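(* There exist an absolute constant $c>0$ and a fixed polynomial $\mathrm{poly}(\cdot)$ such that the following holds for any $\delta\in(0,1]$, $\epsilon>0$, $\alpha>0$ and any positive integers $S,A,O,H,K$ with $$K\ge \mathrm{poly}\left(S,A,O,H,\alpha^{-1},\log(\epsilon^{-1}\delta^{-1})\right)\cdot\epsilon^{-2}.$$ Run the OMLE algorithm (defined in the context) for $K$ episodes with inputs $\alpha$ and $\beta = c\left(H(S^2A+SO)\log(SAOHK)+\log(K/\delta)\right)$. Then for any POMDP with $S$ states, $A$ actions, $O$ observations and horizon $H$ satisfying $\min_{h\in[H]}\sigma_S(\mathbb{O}_h)\ge\alpha$, with probability at least $1-\delta$, the uniform mixture of the policies $\pi^1,\dots,\pi^K$ executed by OMLE is $\epsilon$-optimal, i.e. $$\frac1K\sum_{k=1}^K V^{\pi^k}\ge V^\star-\epsilon.$$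
   Context: Notation: $[n]=\{1,\dots,n\}$; $\Delta_X$ is the set of probability distributions on a finite set $X$; $\sigma_j(M)$ is the $j$-th largest singular value of $M$ (equal to $0$ if $M$ has fewer than $j$ rows or columns). POMDP: a tuple $(\mathscr S,\mathscr A,\mathscr O;H,\mu_1,\mathbb T,\mathbb O;r)$ with finite sets of states, actions, observations of sizes $S,A,O$; horizon $H$; initial state distribution $\mu_1\in\Delta_{\mathscr S}$; transition matrices $\mathbb T_{h,a}\in\mathbb R^{S\times S}$ ($h\in[H-1],a\in\mathscr A$), where $\mathbb T_{h,a}(\cdot\mid s)$ (column $s$) is the distribution of the next state; emission matrices $\mathbb O_h\in\mathbb R^{O\times S}$ ($h\in[H]$), where $\mathbb O_h(\cdot\mid s)$ (column $s$) is the distribution of the observation; known rewards $r_h:\mathscr O\to[0,1]$. In an episode $s_1\sim\mu_1$; at step $h$ the learner sees $o_h\sim\mathbb O_h(\cdot\mid s_h)$, receives $r_h(o_h)$, takes $a_h$, and $s_{h+1}\sim\mathbb T_{h,a_h}(\cdot\mid s_h)$; the episode ends after $a_H$. States are never observed. A policy is $\pi=\{\pi_h\}_{h=1}^H$ with $\pi_h:(\mathscr O\times\mathscr A)^{h-1}\times\mathscr O\to\Delta_{\mathscr A}$. $V^\pi=\mathbb E_\pi[\sum_{h=1}^H r_h(o_h)]$, $V^\star=\sup_\pi V^\pi$. Values without a model argument refer to the true POMDP. Models: $\theta=(\mathbb T,\mathbb O,\mu_1)$, and $\Theta$ is the set of all such parameters for the given $S,A,O,H$; $V^\pi(\theta)$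 is the value of $\pi$ under $\theta$, $\mathbb O_h(\theta)$ its emission matrices, and $\mathbb P^\pi_\theta(\tau)$ the probability of the full trajectory $\tau=(o_1,a_1,\dots,o_H,a_H)$ under $\pi$ and $\theta$. OMLE algorithm with inputs $\alpha,\beta$: set $\mathcal B^1=\{\hat\theta\in\Theta:\min_h\sigma_S(\mathbb O_h(\hat\theta))\ge\alpha\}$ and $\mathcal D=\emptyset$. For $k=1,\dots,K$: compute $(\theta^k,\pi^k)\in\arg\max_{\hat\theta\in\mathcal B^k,\pi}V^\pi(\hat\theta)$ (ties broken by a fixed deterministic rule; if $\mathcal B^k=\emptyset$ the choice is arbitrary); execute $\pi^k$ in the true POMDP for one episode to collect a trajectory $\tau^k$; add $(\pi^k,\tau^k)$ to $\mathcal D$ and set $$\mathcal B^{k+1}=\Big\{\hat\theta\in\Theta:\sum_{(\pi,\tau)\in\mathcal D}\log\mathbb P^\pi_{\hat\theta}(\tau)\ge\max_{\theta'\in\Theta}\sum_{(\pi,\tau)\in\mathcal D}\log\mathbb P^\pi_{\theta'}(\tau)-\beta\Big\}\cap\mathcal B^1.$$ *)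

theory Defs
  imports
    "HOL-Analysis.Weierstrass_Theorems"
    "HOL-Probability.Probability_Mass_Function"
    "HOL-Library.Extended_Real"
    "Jordan_Normal_Form.Char_Poly"
begin

text \<open>
  States, actions and observations are the elements of \<open>{..<S}\<close>, \<open>{..<A}\<close> and \<open>{..<Ob}\<close>;
  steps are numbered from 1 to \<open>H\<close>.
\<close>

text \<open>
  The singular values of \<open>M\<close> are the square roots of the eigenvalues of \<open>M\<^sup>T M\<close>, counted with
  algebraic multiplicity. That matrix is positive semidefinite, so its characteristic polynomial
  splits over the reals and \<open>proots\<close> yields all \<open>dim_col M\<close> of its eigenvalues.
\<close>

definition singular_value :: "nat \<Rightarrow> real mat \<Rightarrow> real" where
  "singular_value j M =
    (if 1 \<le> j \<and> j \<le> dim_row M \<and> j \<le> dim_col M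
     then sqrt (rev (sorted_list_of_multiset (proots (char_poly (transpose_mat M * M)))) ! (j - 1))
     else 0)"

text \<open>
  \<open>trans_prob \<theta> h a s\<close> is column \<open>s\<close> of the transition matrix of action \<open>a\<close> at step \<open>h\<close>, and
  \<open>emit_prob \<theta> h s\<close> is column \<open>s\<close> of the emission matrix at step \<open>h\<close>.
\<close>

record model =
  init_prob :: "nat pmf"
  trans_prob :: "nat \<Rightarrow> nat \<Rightarrow> nat \<Rightarrow> nat pmf"
  emit_prob :: "nat \<Rightarrow> nat \<Rightarrow> nat pmf"

definition models :: "nat \<Rightarrow> nat \<Rightarrow> nat \<Rightarrow> nat \<Rightarrow> model set" where
  "models S A Ob H = {\<theta>.
     set_pmf (init_prob \<theta>) \<subseteq> {..<S} \<and>
     (\<forall>h\<in>{1..<H}. \<forall>a<A. \<forall>s<S. set_pmf (trans_prob \<theta> h a s) \<subseteq> {..<S}) \<and>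
     (\<forall>h\<in>{1..H}. \<forall>s<S. set_pmf (emit_prob \<theta> h s) \<subseteq> {..<Ob})}"

definition emission_matrix :: "nat \<Rightarrow> nat \<Rightarrow> model \<Rightarrow> nat \<Rightarrow> real mat" where
  "emission_matrix S Ob \<theta> h = mat Ob S (\<lambda>(i, s). pmf (emit_prob \<theta> h s) i)"

definition min_singular_value :: "nat \<Rightarrow> nat \<Rightarrow> nat \<Rightarrow> model \<Rightarrow> real" where
  "min_singular_value S Ob H \<theta> = (MIN h\<in>{1..H}. singular_value S (emission_matrix S Ob \<theta> h))"

definition reward_functions :: "nat \<Rightarrow> nat \<Rightarrow> (nat \<Rightarrow> nat \<Rightarrow> real) set" where
  "reward_functions Ob H = {r. \<forall>h\<in>{1..H}. \<forall>i<Ob. r h i \<in> {0..1}}"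

type_synonym trajectory = "(nat \<times> nat) list"
type_synonym policy = "nat \<Rightarrow> trajectory \<Rightarrow> nat \<Rightarrow> nat pmf"

text \<open>The components of a trajectory are pairs of an observation and an action, in temporal order.\<close>

definition histories :: "nat \<Rightarrow> nat \<Rightarrow> nat \<Rightarrow> trajectory set" where
  "histories A Ob n = {\<tau>. length \<tau> = n \<and> set \<tau> \<subseteq> {..<Ob} \<times> {..<A}}"

definition policies :: "nat \<Rightarrow> nat \<Rightarrow> nat \<Rightarrow> policy set" where
  "policies A Ob H =
     {\<pi>. \<forall>h\<in>{1..H}. \<forall>\<tau>\<in>histories A Ob (h - 1). \<forall>i<Ob. set_pmf (\<pi> h \<tau> i) \<subseteq> {..<A}}"

text \<open>
  \<open>rollout \<theta> \<pi> n h \<tau> s\<close> is the law of the full trajectory when the process is in state \<open>s\<close> at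
  step \<open>h\<close>, with past \<open>\<tau>\<close>, and \<open>n\<close> further steps follow step \<open>h\<close>.
\<close>

primrec rollout ::
  "model \<Rightarrow> policy \<Rightarrow> nat \<Rightarrow> nat \<Rightarrow> trajectory \<Rightarrow> nat \<Rightarrow> trajectory pmf" where
  "rollout \<theta> \<pi> 0 h \<tau> s =
     bind_pmf (emit_prob \<theta> h s) (\<lambda>i.
     bind_pmf (\<pi> h \<tau> i) (\<lambda>a.
     return_pmf (\<tau> @ [(i, a)])))"
| "rollout \<theta> \<pi> (Suc n) h \<tau> s =
     bind_pmf (emit_prob \<theta> h s) (\<lambda>i.
     bind_pmf (\<pi> h \<tau> i) (\<lambda>a.
     bind_pmf (trans_prob \<theta> h a s) (\<lambda>s'.
     rollout \<theta> \<pi> n (Suc h) (\<tau> @ [(i, a)]) s')))"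

definition traj_pmf :: "nat \<Rightarrow> model \<Rightarrow> policy \<Rightarrow> trajectory pmf" where
  "traj_pmf H \<theta> \<pi> = bind_pmf (init_prob \<theta>) (rollout \<theta> \<pi> (H - 1) 1 [])"

definition policy_value ::
  "nat \<Rightarrow> (nat \<Rightarrow> nat \<Rightarrow> real) \<Rightarrow> model \<Rightarrow> policy \<Rightarrow> real" where
  "policy_value H r \<theta> \<pi> =
     measure_pmf.expectation (traj_pmf H \<theta> \<pi>) (\<lambda>\<tau>. \<Sum>h=1..H. r h (fst (\<tau> ! (h - 1))))"

definition optimal_value ::
  "nat \<Rightarrow> nat \<Rightarrow> nat \<Rightarrow> (nat \<Rightarrow> nat \<Rightarrow> real) \<Rightarrow> model \<Rightarrow> real" where
  "optimal_value A Ob H r \<theta> = (SUP \<pi>\<in>policies A Ob H. policy_value H r \<theta> \<pi>)"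

text \<open>
  The real function \<open>ln\<close> takes the value 0 at 0, so likelihoods need a logarithm with values in
  the extended reals. A dataset is a list, in order of collection; the supremum in
  \<open>confidence_set\<close> is a maximum because \<open>models\<close> is compact in the parameters that matter.
\<close>

definition eln :: "real \<Rightarrow> ereal" where
  "eln x = (if x > 0 then ereal (ln x) else -\<infinity>)"

type_synonym dataset = "(policy \<times> trajectory) list"

definition log_likelihood :: "nat \<Rightarrow> model \<Rightarrow> dataset \<Rightarrow> ereal" where
  "log_likelihood H \<theta> D = (\<Sum>(\<pi>, \<tau>)\<leftarrow>D. eln (pmf (traj_pmf H \<theta> \<pi>) \<tau>))"

definition initial_set :: "nat \<Rightarrow> nat \<Rightarrow> nat \<Rightarrow> nat \<Rightarrow> real \<Rightarrow> model set" where
  "initial_set S A Ob H \<alpha> = {\<theta> \<in> models S A Ob H. min_singular_value S Ob H \<theta> \<ge> \<alpha>}"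

definition confidence_set ::
  "nat \<Rightarrow> nat \<Rightarrow> nat \<Rightarrow> nat \<Rightarrow> real \<Rightarrow> real \<Rightarrow> dataset \<Rightarrow> model set" where
  "confidence_set S A Ob H \<alpha> \<beta> D =
     (if D = [] then initial_set S A Ob H \<alpha>
      else {\<theta> \<in> models S A Ob H.
              log_likelihood H \<theta> D \<ge> (SUP \<theta>'\<in>models S A Ob H. log_likelihood H \<theta>' D) - ereal \<beta>}
           \<inter> initial_set S A Ob H \<alpha>)"

text \<open>
  A selection rule determines the pair \<open>(\<theta>\<^sup>k, \<pi>\<^sup>k)\<close> from the data collected before episode \<open>k\<close>.
  Only well-formed datasets are considered.
\<close>

definition omle_rule ::
  "nat \<Rightarrow> nat \<Rightarrow> nat \<Rightarrow> nat \<Rightarrow> (nat \<Rightarrow> nat \<Rightarrow> real) \<Rightarrow> real \<Rightarrow> real \<Rightarrow>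
     (dataset \<Rightarrow> model \<times> policy) \<Rightarrow> bool" where
  "omle_rule S A Ob H r \<alpha> \<beta> sel \<longleftrightarrow>
     (\<forall>D\<in>lists (policies A Ob H \<times> histories A Ob H).
        sel D \<in> models S A Ob H \<times> policies A Ob H \<and>
        (confidence_set S A Ob H \<alpha> \<beta> D \<noteq> {} \<longrightarrow>
           is_arg_max (\<lambda>(\<theta>, \<pi>). policy_value H r \<theta> \<pi>)
             (\<lambda>x. x \<in> confidence_set S A Ob H \<alpha> \<beta> D \<times> policies A Ob H) (sel D)))"

text \<open>The law of the dataset after a number of episodes executed in the true model \<open>\<theta>\<close>.\<close>

primrec omle_run :: "nat \<Rightarrow> model \<Rightarrow> (dataset \<Rightarrow> model \<times> policy) \<Rightarrow> nat \<Rightarrow> dataset pmf" where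
  "omle_run H \<theta> sel 0 = return_pmf []"
| "omle_run H \<theta> sel (Suc k) =
     bind_pmf (omle_run H \<theta> sel k) (\<lambda>D.
       let \<pi> = snd (sel D) in map_pmf (\<lambda>\<tau>. D @ [(\<pi>, \<tau>)]) (traj_pmf H \<theta> \<pi>))"

definition omle_beta :: "real \<Rightarrow> nat \<Rightarrow> nat \<Rightarrow> nat \<Rightarrow> nat \<Rightarrow> nat \<Rightarrow> real \<Rightarrow> real" where
  "omle_beta c S A Ob H K \<delta> =
     c * (real H * (real S ^ 2 * real A + real S * real Ob) * ln (real (S * A * Ob * H * K))
          + ln (real K / \<delta>))"

end

theory Submission
  imports Defs
begin

text \<open>
  A maximum likelihood argument over a finite cover of the models shows that, with high probability,
  the true model stays in every confidence set, and every model in the confidence set of episode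
  \<open>k\<close> has trajectory laws close to the true ones under all earlier policies. By optimism the
  regret of episode \<open>k\<close> is at most \<open>H\<close> times the distance of these laws under the new policy.
  The emission matrices of a candidate model have bounded left inverses. Hence this distance is
  bounded, above and below up to polynomial factors, by finitely many seminorms
  \<open>\<Sum>\<tau>. \<bar>w \<bullet> x(\<tau>)\<bar>\<close>, where \<open>w\<close> depends only on the candidate model and \<open>x(\<tau>)\<close> only on
  the true model and the policy. An elliptical potential argument in dimension \<open>S\<close> then turns
  closeness under the past policies into a sublinear sum of the distances under the new ones.
\<close>

section \<open>The least singular value and left inverses\<close>

text \<open>Histories are exponentially many and every round plays a new policy, so a pigeonhole
  argument needs a space of small dimension shared by all rounds; the latent states of the true
  model provide it. Errors are carried forward by the candidate's own stochastic operators, which do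
  not enlarge l1 norms, so no factor exponential in H arises. The cover is measured by one-sided
  ratios of probabilities and not by a distance, because log-likelihoods are unbounded near
  probability 0; a ratio exp(1/K) per episode costs a factor e over the whole run. A union bound
  over this cover and over K prefixes of the run explains the shape of \<beta>. As \<beta> contains
  log K, the condition on the sample size is implicit in K and has to be resolved at the end.

  The entry above contains a malformed symbol. The complete list below replaces it.\<close>

lemma le_one_of_square_le:
  fixes x :: real
  assumes "x\<^sup>2 \<le> x"
  shows "x \<le> 1"
proof (rule ccontr)
  assume "\<not> x \<le> 1"
  then have "1 * x < x * x" by (intro mult_strict_right_mono) auto
  then show False using assms by (simp add: power2_eq_square)
qed

text \<open>First-order optimality: at a minimiser, a perturbation of size \<open>t\<close> changes
  the objective by such a quadratic.\<close>

lemma linear_term_vanishes: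
  fixes b c :: real
  assumes "\<And>t. 0 \<le> 2 * t * b + t\<^sup>2 * c"
  shows "b = 0"
proof (rule ccontr)
  assume b: "b \<noteq> 0"
  define C where "C = \<bar>c\<bar> + 1"
  have C: "C > 0" "c < C" by (auto simp: C_def)
  have "0 \<le> 2 * (- b / C) * b + (- b / C)\<^sup>2 * c" by (rule assms)
  also have "\<dots> = b\<^sup>2 / C\<^sup>2 * (c - 2 * C)"
    using C by (simp add: field_simps power2_eq_square)
  finally have "0 \<le> b\<^sup>2 / C\<^sup>2 * (c - 2 * C)" .
  moreover have "b\<^sup>2 / C\<^sup>2 * (c - 2 * C) < 0"
    using b C by (intro mult_pos_neg) auto
  ultimately show False by linarith
qed

text \<open>The quadratic form attains its minimum on the unit sphere by compactness, first-order
  optimality makes the minimiser an eigenvector, and homogeneity extends the minimum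
  \<open>m\<close> to a bound on all vectors. This ties the algebraic eigenvalues in
  \<open>singular_value\<close> to norms.\<close>

lemma symmetric_rayleigh_minimizer:
  fixes a :: "nat \<Rightarrow> nat \<Rightarrow> real"
  assumes sym: "\<And>i j. i < n \<Longrightarrow> j < n \<Longrightarrow> a i j = a j i" and n: "0 < n"
  obtains m x where "\<exists>i<n. x i \<noteq> 0" "\<And>i. i < n \<Longrightarrow> (\<Sum>j<n. a i j * x j) = m * x i"
    "\<And>y. m * (\<Sum>i<n. (y i)\<^sup>2) \<le> (\<Sum>i<n. \<Sum>j<n. y i * a i j * y j)"
proof -
  define Q where "Q y = (\<Sum>i<n. \<Sum>j<n. y i * a i j * y j)" for y :: "nat \<Rightarrow> real"
  define N where "N y = (\<Sum>i<n. (y i)\<^sup>2)" for y :: "nat \<Rightarrow> real"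
  \<comment> \<open>Coordinates beyond \<open>n\<close> are pinned to 0, so that the box is compact
    in the product topology on all functions.\<close>
  define F where "F i = (if i < n then {-1..1::real} else {0})" for i :: nat
  define B where "B = PiE UNIV F \<inter> {x. N x = 1}"
  have cont: "continuous_on A Q" "continuous_on A N" for A
    unfolding Q_def N_def
    by (intro continuous_intros continuous_on_subset[OF continuous_on_product_coordinates]; simp)+
  have "compactin (product_topology (\<lambda>i::nat. euclidean :: real topology) UNIV) (PiE UNIV F)"
    unfolding compactin_PiE by (auto simp: F_def)
  then have "compact (PiE UNIV F)"
    by (simp add: euclidean_product_topology)
  moreover have "closed {x. N x = 1}"
    using cont(2)[of UNIV] by (intro closed_Collect_eq continuous_on_const) auto
  ultimately have B: "compact B" unfolding B_def by (rule compact_Int_closed)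
  have "(\<lambda>i. if i = 0 then 1 else 0) \<in> B"
    using n by (auto simp: B_def F_def N_def if_distrib[of "\<lambda>x. x\<^sup>2"] sum.delta cong: if_cong)
  then have "B \<noteq> {}" by auto
  with B cont obtain x where x: "x \<in> B" "\<And>y. y \<in> B \<Longrightarrow> Q x \<le> Q y"
    using continuous_attains_inf[of B Q] by blast
  define m where "m = Q x"
  have Nx: "N x = 1" using x by (simp add: B_def)
  have low: "m * N y \<le> Q y" for y
  proof (cases "N y = 0")
    case True
    then have "\<forall>i<n. y i = 0"
      unfolding N_def by (subst (asm) sum_nonneg_eq_0_iff) auto
    then show ?thesis using True by (simp add: Q_def)
  next
    case False
    have pos: "N y > 0" using False unfolding N_def
      by (metis less_eq_real_def sum_nonneg zero_le_power2)
    define c where "c = 1 / sqrt (N y)"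
    define z where "z i = (if i < n then c * y i else 0)" for i
    have c2: "c\<^sup>2 * N y = 1" using pos by (simp add: c_def power_divide)
    have Nz: "N z = 1"
      using c2 by (simp add: N_def z_def power_mult_distrib sum_distrib_left)
    have "\<bar>z i\<bar> \<le> 1" if "i < n" for i
    proof -
      have "(z i)\<^sup>2 \<le> N z" unfolding N_def using that by (intro member_le_sum) auto
      then show ?thesis using Nz by (simp add: abs_square_le_1)
    qed
    then have "z \<in> B" using Nz by (auto simp: B_def F_def z_def abs_le_iff)
    then have "m \<le> Q z" using x by (simp add: m_def)
    also have "Q z = c\<^sup>2 * Q y"
      by (simp add: Q_def z_def sum_distrib_left power2_eq_square ac_simps)
    finally have "m * N y \<le> c\<^sup>2 * Q y * N y" using pos by (simp add: mult_right_mono)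
    also have "\<dots> = Q y" using c2 by (metis mult.assoc mult.commute mult_1)
    finally show ?thesis .
  qed
  have eig: "(\<Sum>j<n. a i j * x j) = m * x i" if i: "i < n" for i
  proof -
    have "0 \<le> 2 * t * ((\<Sum>j<n. a i j * x j) - m * x i) + t\<^sup>2 * (a i i - m)" for t
    proof -
      \<comment> \<open>Only coordinate \<open>i\<close> is perturbed; the form minus
        \<open>m\<close> times the squared norm is nonnegative and vanishes at
        \<open>x\<close>.\<close>
      define d where "d j = (if j = i then t else 0)" for j
      have "Q (\<lambda>j. x j + d j) = Q x + (\<Sum>k<n. \<Sum>j<n. d k * a k j * x j)
          + (\<Sum>k<n. \<Sum>j<n. x k * a k j * d j) + (\<Sum>k<n. \<Sum>j<n. d k * a k j * d j)"
        unfolding Q_def by (simp add: algebra_simps sum.distrib)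
      also have "(\<Sum>k<n. \<Sum>j<n. d k * a k j * x j) = t * (\<Sum>j<n. a i j * x j)"
      proof -
        have "(\<Sum>k<n. \<Sum>j<n. d k * a k j * x j) = (\<Sum>k<n. if k = i then t * (\<Sum>j<n. a i j * x j) else 0)"
          by (intro sum.cong) (auto simp: d_def sum_distrib_left ac_simps)
        then show ?thesis using i by simp
      qed
      also have "(\<Sum>k<n. \<Sum>j<n. x k * a k j * d j) = t * (\<Sum>j<n. a i j * x j)"
      proof -
        have "(\<Sum>k<n. \<Sum>j<n. x k * a k j * d j) = (\<Sum>k<n. \<Sum>j<n. if j = i then x k * a k i * t else 0)"
          by (intro sum.cong) (auto simp: d_def)
        also have "\<dots> = (\<Sum>k<n. x k * a k i * t)" using i by simp
        also have "\<dots> = t * (\<Sum>j<n. a i j * x j)"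
          unfolding sum_distrib_left by (intro sum.cong) (auto simp: sym i)
        finally show ?thesis .
      qed
      also have "(\<Sum>k<n. \<Sum>j<n. d k * a k j * d j) = t\<^sup>2 * a i i"
      proof -
        have "(\<Sum>k<n. \<Sum>j<n. d k * a k j * d j) = (\<Sum>k<n. \<Sum>j<n. if j = i then (if k = i then t\<^sup>2 * a i i else 0) else 0)"
          by (intro sum.cong) (auto simp: d_def power2_eq_square)
        then show ?thesis using i by simp
      qed
      finally have 1: "Q (\<lambda>j. x j + d j) = Q x + 2 * t * (\<Sum>j<n. a i j * x j) + t\<^sup>2 * a i i"
        by simp
      have "N (\<lambda>j. x j + d j) = N x + (\<Sum>j<n. if j = i then 2 * t * x i + t\<^sup>2 else 0)"
        unfolding N_def sum.distrib[symmetric]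
        by (intro sum.cong) (auto simp: d_def power2_eq_square algebra_simps)
      then have 2: "N (\<lambda>j. x j + d j) = 1 + 2 * t * x i + t\<^sup>2" using i Nx by simp
      have "m * N (\<lambda>j. x j + d j) \<le> Q (\<lambda>j. x j + d j)" by (rule low)
      then show ?thesis unfolding 1 2 by (simp add: m_def algebra_simps)
    qed
    from linear_term_vanishes[OF this] show ?thesis by simp
  qed
  have "\<exists>i<n. x i \<noteq> 0"
  proof (rule ccontr)
    assume "\<not> ?thesis"
    then have "N x = 0" unfolding N_def by (intro sum.neutral) auto
    then show False using Nx by simp
  qed
  then show ?thesis by (rule that[OF _ eig low[unfolded Q_def N_def]])
qed

text \<open>The Hermitian form \<open>Z\<close> is its own conjugate by symmetry, and it is
  \<open>c\<close> times the positive number \<open>N\<close>.\<close>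

lemma symmetric_complex_eigenvalue_real:
  fixes a :: "nat \<Rightarrow> nat \<Rightarrow> real" and v :: "nat \<Rightarrow> complex"
  assumes sym: "\<And>i j. i < n \<Longrightarrow> j < n \<Longrightarrow> a i j = a j i"
    and eig: "\<And>i. i < n \<Longrightarrow> (\<Sum>j<n. of_real (a i j) * v j) = c * v i"
    and nz: "\<exists>i<n. v i \<noteq> 0"
  shows "c = of_real (Re c)"
proof -
  define N where "N = (\<Sum>i<n. (cmod (v i))\<^sup>2)"
  define Z where "Z = (\<Sum>i<n. \<Sum>j<n. cnj (v i) * of_real (a i j) * v j)"
  have "N \<noteq> 0"
    unfolding N_def using nz by (subst sum_nonneg_eq_0_iff) auto
  have Z: "Z = c * of_real N"
  proof -
    have "Z = (\<Sum>i<n. cnj (v i) * (\<Sum>j<n. of_real (a i j) * v j))"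
      by (simp add: Z_def sum_distrib_left ac_simps)
    also have "\<dots> = (\<Sum>i<n. c * of_real ((cmod (v i))\<^sup>2))"
    proof (intro sum.cong refl)
      fix i assume "i \<in> {..<n}"
      then show "cnj (v i) * (\<Sum>j<n. of_real (a i j) * v j) = c * of_real ((cmod (v i))\<^sup>2)"
        by (subst eig) (simp_all only: lessThan_iff complex_norm_square ac_simps)
    qed
    finally show ?thesis by (simp add: N_def sum_distrib_left)
  qed
  have "cnj Z = (\<Sum>i<n. \<Sum>j<n. cnj (v j) * of_real (a i j) * v i)"
    by (simp add: Z_def ac_simps)
  also have "\<dots> = (\<Sum>j<n. \<Sum>i<n. cnj (v j) * of_real (a i j) * v i)"
    by (rule sum.swap)
  also have "\<dots> = Z"
    unfolding Z_def by (intro sum.cong) (auto simp: sym)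
  finally have "cnj c * of_real N = c * of_real N" using Z by simp
  then have "cnj c = c" using \<open>N \<noteq> 0\<close> by simp
  then show ?thesis by (simp add: complex_eq_iff)
qed

lemma mult_mat_vec_index_sum:
  fixes A :: "'a :: comm_semiring_0 mat"
  assumes "A \<in> carrier_mat n m" "v \<in> carrier_vec m" "i < n"
  shows "(A *\<^sub>v v) $ i = (\<Sum>j<m. A $$ (i, j) * v $ j)"
  using assms by (simp add: scalar_prod_def atLeast0LessThan)

text \<open>Over the reals \<open>proots\<close> sees only real roots, so the index in
  \<open>singular_value\<close> points to the intended eigenvalue only if none is missing. The
  polynomial is factored over the complex numbers, its roots are shown to be real, and the
  factorisation is pulled back along the injective embedding.\<close>

lemma symmetric_char_poly_splits:
  fixes A :: "real mat"
  assumes A: "A \<in> carrier_mat n n" and sym: "\<And>i j. i < n \<Longrightarrow> j < n \<Longrightarrow> A $$ (i, j) = A $$ (j, i)"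
  obtains as where "char_poly A = (\<Prod>a\<leftarrow>as. [:- a, 1:])" "length as = n"
proof -
  let ?C = "map_mat complex_of_real A"
  interpret P: map_poly_inj_comm_ring_hom complex_of_real ..
  have C: "?C \<in> carrier_mat n n" using A by simp
  obtain bs where bs: "char_poly ?C = (\<Prod>a\<leftarrow>bs. [:- a, 1:])" "length bs = n"
    using char_poly_factorized[OF C] by auto
  have real: "b = of_real (Re b)" if "b \<in> set bs" for b
  proof -
    have "poly (char_poly ?C) b = 0"
      unfolding bs poly_prod_list using that by (auto simp: prod_list_zero_iff intro!: image_eqI)
    then have "eigenvalue ?C b" by (simp add: eigenvalue_root_char_poly[OF C])
    then obtain v where v: "v \<in> carrier_vec n" "v \<noteq> 0\<^sub>v n" "?C *\<^sub>v v = b \<cdot>\<^sub>v v"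
      using C by (auto simp: eigenvalue_def eigenvector_def)
    have "(\<Sum>j<n. of_real (A $$ (i, j)) * v $ j) = b * v $ i" if i: "i < n" for i
    proof -
      have "(?C *\<^sub>v v) $ i = (\<Sum>j<n. of_real (A $$ (i, j)) * v $ j)"
        using i A v(1) by (simp add: scalar_prod_def atLeast0LessThan)
      then show ?thesis using v i by simp
    qed
    moreover have "\<exists>i<n. v $ i \<noteq> 0"
    proof (rule ccontr)
      assume "\<not> ?thesis"
      then have "v = 0\<^sub>v n" using v(1) by (intro eq_vecI) auto
      then show False using v by simp
    qed
    ultimately show ?thesis
      by (intro symmetric_complex_eigenvalue_real[where a = "\<lambda>i j. A $$ (i, j)" and v = "\<lambda>i. v $ i"])
        (auto intro: sym)
  qed
  define as where "as = map Re bs"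
  have "map_poly complex_of_real (char_poly A) = char_poly ?C"
    by (rule of_real_hom.char_poly_hom[OF A, symmetric])
  also have "\<dots> = (\<Prod>b\<leftarrow>bs. map_poly of_real [:- Re b, 1:])"
    unfolding bs by (intro arg_cong[of _ _ prod_list] map_cong refl) (use real in auto)
  also have "\<dots> = map_poly of_real (\<Prod>a\<leftarrow>as. [:- a, 1:])"
    unfolding as_def P.hom_prod_list by (simp add: o_def)
  finally have "char_poly A = (\<Prod>a\<leftarrow>as. [:- a, 1:])" by (rule P.injectivity)
  moreover have "length as = n" using bs(2) by (simp add: as_def)
  ultimately show ?thesis by (rule that)
qed

lemma proots_prod_list_linear:
  "proots (\<Prod>a\<leftarrow>as. [:- a, 1:]) = mset (as :: 'a :: idom list)"
proof (induction as)
  case (Cons a as)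
  have "(\<Prod>a\<leftarrow>as. [:- a, 1:]) \<noteq> 0" by (auto simp: prod_list_zero_iff)
  then show ?case using Cons by (simp add: proots_mult del: mult_pCons_left)
qed simp

lemma gram_quadratic_form:
  fixes F :: "nat \<Rightarrow> nat \<Rightarrow> real"
  shows "(\<Sum>i<n. x i * (\<Sum>j<n. (\<Sum>k<r. F k i * F k j) * x j)) = (\<Sum>k<r. (\<Sum>s<n. F k s * x s)\<^sup>2)"
proof -
  have "(\<Sum>i<n. x i * (\<Sum>j<n. (\<Sum>k<r. F k i * F k j) * x j)) =
      (\<Sum>i<n. \<Sum>j<n. \<Sum>k<r. (F k i * x i) * (F k j * x j))"
    by (simp add: sum_distrib_left sum_distrib_right ac_simps)
  also have "\<dots> = (\<Sum>i<n. \<Sum>k<r. \<Sum>j<n. (F k i * x i) * (F k j * x j))"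
    by (intro sum.cong sum.swap refl)
  also have "\<dots> = (\<Sum>k<r. \<Sum>i<n. \<Sum>j<n. (F k i * x i) * (F k j * x j))"
    by (rule sum.swap)
  finally show ?thesis by (simp add: power2_eq_square sum_product)
qed

text \<open>The \<open>c\<close>-th largest of \<open>c\<close> eigenvalues is the least one, and
  the Rayleigh minimum \<open>m\<close> is itself a root, hence at least as large. So \<alpha>^2 is
  at most \<open>m\<close>, which bounds the Gram form from below.\<close>

lemma least_singular_value_lower_bound:
  assumes M: "M \<in> carrier_mat r c" and c: "0 < c" and sv: "\<alpha> \<le> singular_value c M" and \<alpha>: "0 < \<alpha>"
  shows "\<alpha>\<^sup>2 * (\<Sum>i<c. (x i)\<^sup>2) \<le> (\<Sum>k<r. (\<Sum>i<c. M $$ (k, i) * x i)\<^sup>2)"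
proof -
  let ?A = "transpose_mat M * M"
  have A: "?A \<in> carrier_mat c c" using M by auto
  have Aij: "?A $$ (i, j) = (\<Sum>k<r. M $$ (k, i) * M $$ (k, j))" if "i < c" "j < c" for i j
    using that M by (auto simp: scalar_prod_def atLeast0LessThan)
  have sym: "?A $$ (i, j) = ?A $$ (j, i)" if "i < c" "j < c" for i j
    using that by (simp add: Aij mult.commute)
  obtain as where as: "char_poly ?A = (\<Prod>a\<leftarrow>as. [:- a, 1:])" "length as = c"
    by (rule symmetric_char_poly_splits[OF A sym])
  obtain m z where m: "\<exists>i<c. z i \<noteq> 0" "\<And>i. i < c \<Longrightarrow> (\<Sum>j<c. ?A $$ (i, j) * z j) = m * z i"
    "\<And>y. m * (\<Sum>i<c. (y i)\<^sup>2) \<le> (\<Sum>i<c. \<Sum>j<c. y i * ?A $$ (i, j) * y j)"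
    by (rule symmetric_rayleigh_minimizer[of c "\<lambda>i j. ?A $$ (i, j)"]) (rule sym c that; assumption)+
  have "eigenvector ?A (vec c z) m"
    unfolding eigenvector_def
  proof (intro conjI)
    show "?A *\<^sub>v vec c z = m \<cdot>\<^sub>v vec c z"
    proof (intro eq_vecI)
      fix i assume "i < dim_vec (m \<cdot>\<^sub>v vec c z)"
      then have i: "i < c" by simp
      have "(?A *\<^sub>v vec c z) $ i = (\<Sum>j<c. ?A $$ (i, j) * z j)"
        using mult_mat_vec_index_sum[OF A _ i, of "vec c z"] by simp
      then show "(?A *\<^sub>v vec c z) $ i = (m \<cdot>\<^sub>v vec c z) $ i" using m(2)[OF i] i by simp
    qed (use A in auto)
    show "vec c z \<noteq> 0\<^sub>v (dim_row ?A)"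
    proof
      assume "vec c z = 0\<^sub>v (dim_row ?A)"
      then have "\<forall>i<c. z i = 0" using M by (metis A carrier_matD(1) index_vec index_zero_vec(1))
      then show False using m(1) by auto
    qed
  qed (use M in auto)
  then have "poly (char_poly ?A) m = 0"
    by (simp add: eigenvalue_root_char_poly[OF A, symmetric] eigenvalue_def) blast
  then have "m \<in> set as"
    unfolding as poly_prod_list by (auto simp: prod_list_zero_iff)
  then have "m \<in> set (sort as)" by simp
  then have "sort as ! 0 \<le> m"
    by (metis in_set_conv_nth sorted_nth_mono sorted_sort zero_le)
  \<comment> \<open>With fewer rows than columns \<open>singular_value\<close> would be 0 by
    definition, against \<open>0 < \<alpha>\<close>.\<close>
  have "c \<le> r"
    using sv \<alpha> M by (auto simp: singular_value_def split: if_splits)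
  then have "singular_value c M = sqrt (sort as ! 0)"
    using M c as by (simp add: singular_value_def proots_prod_list_linear rev_nth)
  then have "\<alpha> \<le> sqrt (sort as ! 0)" using sv by simp
  then have "\<alpha>\<^sup>2 \<le> sort as ! 0"
  proof -
    \<comment> \<open>\<open>sqrt\<close> is negative at negative arguments, so positivity of the
      root is what allows squaring to undo it.\<close>
    have "0 < sqrt (sort as ! 0)" using \<open>\<alpha> \<le> sqrt (sort as ! 0)\<close> \<alpha> by linarith
    then have "(sqrt (sort as ! 0))\<^sup>2 = sort as ! 0" by simp
    moreover have "\<alpha>\<^sup>2 \<le> (sqrt (sort as ! 0))\<^sup>2"
      using \<open>\<alpha> \<le> sqrt (sort as ! 0)\<close> \<alpha> by (intro power_mono) auto
    ultimately show ?thesis by simp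
  qed
  then have "\<alpha>\<^sup>2 \<le> m" using \<open>sort as ! 0 \<le> m\<close> by simp
  then have "\<alpha>\<^sup>2 * (\<Sum>i<c. (x i)\<^sup>2) \<le> m * (\<Sum>i<c. (x i)\<^sup>2)"
    by (intro mult_right_mono sum_nonneg) auto
  also have "\<dots> \<le> (\<Sum>i<c. \<Sum>j<c. x i * ?A $$ (i, j) * x j)" by (rule m)
  also have "\<dots> = (\<Sum>i<c. x i * (\<Sum>j<c. ?A $$ (i, j) * x j))"
    by (simp only: sum_distrib_left mult.assoc)
  also have "\<dots> = (\<Sum>i<c. x i * (\<Sum>j<c. (\<Sum>k<r. M $$ (k, i) * M $$ (k, j)) * x j))"
    by (intro sum.cong refl arg_cong2[where f = "(*)"] Aij) auto
  also have "\<dots> = (\<Sum>k<r. (\<Sum>i<c. M $$ (k, i) * x i)\<^sup>2)" by (rule gram_quadratic_form)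
  finally show ?thesis .
qed

text \<open>\<open>L\<close> is the Moore-Penrose inverse, with \<open>G\<close> the Gram matrix of
  \<open>F\<close>. If y is its column \<open>k\<close>, then G y is row \<open>k\<close> of
  \<open>F\<close>, so \<open>b\<close>, the \<open>k\<close>-th entry of F y, equals |F y|^2. Hence
  b^2 \<le> b, so b \<le> 1, and the lower bound on \<open>F\<close> gives \<alpha>^2 |y|^2 \<le>
  1.\<close>

lemma bounded_left_inverse:
  fixes F :: "nat \<Rightarrow> nat \<Rightarrow> real"
  assumes \<alpha>: "0 < \<alpha>"
    and low: "\<And>x. \<alpha>\<^sup>2 * (\<Sum>s<n. (x s)\<^sup>2) \<le> (\<Sum>k<r. (\<Sum>s<n. F k s * x s)\<^sup>2)"
  obtains L where "\<And>l s. l < n \<Longrightarrow> s < n \<Longrightarrow> (\<Sum>k<r. L l k * F k s) = (if l = s then 1 else 0)"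
    "\<And>l k. l < n \<Longrightarrow> k < r \<Longrightarrow> \<bar>L l k\<bar> \<le> 1 / \<alpha>"
proof -
  define G where "G = mat n n (\<lambda>(i, j). \<Sum>k<r. F k i * F k j)"
  have G: "G \<in> carrier_mat n n" by (simp add: G_def)
  have quad: "(\<Sum>i<n. x i * (\<Sum>j<n. G $$ (i, j) * x j)) = (\<Sum>k<r. (\<Sum>s<n. F k s * x s)\<^sup>2)" for x
    using gram_quadratic_form[where x = x and F = F and n = n and r = r] by (simp add: G_def)
  have "Determinant.det G \<noteq> 0"
  proof
    assume "Determinant.det G = 0"
    then obtain v where v: "v \<in> carrier_vec n" "v \<noteq> 0\<^sub>v n" "G *\<^sub>v v = 0\<^sub>v n"
      using det_0_iff_vec_prod_zero_field[OF G] by auto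
    have Gv: "(\<Sum>j<n. G $$ (i, j) * v $ j) = 0" if i: "i < n" for i
    proof -
      have "(G *\<^sub>v v) $ i = (\<Sum>j<n. G $$ (i, j) * v $ j)"
        using i G v(1) by (simp add: scalar_prod_def atLeast0LessThan)
      then show ?thesis using v i by simp
    qed
    have "\<alpha>\<^sup>2 * (\<Sum>s<n. (v $ s)\<^sup>2) \<le> 0"
      using low[of "\<lambda>s. v $ s"] quad[of "\<lambda>s. v $ s"] Gv by simp
    then have "(\<Sum>s<n. (v $ s)\<^sup>2) \<le> 0"
      using \<alpha> by (simp add: mult_le_0_iff)
    then have "(\<Sum>s<n. (v $ s)\<^sup>2) = 0"
      by (intro antisym sum_nonneg) auto
    then have "\<forall>s<n. v $ s = 0"
      by (subst (asm) sum_nonneg_eq_0_iff) auto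
    then have "v = 0\<^sub>v n" using v(1) by (intro eq_vecI) auto
    then show False using v by simp
  qed
  from det_non_zero_imp_unit[OF G this, of "()"]
  obtain Gi where Gi: "Gi \<in> carrier_mat n n" "Gi * G = 1\<^sub>m n" "G * Gi = 1\<^sub>m n"
    by (auto simp: Units_def ring_mat_def)
  define L where "L l k = (\<Sum>s<n. Gi $$ (l, s) * F k s)" for l k
  have inv: "(\<Sum>k<r. L l k * F k s) = (if l = s then 1 else 0)" if "l < n" "s < n" for l s
  proof -
    have "(\<Sum>k<r. L l k * F k s) = (\<Sum>k<r. \<Sum>t<n. Gi $$ (l, t) * (F k t * F k s))"
      by (simp add: L_def sum_distrib_right mult.assoc)
    also have "\<dots> = (\<Sum>t<n. \<Sum>k<r. Gi $$ (l, t) * (F k t * F k s))" by (rule sum.swap)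
    also have "\<dots> = (\<Sum>t<n. Gi $$ (l, t) * G $$ (t, s))"
      using that by (simp add: G_def sum_distrib_left)
    also have "\<dots> = (Gi * G) $$ (l, s)"
      using that Gi(1) G by (simp add: scalar_prod_def atLeast0LessThan)
    finally show ?thesis using Gi that by simp
  qed
  have bound: "\<bar>L l k\<bar> \<le> 1 / \<alpha>" if l: "l < n" and k: "k < r" for l k
  proof -
    define b where "b = (\<Sum>s<n. F k s * L s k)"
    have GL: "(\<Sum>j<n. G $$ (i, j) * L j k) = F k i" if i: "i < n" for i
    proof -
      have "(\<Sum>j<n. G $$ (i, j) * L j k) = (\<Sum>j<n. \<Sum>s<n. G $$ (i, j) * Gi $$ (j, s) * F k s)"
        by (simp add: L_def sum_distrib_left ac_simps)
      also have "\<dots> = (\<Sum>s<n. \<Sum>j<n. G $$ (i, j) * Gi $$ (j, s) * F k s)" by (rule sum.swap)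
      also have "\<dots> = (\<Sum>s<n. (G * Gi) $$ (i, s) * F k s)"
        using i Gi(1) G by (intro sum.cong) (auto simp: scalar_prod_def atLeast0LessThan sum_distrib_right)
      also have "\<dots> = (\<Sum>s<n. if s = i then F k i else 0)"
        unfolding Gi(3) using i by (intro sum.cong) auto
      finally show ?thesis using i by simp
    qed
    have q: "(\<Sum>k'<r. (\<Sum>s<n. F k' s * L s k)\<^sup>2) = b"
      using quad[of "\<lambda>s. L s k"] GL by (simp add: b_def mult.commute)
    have "b\<^sup>2 \<le> (\<Sum>k'<r. (\<Sum>s<n. F k' s * L s k)\<^sup>2)"
      unfolding b_def using k
      by (intro member_le_sum[where f = "\<lambda>k'. (\<Sum>s<n. F k' s * L s k)\<^sup>2"]) auto
    then have "b\<^sup>2 \<le> b" unfolding q .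
    then have b1: "b \<le> 1"
      by (rule le_one_of_square_le)
    have "\<alpha>\<^sup>2 * (L l k)\<^sup>2 \<le> \<alpha>\<^sup>2 * (\<Sum>s<n. (L s k)\<^sup>2)"
      using l by (intro mult_left_mono member_le_sum) auto
    also have "\<dots> \<le> b" using low[of "\<lambda>s. L s k"] q by simp
    finally have "(\<alpha> * L l k)\<^sup>2 \<le> 1" using b1 by (simp add: power_mult_distrib)
    then have "\<bar>\<alpha> * L l k\<bar> \<le> 1" by (simp add: abs_square_le_1)
    then show ?thesis using \<alpha> by (simp add: abs_mult field_simps)
  qed
  show ?thesis by (rule that[OF inv bound])
qed

section \<open>Elliptical potential\<close>

text \<open>Sylvester's identity det (1 - U V) = det (1 - V U): the bordered matrix with
  off-diagonal blocks \<open>U\<close> and \<open>V\<close> has two factorisations into block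
  triangular matrices, with Schur complements \<open>c\<close> and \<open>X\<close>. The sign in
  \<open>V\<close> turns the minus signs into plus.\<close>

lemma det_identity_plus_rank_one:
  fixes u v :: "nat \<Rightarrow> real"
  shows "Determinant.det (mat n n (\<lambda>(i, j). (if i = j then 1 else 0) + u i * v j)) = 1 + (\<Sum>i<n. u i * v i)"
proof -
  define U where "U = mat n 1 (\<lambda>(i, j). u i)"
  define V where "V = mat 1 n (\<lambda>(i, j). - v j)"
  define X where "X = mat n n (\<lambda>(i, j). (if i = j then 1 else 0) + u i * v j)"
  define c where "c = mat 1 1 (\<lambda>(i::nat, j::nat). 1 + (\<Sum>i<n. u i * v i))"
  have U: "U \<in> carrier_mat n 1" and V: "V \<in> carrier_mat 1 n" and X: "X \<in> carrier_mat n n"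
    and c: "c \<in> carrier_mat 1 1"
    by (auto simp: U_def V_def X_def c_def)
  have XUV: "X + U * V = 1\<^sub>m n"
    by (intro eq_matI) (auto simp: X_def U_def V_def scalar_prod_def)
  have VU: "V * U + c = 1\<^sub>m 1"
    by (intro eq_matI) (auto simp: c_def U_def V_def scalar_prod_def sum_negf atLeast0LessThan mult.commute)
  have "four_block_mat (1\<^sub>m n) (0\<^sub>m n 1) V (1\<^sub>m 1) * four_block_mat (1\<^sub>m n) U (0\<^sub>m 1 n) c
      = four_block_mat (1\<^sub>m n) U V (1\<^sub>m 1)"
    using U V c VU by (subst mult_four_block_mat[of _ n n _ 1 _ 1 _ _ n _ 1]) auto
  moreover have "four_block_mat X U (0\<^sub>m 1 n) (1\<^sub>m 1) * four_block_mat (1\<^sub>m n) (0\<^sub>m n 1) V (1\<^sub>m 1)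
      = four_block_mat (1\<^sub>m n) U V (1\<^sub>m 1)"
    using U V X XUV by (subst mult_four_block_mat[of _ n n _ 1 _ 1 _ _ n _ 1]) auto
  ultimately have "Determinant.det (four_block_mat (1\<^sub>m n) (0\<^sub>m n 1) V (1\<^sub>m 1) * four_block_mat (1\<^sub>m n) U (0\<^sub>m 1 n) c)
      = Determinant.det (four_block_mat X U (0\<^sub>m 1 n) (1\<^sub>m 1) * four_block_mat (1\<^sub>m n) (0\<^sub>m n 1) V (1\<^sub>m 1))"
    by simp
  moreover have "Determinant.det (four_block_mat (1\<^sub>m n) (0\<^sub>m n 1) V (1\<^sub>m 1)) = 1"
    using V by (subst det_four_block_mat_upper_right_zero[of _ n _ 1]) auto
  moreover have "Determinant.det (four_block_mat (1\<^sub>m n) U (0\<^sub>m 1 n) c) = Determinant.det c"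
    using U c by (subst det_four_block_mat_lower_left_zero[of _ n _ 1]) auto
  moreover have "Determinant.det (four_block_mat X U (0\<^sub>m 1 n) (1\<^sub>m 1)) = Determinant.det X"
    using U X by (subst det_four_block_mat_lower_left_zero[of _ n _ 1]) auto
  moreover have "Determinant.det (P * Q) = Determinant.det P * Determinant.det Q"
    if "P \<in> carrier_mat (n + 1) (n + 1)" "Q \<in> carrier_mat (n + 1) (n + 1)" for P Q :: "real mat"
    using that by (rule det_mult)
  moreover have "four_block_mat (1\<^sub>m n) (0\<^sub>m n 1) V (1\<^sub>m 1) \<in> carrier_mat (n + 1) (n + 1)"
    "four_block_mat (1\<^sub>m n) U (0\<^sub>m 1 n) c \<in> carrier_mat (n + 1) (n + 1)"
    "four_block_mat X U (0\<^sub>m 1 n) (1\<^sub>m 1) \<in> carrier_mat (n + 1) (n + 1)"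
    using X c by (auto intro!: four_block_carrier_mat)
  ultimately have "Determinant.det c = Determinant.det X" by simp
  moreover have "Determinant.det c = 1 + (\<Sum>i<n. u i * v i)"
    by (subst det_single) (auto simp: c_def)
  ultimately show ?thesis by (simp add: X_def)
qed

text \<open>The Leibniz expansion has n! terms of size at most B^n. So crude a bound is enough
  because only its logarithm enters the potential argument.\<close>

lemma det_bound:
  fixes A :: "real mat"
  assumes A: "A \<in> carrier_mat n n" and B: "\<And>i j. i < n \<Longrightarrow> j < n \<Longrightarrow> \<bar>A $$ (i, j)\<bar> \<le> B"
  shows "\<bar>Determinant.det A\<bar> \<le> (real n * B) ^ n"
proof -
  let ?P = "{p. p permutes {0..<n}}"
  have "\<bar>Determinant.det A\<bar> \<le> (\<Sum>p\<in>?P. \<bar>of_int (sign p) * (\<Prod>i = 0..<n. A $$ (i, p i))\<bar>)"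
    using A by (simp add: Determinant.det_def sum_abs)
  also have "\<dots> \<le> (\<Sum>p\<in>?P. B ^ n)"
  proof (intro sum_mono)
    fix p assume p: "p \<in> ?P"
    have "(\<Prod>i = 0..<n. \<bar>A $$ (i, p i)\<bar>) \<le> (\<Prod>i = 0..<n. B)"
      using p by (intro prod_mono) (auto intro!: B simp: permutes_in_image)
    then show "\<bar>of_int (sign p) * (\<Prod>i = 0..<n. A $$ (i, p i))\<bar> \<le> B ^ n"
      by (simp add: abs_mult abs_prod sign_def)
  qed
  also have "\<dots> = fact n * B ^ n"
    using card_permutations[of "{0..<n}" n] by simp
  also have "\<dots> \<le> real n ^ n * B ^ n"
  proof (cases "n = 0")
    case False
    then have "0 \<le> B" using B[of 0 0] by force
    then show ?thesis using fact_le_power[of n, where 'a = real] by (intro mult_right_mono) auto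
  qed simp
  finally show ?thesis by (simp add: power_mult_distrib)
qed

lemma det_nonzero_solvable:
  fixes G :: "real mat"
  assumes G: "G \<in> carrier_mat n n" and det: "Determinant.det G \<noteq> 0"
  obtains y where "\<And>i. i < n \<Longrightarrow> (\<Sum>j<n. G $$ (i, j) * y j) = b i"
proof -
  from det_non_zero_imp_unit[OF G det, of "()"]
  obtain Gi where Gi: "Gi \<in> carrier_mat n n" "G * Gi = 1\<^sub>m n"
    by (auto simp: Units_def ring_mat_def)
  have "(\<Sum>j<n. G $$ (i, j) * (\<Sum>s<n. Gi $$ (j, s) * b s)) = b i" if i: "i < n" for i
  proof -
    have "(\<Sum>j<n. G $$ (i, j) * (\<Sum>s<n. Gi $$ (j, s) * b s)) =
        (\<Sum>j<n. \<Sum>s<n. G $$ (i, j) * Gi $$ (j, s) * b s)"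
      by (simp add: sum_distrib_left ac_simps)
    also have "\<dots> = (\<Sum>s<n. \<Sum>j<n. G $$ (i, j) * Gi $$ (j, s) * b s)" by (rule sum.swap)
    also have "\<dots> = (\<Sum>s<n. (G * Gi) $$ (i, s) * b s)"
      using i Gi(1) G by (intro sum.cong) (auto simp: scalar_prod_def atLeast0LessThan sum_distrib_right)
    also have "\<dots> = (\<Sum>s<n. if s = i then b i else 0)"
      unfolding Gi(2) using i by (intro sum.cong) auto
    finally show ?thesis using i by simp
  qed
  then show ?thesis by (rule that)
qed

text \<open>The design matrix of ridge regression; the identity summand keeps it invertible and is
  paid for by the term \<open>W\<close> in \<open>elliptical_potential\<close>.\<close>

definition regularized_gram :: "nat \<Rightarrow> (nat \<Rightarrow> nat \<Rightarrow> real) \<Rightarrow> nat \<Rightarrow> real mat" where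
  "regularized_gram d z k = mat d d (\<lambda>(i, j). (if i = j then 1 else 0) + (\<Sum>t<k. z t i * z t j))"

lemma regularized_gram_carrier: "regularized_gram d z k \<in> carrier_mat d d"
  by (simp add: regularized_gram_def)

lemma regularized_gram_form:
  "(\<Sum>i<d. a i * (\<Sum>j<d. regularized_gram d z k $$ (i, j) * b j)) =
     (\<Sum>i<d. a i * b i) + (\<Sum>t<k. (\<Sum>i<d. a i * z t i) * (\<Sum>i<d. b i * z t i))"
proof -
  have "(\<Sum>i<d. a i * (\<Sum>j<d. regularized_gram d z k $$ (i, j) * b j)) =
      (\<Sum>i<d. (\<Sum>j<d. if j = i then a i * b i else 0) + (\<Sum>j<d. \<Sum>t<k. (a i * z t i) * (b j * z t j)))"
    unfolding sum.distrib[symmetric] sum_distrib_left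
    by (intro sum.cong)
      (auto simp: regularized_gram_def algebra_simps sum_distrib_left sum_distrib_right sum.distrib)
  also have "\<dots> = (\<Sum>i<d. a i * b i) + (\<Sum>i<d. \<Sum>j<d. \<Sum>t<k. (a i * z t i) * (b j * z t j))"
    by (simp add: sum.distrib)
  also have "(\<Sum>i<d. \<Sum>j<d. \<Sum>t<k. (a i * z t i) * (b j * z t j)) =
      (\<Sum>i<d. \<Sum>t<k. \<Sum>j<d. (a i * z t i) * (b j * z t j))"
    by (intro sum.cong sum.swap refl)
  also have "\<dots> = (\<Sum>t<k. \<Sum>i<d. \<Sum>j<d. (a i * z t i) * (b j * z t j))"
    by (rule sum.swap)
  finally show ?thesis by (simp add: sum_product)
qed

text \<open>With z the new vector and G y = z, the number \<open>u\<close> is the squared norm of z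
  in the inverse of G, written without an inverse. The determinant grows by the rank-one formula,
  the last claim is Cauchy-Schwarz for the inner product of G applied to w and y, and u \<le> 1
  because G dominates the identity and |z| \<le> 1.\<close>

lemma det_regularized_gram_step:
  assumes pos: "0 < Determinant.det (regularized_gram d z k)" and z1: "(\<Sum>i<d. (z k i)\<^sup>2) \<le> 1"
  shows "\<exists>u. 0 \<le> u \<and> u \<le> 1 \<and>
    Determinant.det (regularized_gram d z (Suc k)) = Determinant.det (regularized_gram d z k) * (1 + u) \<and>
    (\<forall>w. (\<Sum>i<d. w i * z k i)\<^sup>2 \<le> ((\<Sum>i<d. (w i)\<^sup>2) + (\<Sum>t<k. (\<Sum>i<d. w i * z t i)\<^sup>2)) * u)"
proof -
  let ?G = "regularized_gram d z k"
  obtain y where y: "\<And>i. i < d \<Longrightarrow> (\<Sum>j<d. ?G $$ (i, j) * y j) = z k i"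
    using det_nonzero_solvable[OF regularized_gram_carrier, of d z k "z k"] pos by auto
  define u where "u = (\<Sum>i<d. y i * z k i)"
  have form: "(\<Sum>i<d. w i * z k i) = (\<Sum>i<d. w i * y i) + (\<Sum>t<k. (\<Sum>i<d. w i * z t i) * (\<Sum>i<d. y i * z t i))" for w
    using regularized_gram_form[where d = d and a = w and z = z and k = k and b = y] y by simp
  have u: "u = (\<Sum>i<d. (y i)\<^sup>2) + (\<Sum>t<k. (\<Sum>i<d. y i * z t i)\<^sup>2)"
    unfolding u_def form[of y] by (simp add: power2_eq_square)
  have y2: "0 \<le> (\<Sum>i<d. (y i)\<^sup>2)" "(\<Sum>i<d. (y i)\<^sup>2) \<le> u"
    unfolding u by (auto intro!: sum_nonneg)
  then have u0: "0 \<le> u" by linarith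
  have "u\<^sup>2 \<le> (\<Sum>i<d. (y i)\<^sup>2) * (\<Sum>i<d. (z k i)\<^sup>2)"
    unfolding u_def by (rule Cauchy_Schwarz_ineq_sum)
  also have "\<dots> \<le> u * 1" using y2 z1 u0 by (intro mult_mono) (auto intro!: sum_nonneg)
  finally have "u\<^sup>2 \<le> u" by simp
  then have u1: "u \<le> 1"
    by (rule le_one_of_square_le)
  have cs: "(\<Sum>i<d. w i * z k i)\<^sup>2 \<le> ((\<Sum>i<d. (w i)\<^sup>2) + (\<Sum>t<k. (\<Sum>i<d. w i * z t i)\<^sup>2)) * u" for w
  proof -
    \<comment> \<open>The inner product of G becomes Euclidean once a vector is extended by its
      products with the earlier vectors, hence the disjoint sum of index sets.\<close>
    define f where "f v = case_sum v (\<lambda>t. \<Sum>i<d. v i * z t i)" for v :: "nat \<Rightarrow> real"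
    have "(\<Sum>i\<in>{..<d} <+> {..<k}. f w i * f y i)\<^sup>2 \<le>
        (\<Sum>i\<in>{..<d} <+> {..<k}. (f w i)\<^sup>2) * (\<Sum>i\<in>{..<d} <+> {..<k}. (f y i)\<^sup>2)"
      by (rule Cauchy_Schwarz_ineq_sum)
    then show ?thesis unfolding form u by (simp add: f_def sum.Plus)
  qed
  \<comment> \<open>G + z z^T = G (1 + y z^T), because G y = z.\<close>
  have "regularized_gram d z (Suc k) = ?G * mat d d (\<lambda>(i, j). (if i = j then 1 else 0) + y i * z k j)"
  proof (intro eq_matI)
    fix i j assume "i < dim_row (?G * mat d d (\<lambda>(i, j). (if i = j then 1 else 0) + y i * z k j))"
      "j < dim_col (?G * mat d d (\<lambda>(i, j). (if i = j then 1 else 0) + y i * z k j))"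
    then have i: "i < d" and j: "j < d" by (auto simp: regularized_gram_def)
    have "(?G * mat d d (\<lambda>(i, j). (if i = j then 1 else 0) + y i * z k j)) $$ (i, j)
        = (\<Sum>l<d. ?G $$ (i, l) * ((if l = j then 1 else 0) + y l * z k j))"
      using i j regularized_gram_carrier[of d z k] by (simp add: scalar_prod_def atLeast0LessThan)
    also have "\<dots> = (\<Sum>l<d. if l = j then ?G $$ (i, j) else 0) + (\<Sum>l<d. ?G $$ (i, l) * y l) * z k j"
      unfolding sum_distrib_right sum.distrib[symmetric] by (intro sum.cong) (auto simp: algebra_simps)
    also have "\<dots> = ?G $$ (i, j) + z k i * z k j"
      using i j y by simp
    finally show "regularized_gram d z (Suc k) $$ (i, j) =
        (?G * mat d d (\<lambda>(i, j). (if i = j then 1 else 0) + y i * z k j)) $$ (i, j)"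
      using i j by (simp add: regularized_gram_def)
  qed (auto simp: regularized_gram_def)
  then have "Determinant.det (regularized_gram d z (Suc k)) = Determinant.det ?G * (1 + u)"
    unfolding u_def using regularized_gram_carrier[of d z k]
    by (simp add: det_mult[of _ d] det_identity_plus_rank_one)
  then show ?thesis using u0 u1 cs by blast
qed

text \<open>The square of the \<open>k\<close>-th summand is at most \<open>W + R\<close> times the
  relative growth of the determinant in round \<open>k\<close>. The final determinant is polynomial
  in \<open>K\<close>, so these growth rates sum to order d log (d K); Cauchy-Schwarz over the
  rounds gives the square root of \<open>K\<close>.\<close>

lemma elliptical_potential:
  fixes w z :: "nat \<Rightarrow> nat \<Rightarrow> real"
  assumes d: "0 < d" and z: "\<And>k. k < K \<Longrightarrow> (\<Sum>i<d. (z k i)\<^sup>2) \<le> 1"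
    and w: "\<And>k. k < K \<Longrightarrow> (\<Sum>i<d. (w k i)\<^sup>2) \<le> W"
    and R: "\<And>k. k < K \<Longrightarrow> (\<Sum>t<k. (\<Sum>i<d. w k i * z t i)\<^sup>2) \<le> R"
  shows "(\<Sum>k<K. \<bar>\<Sum>i<d. w k i * z k i\<bar>) \<le> sqrt (2 * real K * real d * (W + R) * ln (real d * (1 + real K)))"
proof (cases "K = 0")
  case False
  then have K: "0 < K" by simp
  define D where "D k = Determinant.det (regularized_gram d z k)" for k
  define P where "P k u \<longleftrightarrow> 0 \<le> u \<and> u \<le> 1 \<and> D (Suc k) = D k * (1 + u) \<and>
    (\<forall>w. (\<Sum>i<d. w i * z k i)\<^sup>2 \<le> ((\<Sum>i<d. (w i)\<^sup>2) + (\<Sum>t<k. (\<Sum>i<d. w i * z t i)\<^sup>2)) * u)" for k u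
  have "regularized_gram d z 0 = 1\<^sub>m d" by (intro eq_matI) (auto simp: regularized_gram_def)
  then have D0: "D 0 = 1" by (simp add: D_def)
  have step: "\<exists>u. P k u" if "k < K" "0 < D k" for k
    using det_regularized_gram_step[of d z k] that z unfolding P_def D_def by blast
  have Dpos: "k \<le> K \<Longrightarrow> 0 < D k" for k
  proof (induction k)
    case (Suc k)
    then obtain u where "P k u" using step[of k] by auto
    then show ?case using Suc by (auto simp: P_def intro!: mult_pos_pos)
  qed (simp add: D0)
  then have "\<forall>k\<in>{..<K}. \<exists>u. P k u" using step by auto
  then obtain u where u: "\<And>k. k < K \<Longrightarrow> P k (u k)" by (metis lessThan_iff)
  have "k \<le> K \<Longrightarrow> (\<Sum>i<k. u i) \<le> 2 * ln (D k)" for k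
  proof (induction k)
    case (Suc k)
    then have uk: "0 \<le> u k" "u k \<le> 1" "D (Suc k) = D k * (1 + u k)" and "0 < D k"
      using u[of k] Dpos[of k] by (auto simp: P_def)
    \<comment> \<open>On [0, 1] this yields u \<le> 2 ln (1 + u), the origin of the 2 under the
      square root.\<close>
    have "exp (u k / 2) \<le> 1 + u k / 2 + (u k / 2)\<^sup>2" using uk by (intro exp_bound) auto
    also have "(u k / 2)\<^sup>2 \<le> u k / 2"
      using mult_mono[of "u k / 2" 1 "u k / 2" "u k / 2"] uk by (simp add: power2_eq_square)
    finally have "u k / 2 \<le> ln (1 + u k)" using uk by (subst ln_ge_iff) auto
    then show ?case using Suc uk \<open>0 < D k\<close> by (simp add: ln_mult)
  qed (simp add: D0)
  then have su: "(\<Sum>k<K. u k) \<le> 2 * ln (D K)" by simp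
  have zb: "\<bar>z t i\<bar> \<le> 1" if "t < K" "i < d" for t i
  proof -
    have "(z t i)\<^sup>2 \<le> (\<Sum>i<d. (z t i)\<^sup>2)" using that by (intro member_le_sum) auto
    then show ?thesis using z[OF that(1)] abs_square_le_1[of "z t i"] by linarith
  qed
  have "\<bar>D K\<bar> \<le> (real d * (1 + real K)) ^ d"
    unfolding D_def
  proof (rule det_bound[OF regularized_gram_carrier])
    fix i j assume ij: "i < d" "j < d"
    have "\<bar>\<Sum>t<K. z t i * z t j\<bar> \<le> (\<Sum>t<K. \<bar>z t i\<bar> * \<bar>z t j\<bar>)"
      unfolding abs_mult[symmetric] by (rule sum_abs)
    also have "\<dots> \<le> (\<Sum>t<K. 1)"
      using ij by (intro sum_mono mult_le_one zb) auto
    finally show "\<bar>regularized_gram d z K $$ (i, j)\<bar> \<le> 1 + real K"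
      using ij by (auto simp: regularized_gram_def)
  qed
  then have "ln (D K) \<le> ln ((real d * (1 + real K)) ^ d)"
    using Dpos[of K] by (subst ln_le_cancel_iff) (use d in auto)
  also have "\<dots> = real d * ln (real d * (1 + real K))" using d by (simp add: ln_realpow)
  finally have lnD: "ln (D K) \<le> real d * ln (real d * (1 + real K))" .
  have WR: "0 \<le> W + R"
    using w[OF K] R[OF K] sum_nonneg[of "{..<d}" "\<lambda>i. (w 0 i)\<^sup>2"] by auto
  have "(\<Sum>k<K. (\<Sum>i<d. w k i * z k i)\<^sup>2) \<le> (\<Sum>k<K. (W + R) * u k)"
  proof (intro sum_mono)
    fix k assume "k \<in> {..<K}"
    then have k: "k < K" by simp
    have "(\<Sum>i<d. w k i * z k i)\<^sup>2 \<le> ((\<Sum>i<d. (w k i)\<^sup>2) + (\<Sum>t<k. (\<Sum>i<d. w k i * z t i)\<^sup>2)) * u k"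
      using u[OF k] by (simp add: P_def)
    also have "\<dots> \<le> (W + R) * u k"
      using u[OF k] by (intro mult_right_mono add_mono w[OF k] R[OF k]) (auto simp: P_def)
    finally show "(\<Sum>i<d. w k i * z k i)\<^sup>2 \<le> (W + R) * u k" .
  qed
  also have "\<dots> \<le> (W + R) * (2 * (real d * ln (real d * (1 + real K))))"
    unfolding sum_distrib_left[symmetric] using WR su lnD by (intro mult_left_mono) auto
  finally have S: "(\<Sum>k<K. (\<Sum>i<d. w k i * z k i)\<^sup>2) \<le> (W + R) * (2 * (real d * ln (real d * (1 + real K))))" .
  have "(\<Sum>k<K. \<bar>\<Sum>i<d. w k i * z k i\<bar>)\<^sup>2 \<le> (\<Sum>k<K. (\<Sum>i<d. w k i * z k i)\<^sup>2) * real K"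
    using sum_squared_le_sum_of_squares[of "\<lambda>k. \<bar>\<Sum>i<d. w k i * z k i\<bar>" "{..<K}"] K by simp
  also have "\<dots> \<le> (W + R) * (2 * (real d * ln (real d * (1 + real K)))) * real K"
    using S by (intro mult_right_mono) auto
  finally have "(\<Sum>k<K. \<bar>\<Sum>i<d. w k i * z k i\<bar>)\<^sup>2 \<le> 2 * real K * real d * (W + R) * ln (real d * (1 + real K))"
    by (simp add: algebra_simps)
  then show ?thesis by (rule real_le_rsqrt)
qed simp

text \<open>
  Replacing the family \<open>x k\<close> by its signed sum \<open>z k\<close> makes the l1 seminorm at \<open>w k\<close> a linear
  form, while \<open>z t\<close> stays below the seminorm of round \<open>t\<close> at every other \<open>w k\<close>.
\<close>

lemma l1_elliptical_potential:
  fixes w :: "nat \<Rightarrow> nat \<Rightarrow> real" and x :: "nat \<Rightarrow> 'a \<Rightarrow> nat \<Rightarrow> real"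
  assumes d: "0 < d" and x: "\<And>k. k < K \<Longrightarrow> (\<Sum>\<tau>\<in>T. \<Sum>i<d. \<bar>x k \<tau> i\<bar>) \<le> 1"
    and w: "\<And>k. k < K \<Longrightarrow> (\<Sum>i<d. (w k i)\<^sup>2) \<le> W"
    and R: "\<And>k. k < K \<Longrightarrow> (\<Sum>t<k. (\<Sum>\<tau>\<in>T. \<bar>\<Sum>i<d. w k i * x t \<tau> i\<bar>)\<^sup>2) \<le> R"
  shows "(\<Sum>k<K. \<Sum>\<tau>\<in>T. \<bar>\<Sum>i<d. w k i * x k \<tau> i\<bar>) \<le> sqrt (2 * real K * real d * (W + R) * ln (real d * (1 + real K)))"
proof -
  define z where "z k i = (\<Sum>\<tau>\<in>T. sgn (\<Sum>i<d. w k i * x k \<tau> i) * x k \<tau> i)" for k i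
  have lin: "(\<Sum>i<d. v i * z k i) = (\<Sum>\<tau>\<in>T. sgn (\<Sum>i<d. w k i * x k \<tau> i) * (\<Sum>i<d. v i * x k \<tau> i))" for v k
  proof -
    have "(\<Sum>i<d. v i * z k i) = (\<Sum>i<d. \<Sum>\<tau>\<in>T. sgn (\<Sum>i<d. w k i * x k \<tau> i) * (v i * x k \<tau> i))"
      by (simp add: z_def sum_distrib_left ac_simps)
    also have "\<dots> = (\<Sum>\<tau>\<in>T. \<Sum>i<d. sgn (\<Sum>i<d. w k i * x k \<tau> i) * (v i * x k \<tau> i))"
      by (rule sum.swap)
    finally show ?thesis by (simp add: sum_distrib_left)
  qed
  have sgn1: "\<bar>sgn a * b\<bar> \<le> \<bar>b\<bar>" for a b :: real by (auto simp: sgn_if)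
  have eq: "\<bar>\<Sum>i<d. w k i * z k i\<bar> = (\<Sum>\<tau>\<in>T. \<bar>\<Sum>i<d. w k i * x k \<tau> i\<bar>)" for k
  proof -
    have "(\<Sum>i<d. w k i * z k i) = (\<Sum>\<tau>\<in>T. \<bar>\<Sum>i<d. w k i * x k \<tau> i\<bar>)"
      unfolding lin by (intro sum.cong refl) (simp add: abs_sgn mult.commute)
    then show ?thesis by (simp add: sum_nonneg)
  qed
  have le: "\<bar>\<Sum>i<d. w k i * z t i\<bar> \<le> (\<Sum>\<tau>\<in>T. \<bar>\<Sum>i<d. w k i * x t \<tau> i\<bar>)" for k t
    unfolding lin by (rule order_trans[OF sum_abs]) (intro sum_mono sgn1)
  have z1: "(\<Sum>i<d. (z k i)\<^sup>2) \<le> 1" if "k < K" for k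
  proof -
    have s: "(\<Sum>i<d. \<bar>z k i\<bar>) \<le> 1"
    proof -
      have "(\<Sum>i<d. \<bar>z k i\<bar>) \<le> (\<Sum>i<d. \<Sum>\<tau>\<in>T. \<bar>x k \<tau> i\<bar>)"
        unfolding z_def by (intro sum_mono order_trans[OF sum_abs] sgn1)
      also have "\<dots> = (\<Sum>\<tau>\<in>T. \<Sum>i<d. \<bar>x k \<tau> i\<bar>)" by (rule sum.swap)
      finally show ?thesis using x[OF that] by simp
    qed
    \<comment> \<open>Coordinates bounded by 1 have squares below their absolute values, so the l1
      bound gives the Euclidean one.\<close>
    have "(z k i)\<^sup>2 \<le> \<bar>z k i\<bar>" if "i < d" for i
    proof -
      have "\<bar>z k i\<bar> \<le> (\<Sum>i<d. \<bar>z k i\<bar>)" using that by (intro member_le_sum) auto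
      then have "\<bar>z k i\<bar> * \<bar>z k i\<bar> \<le> 1 * \<bar>z k i\<bar>" using s by (intro mult_right_mono) auto
      then show ?thesis by (simp add: power2_eq_square)
    qed
    then have "(\<Sum>i<d. (z k i)\<^sup>2) \<le> (\<Sum>i<d. \<bar>z k i\<bar>)" by (intro sum_mono) auto
    then show ?thesis using s by simp
  qed
  have "(\<Sum>k<K. \<bar>\<Sum>i<d. w k i * z k i\<bar>) \<le> sqrt (2 * real K * real d * (W + R) * ln (real d * (1 + real K)))"
  proof (rule elliptical_potential[OF d z1 w])
    fix k assume k: "k < K"
    have "(\<Sum>t<k. (\<Sum>i<d. w k i * z t i)\<^sup>2) \<le> (\<Sum>t<k. (\<Sum>\<tau>\<in>T. \<bar>\<Sum>i<d. w k i * x t \<tau> i\<bar>)\<^sup>2)"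
      by (intro sum_mono abs_le_square_iff[THEN iffD1] order_trans[OF le abs_ge_self])
    then show "(\<Sum>t<k. (\<Sum>i<d. w k i * z t i)\<^sup>2) \<le> R" using R[OF k] by simp
  qed
  then show ?thesis unfolding eq .
qed

section \<open>Trajectory probabilities\<close>

lemma pmf_bind_sum:
  fixes n :: nat
  assumes "set_pmf p \<subseteq> {..<n}"
  shows "pmf (bind_pmf p f) x = (\<Sum>s<n. pmf p s * pmf (f s) x)"
  unfolding pmf_bind using assms
  by (subst integral_measure_pmf_real[where A = "{..<n}"]) (auto simp: mult.commute)

lemma pmf_bind_single:
  assumes "\<And>j. j \<in> set_pmf p \<Longrightarrow> j \<noteq> i \<Longrightarrow> pmf (f j) x = 0"
  shows "pmf (bind_pmf p f) x = pmf p i * pmf (f i) x"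
  unfolding pmf_bind using assms
  by (subst integral_measure_pmf_real[where A = "{i}"]) (auto simp: mult.commute)

lemma sum_pmf_lessThan: "set_pmf (p :: nat pmf) \<subseteq> {..<n} \<Longrightarrow> (\<Sum>i<n. pmf p i) = 1"
  by (intro sum_pmf_eq_1) auto

lemma init_prob_sum: "\<theta> \<in> models S A Ob H \<Longrightarrow> (\<Sum>s<S. pmf (init_prob \<theta>) s) = 1"
  by (intro sum_pmf_lessThan) (simp add: models_def)

lemma trans_prob_sum:
  "\<theta> \<in> models S A Ob H \<Longrightarrow> 1 \<le> h \<Longrightarrow> h < H \<Longrightarrow> a < A \<Longrightarrow> s < S \<Longrightarrow>
    (\<Sum>s'<S. pmf (trans_prob \<theta> h a s) s') = 1"
  by (intro sum_pmf_lessThan) (simp add: models_def)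

lemma emit_prob_sum:
  "\<theta> \<in> models S A Ob H \<Longrightarrow> 1 \<le> h \<Longrightarrow> h \<le> H \<Longrightarrow> s < S \<Longrightarrow> (\<Sum>i<Ob. pmf (emit_prob \<theta> h s) i) = 1"
  by (intro sum_pmf_lessThan) (simp add: models_def)

lemma policy_sum:
  "\<pi> \<in> policies A Ob H \<Longrightarrow> n < H \<Longrightarrow> \<tau> \<in> histories A Ob n \<Longrightarrow> i < Ob \<Longrightarrow> (\<Sum>a<A. pmf (\<pi> (Suc n) \<tau> i) a) = 1"
  by (intro sum_pmf_lessThan) (force simp: policies_def)

section \<open>Histories and the support of trajectory laws\<close>

lemma finite_histories: "finite (histories A Ob n)"
proof -
  have "histories A Ob n = {\<tau>. set \<tau> \<subseteq> {..<Ob} \<times> {..<A} \<and> length \<tau> = n}"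
    by (auto simp: histories_def)
  then show ?thesis by (simp add: finite_lists_length_eq)
qed

lemma histories_0: "histories A Ob 0 = {[]}"
  by (auto simp: histories_def)

lemma histories_snoc: "\<tau> \<in> histories A Ob n \<Longrightarrow> i < Ob \<Longrightarrow> a < A \<Longrightarrow> \<tau> @ [(i, a)] \<in> histories A Ob (Suc n)"
  by (auto simp: histories_def)

lemma sum_histories_Suc:
  "(\<Sum>\<tau>\<in>histories A Ob (Suc n). f \<tau>) = (\<Sum>\<tau>\<in>histories A Ob n. \<Sum>i<Ob. \<Sum>a<A. f (\<tau> @ [(i, a)]))"
proof -
  let ?g = "\<lambda>(\<tau>, i, a). \<tau> @ [(i, a)]"
  have "?g ` (histories A Ob n \<times> {..<Ob} \<times> {..<A}) = histories A Ob (Suc n)"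
  proof (intro equalityI subsetI)
    fix \<tau> assume "\<tau> \<in> histories A Ob (Suc n)"
    then have "\<tau> \<noteq> []" "length \<tau> = Suc n" "set \<tau> \<subseteq> {..<Ob} \<times> {..<A}" by (auto simp: histories_def)
    then show "\<tau> \<in> ?g ` (histories A Ob n \<times> {..<Ob} \<times> {..<A})"
      by (cases \<tau> rule: rev_cases) (auto simp: histories_def image_def)
  qed (auto simp: histories_def)
  moreover have "inj_on ?g (histories A Ob n \<times> {..<Ob} \<times> {..<A})"
    by (auto simp: inj_on_def)
  ultimately have "(\<Sum>\<tau>\<in>histories A Ob (Suc n). f \<tau>) = (\<Sum>x\<in>histories A Ob n \<times> {..<Ob} \<times> {..<A}. f (?g x))"
    by (metis (no_types, lifting) sum.reindex_cong)
  also have "\<dots> = (\<Sum>\<tau>\<in>histories A Ob n. \<Sum>i<Ob. \<Sum>a<A. f (\<tau> @ [(i, a)]))"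
    by (simp add: sum.cartesian_product case_prod_unfold)
  finally show ?thesis .
qed

lemma rollout_prefix:
  "\<sigma> \<in> set_pmf (rollout \<theta> \<pi> n h \<tau> s) \<Longrightarrow> take (length \<tau>) \<sigma> = \<tau>"
proof (induction n arbitrary: h \<tau> s)
  case (Suc n)
  then obtain i a s' where "\<sigma> \<in> set_pmf (rollout \<theta> \<pi> n (Suc h) (\<tau> @ [(i, a)]) s')" by auto
  then have "take (length (\<tau> @ [(i, a)])) \<sigma> = \<tau> @ [(i, a)]" by (rule Suc.IH)
  then have "take (length \<tau>) (take (length (\<tau> @ [(i, a)])) \<sigma>) = \<tau>" by simp
  then show ?case by (simp add: min_def)
qed auto

lemma rollout_support:
  assumes "\<theta> \<in> models S A Ob H" "\<pi> \<in> policies A Ob H"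
  shows "n + h = H \<Longrightarrow> 1 \<le> h \<Longrightarrow> \<tau> \<in> histories A Ob (h - 1) \<Longrightarrow> s < S \<Longrightarrow>
    set_pmf (rollout \<theta> \<pi> n h \<tau> s) \<subseteq> histories A Ob H"
proof (induction n arbitrary: h \<tau> s)
  case 0
  then have "set_pmf (emit_prob \<theta> h s) \<subseteq> {..<Ob}" "\<And>i. i < Ob \<Longrightarrow> set_pmf (\<pi> h \<tau> i) \<subseteq> {..<A}"
    using assms by (auto simp: models_def policies_def)
  then show ?case
    using histories_snoc[OF 0(3)] 0 by (auto simp: subset_iff)
next
  case (Suc n)
  then have emit: "set_pmf (emit_prob \<theta> h s) \<subseteq> {..<Ob}"
    and pol: "\<And>i. i < Ob \<Longrightarrow> set_pmf (\<pi> h \<tau> i) \<subseteq> {..<A}"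
    and trans: "\<And>a. a < A \<Longrightarrow> set_pmf (trans_prob \<theta> h a s) \<subseteq> {..<S}"
    using assms by (auto simp: models_def policies_def)
  have IH: "set_pmf (rollout \<theta> \<pi> n (Suc h) (\<tau> @ [(i, a)]) s') \<subseteq> histories A Ob H"
    if "i < Ob" "a < A" "s' < S" for i a s'
    using that Suc.prems histories_snoc[OF Suc.prems(3) that(1,2)] by (intro Suc.IH) auto
  show ?case
  proof
    fix \<sigma> assume "\<sigma> \<in> set_pmf (rollout \<theta> \<pi> (Suc n) h \<tau> s)"
    then obtain i a s' where "i \<in> set_pmf (emit_prob \<theta> h s)" "a \<in> set_pmf (\<pi> h \<tau> i)"
      "s' \<in> set_pmf (trans_prob \<theta> h a s)" "\<sigma> \<in> set_pmf (rollout \<theta> \<pi> n (Suc h) (\<tau> @ [(i, a)]) s')"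
      by auto
    moreover from this have "i < Ob" using emit by auto
    moreover from calculation have "a < A" using pol by auto
    moreover from calculation have "s' < S" using trans by auto
    ultimately show "\<sigma> \<in> histories A Ob H" using IH by blast
  qed
qed

lemma traj_pmf_support:
  assumes "\<theta> \<in> models S A Ob H" "\<pi> \<in> policies A Ob H" "0 < H"
  shows "set_pmf (traj_pmf H \<theta> \<pi>) \<subseteq> histories A Ob H"
proof -
  have "set_pmf (rollout \<theta> \<pi> (H - 1) 1 [] s) \<subseteq> histories A Ob H" if "s < S" for s
    using assms that by (intro rollout_support[OF assms(1,2)]) (auto simp: histories_0)
  moreover have "set_pmf (init_prob \<theta>) \<subseteq> {..<S}" using assms by (simp add: models_def)
  ultimately show ?thesis by (auto simp: traj_pmf_def)
qed

lemma pmf_rollout_0: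
  "pmf (rollout \<theta> \<pi> 0 h \<tau> s) (\<tau> @ [(i, a)]) = pmf (emit_prob \<theta> h s) i * pmf (\<pi> h \<tau> i) a"
proof -
  have "pmf (bind_pmf (\<pi> h \<tau> j) (\<lambda>a. return_pmf (\<tau> @ [(j, a)]))) (\<tau> @ [(i, a)]) = 0" if "j \<noteq> i" for j
    using that by (simp add: pmf_eq_0_set_pmf)
  moreover have "pmf (bind_pmf (\<pi> h \<tau> i) (\<lambda>a. return_pmf (\<tau> @ [(i, a)]))) (\<tau> @ [(i, a)]) = pmf (\<pi> h \<tau> i) a"
    by (subst pmf_bind_single[where i = a]) auto
  ultimately show ?thesis by (simp add: pmf_bind_single[where i = i])
qed

text \<open>Trajectories record observations and actions, so by \<open>rollout_prefix\<close> only
  the branch with the recorded pair can produce \<open>\<sigma>\<close>. Two binds collapse to one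
  term and only the hidden state is summed.\<close>

lemma pmf_rollout_Suc:
  assumes \<sigma>: "take (Suc (length \<tau>)) \<sigma> = \<tau> @ [(i, a)]" and trans: "set_pmf (trans_prob \<theta> h a s) \<subseteq> {..<S}"
  shows "pmf (rollout \<theta> \<pi> (Suc n) h \<tau> s) \<sigma> = pmf (emit_prob \<theta> h s) i * pmf (\<pi> h \<tau> i) a *
    (\<Sum>s'<S. pmf (trans_prob \<theta> h a s) s' * pmf (rollout \<theta> \<pi> n (Suc h) (\<tau> @ [(i, a)]) s') \<sigma>)"
proof -
  have other: "\<sigma> \<notin> set_pmf (rollout \<theta> \<pi> n (Suc h) (\<tau> @ [(j, b)]) s')" if "(j, b) \<noteq> (i, a)" for j b s'
  proof
    assume "\<sigma> \<in> set_pmf (rollout \<theta> \<pi> n (Suc h) (\<tau> @ [(j, b)]) s')"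
    from rollout_prefix[OF this] show False using \<sigma> that by simp
  qed
  have "pmf (rollout \<theta> \<pi> (Suc n) h \<tau> s) \<sigma> = pmf (emit_prob \<theta> h s) i *
      pmf (bind_pmf (\<pi> h \<tau> i) (\<lambda>a. bind_pmf (trans_prob \<theta> h a s) (rollout \<theta> \<pi> n (Suc h) (\<tau> @ [(i, a)])))) \<sigma>"
    unfolding rollout.simps
    by (rule pmf_bind_single) (use other in \<open>auto simp: pmf_eq_0_set_pmf\<close>)
  also have "pmf (bind_pmf (\<pi> h \<tau> i) (\<lambda>a. bind_pmf (trans_prob \<theta> h a s) (rollout \<theta> \<pi> n (Suc h) (\<tau> @ [(i, a)])))) \<sigma>
      = pmf (\<pi> h \<tau> i) a * pmf (bind_pmf (trans_prob \<theta> h a s) (rollout \<theta> \<pi> n (Suc h) (\<tau> @ [(i, a)]))) \<sigma>"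
    by (rule pmf_bind_single) (use other in \<open>auto simp: pmf_eq_0_set_pmf\<close>)
  finally show ?thesis by (simp add: pmf_bind_sum[OF trans] mult.assoc)
qed

text \<open>
  \<open>fwd S \<theta> \<pi> n \<tau> s\<close> is the joint probability of the past \<open>\<tau>\<close> of length \<open>n\<close> and the state \<open>s\<close> at
  step \<open>n + 1\<close>; \<open>obs S \<theta> \<pi> n \<tau> i\<close> replaces the state by the observation at that step.
\<close>

primrec fwd :: "nat \<Rightarrow> model \<Rightarrow> policy \<Rightarrow> nat \<Rightarrow> trajectory \<Rightarrow> nat \<Rightarrow> real" where
  "fwd S \<theta> \<pi> 0 \<tau> s = pmf (init_prob \<theta>) s"
| "fwd S \<theta> \<pi> (Suc n) \<tau> s =
     pmf (\<pi> (Suc n) (butlast \<tau>) (fst (last \<tau>))) (snd (last \<tau>)) *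
     (\<Sum>s'<S. fwd S \<theta> \<pi> n (butlast \<tau>) s' * pmf (emit_prob \<theta> (Suc n) s') (fst (last \<tau>)) *
        pmf (trans_prob \<theta> (Suc n) (snd (last \<tau>)) s') s)"

definition obs :: "nat \<Rightarrow> model \<Rightarrow> policy \<Rightarrow> nat \<Rightarrow> trajectory \<Rightarrow> nat \<Rightarrow> real" where
  "obs S \<theta> \<pi> n \<tau> i = (\<Sum>s<S. fwd S \<theta> \<pi> n \<tau> s * pmf (emit_prob \<theta> (Suc n) s) i)"

lemma fwd_snoc:
  "fwd S \<theta> \<pi> (Suc n) (\<tau> @ [(i, a)]) s = pmf (\<pi> (Suc n) \<tau> i) a *
     (\<Sum>s'<S. fwd S \<theta> \<pi> n \<tau> s' * pmf (emit_prob \<theta> (Suc n) s') i * pmf (trans_prob \<theta> (Suc n) a s') s)"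
  by simp

lemma fwd_nonneg: "0 \<le> fwd S \<theta> \<pi> n \<tau> s"
  by (induction n arbitrary: \<tau> s) (auto intro!: mult_nonneg_nonneg sum_nonneg)

text \<open>Steps move one at a time from the recursion of \<open>rollout\<close> to that of
  \<open>fwd\<close>: \<open>n = 0\<close> is the definition of \<open>traj_pmf\<close>, and at
  \<open>n = H - 1\<close> only one emission and one action are left.\<close>

lemma pmf_traj_pmf_unroll:
  assumes \<theta>: "\<theta> \<in> models S A Ob H" and \<sigma>: "\<sigma> \<in> histories A Ob H"
  shows "n < H \<Longrightarrow> pmf (traj_pmf H \<theta> \<pi>) \<sigma> =
    (\<Sum>s<S. fwd S \<theta> \<pi> n (take n \<sigma>) s * pmf (rollout \<theta> \<pi> (H - 1 - n) (Suc n) (take n \<sigma>) s) \<sigma>)"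
proof (induction n)
  case 0
  then show ?case using \<theta> by (simp add: traj_pmf_def pmf_bind_sum models_def)
next
  case (Suc n)
  obtain i a where ia: "\<sigma> ! n = (i, a)" by fastforce
  have len: "length \<sigma> = H" and "\<sigma> ! n \<in> {..<Ob} \<times> {..<A}"
    using \<sigma> Suc.prems nth_mem[of n \<sigma>] by (auto simp: histories_def)
  then have a: "a < A" using ia by auto
  have take: "take (Suc n) \<sigma> = take n \<sigma> @ [(i, a)]"
    using len Suc.prems ia by (simp add: take_Suc_conv_app_nth)
  have trans: "set_pmf (trans_prob \<theta> (Suc n) a s) \<subseteq> {..<S}" if "s < S" for s
    using \<theta> a that Suc.prems by (auto simp: models_def)
  have H: "H - 1 - n = Suc (H - 1 - Suc n)" using Suc.prems by simp
  let ?r = "\<lambda>s'. pmf (rollout \<theta> \<pi> (H - 1 - Suc n) (Suc (Suc n)) (take (Suc n) \<sigma>) s') \<sigma>"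
  have "pmf (traj_pmf H \<theta> \<pi>) \<sigma> = (\<Sum>s<S. fwd S \<theta> \<pi> n (take n \<sigma>) s *
      (pmf (emit_prob \<theta> (Suc n) s) i * pmf (\<pi> (Suc n) (take n \<sigma>) i) a *
        (\<Sum>s'<S. pmf (trans_prob \<theta> (Suc n) a s) s' * ?r s')))"
    unfolding Suc.IH[OF Suc_lessD[OF Suc.prems]] H
  proof (intro sum.cong refl)
    fix s assume "s \<in> {..<S}"
    then have s: "s < S" by simp
    have "take (Suc (length (take n \<sigma>))) \<sigma> = take n \<sigma> @ [(i, a)]"
      using take len Suc.prems by (simp add: min_def)
    from pmf_rollout_Suc[OF this trans[OF s], of \<pi> "H - 1 - Suc n"]
    show "fwd S \<theta> \<pi> n (take n \<sigma>) s * pmf (rollout \<theta> \<pi> (Suc (H - 1 - Suc n)) (Suc n) (take n \<sigma>) s) \<sigma> =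
        fwd S \<theta> \<pi> n (take n \<sigma>) s * (pmf (emit_prob \<theta> (Suc n) s) i * pmf (\<pi> (Suc n) (take n \<sigma>) i) a *
        (\<Sum>s'<S. pmf (trans_prob \<theta> (Suc n) a s) s' * ?r s'))"
      unfolding take by simp
  qed
  also have "\<dots> = (\<Sum>s<S. \<Sum>s'<S. pmf (\<pi> (Suc n) (take n \<sigma>) i) a * (fwd S \<theta> \<pi> n (take n \<sigma>) s *
      pmf (emit_prob \<theta> (Suc n) s) i * pmf (trans_prob \<theta> (Suc n) a s) s') * ?r s')"
    by (simp add: sum_distrib_left ac_simps)
  also have "\<dots> = (\<Sum>s'<S. \<Sum>s<S. pmf (\<pi> (Suc n) (take n \<sigma>) i) a * (fwd S \<theta> \<pi> n (take n \<sigma>) s *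
      pmf (emit_prob \<theta> (Suc n) s) i * pmf (trans_prob \<theta> (Suc n) a s) s') * ?r s')"
    by (rule sum.swap)
  also have "\<dots> = (\<Sum>s'<S. fwd S \<theta> \<pi> (Suc n) (take (Suc n) \<sigma>) s' * ?r s')"
    by (simp only: take fwd_snoc sum_distrib_left sum_distrib_right)
  finally show ?case .
qed

lemma pmf_traj_pmf_snoc:
  assumes "\<theta> \<in> models S A Ob (Suc n)" "\<tau> \<in> histories A Ob n" "i < Ob" "a < A"
  shows "pmf (traj_pmf (Suc n) \<theta> \<pi>) (\<tau> @ [(i, a)]) = pmf (\<pi> (Suc n) \<tau> i) a * obs S \<theta> \<pi> n \<tau> i"
proof -
  have len: "length \<tau> = n" using assms by (simp add: histories_def)
  have "pmf (traj_pmf (Suc n) \<theta> \<pi>) (\<tau> @ [(i, a)]) =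
      (\<Sum>s<S. fwd S \<theta> \<pi> n \<tau> s * pmf (rollout \<theta> \<pi> 0 (Suc n) \<tau> s) (\<tau> @ [(i, a)]))"
    using pmf_traj_pmf_unroll[OF assms(1) histories_snoc[OF assms(2-4)], of n \<pi>] len by simp
  then show ?thesis unfolding pmf_rollout_0 by (simp add: obs_def sum_distrib_left ac_simps)
qed

lemma sum_obs:
  assumes "\<theta> \<in> models S A Ob H" "n < H"
  shows "(\<Sum>i<Ob. obs S \<theta> \<pi> n \<tau> i) = (\<Sum>s<S. fwd S \<theta> \<pi> n \<tau> s)"
proof -
  have "(\<Sum>i<Ob. obs S \<theta> \<pi> n \<tau> i) = (\<Sum>s<S. \<Sum>i<Ob. fwd S \<theta> \<pi> n \<tau> s * pmf (emit_prob \<theta> (Suc n) s) i)"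
    unfolding obs_def by (rule sum.swap)
  also have "\<dots> = (\<Sum>s<S. fwd S \<theta> \<pi> n \<tau> s)"
    unfolding sum_distrib_left[symmetric]
    by (intro sum.cong) (use assms in \<open>auto simp: emit_prob_sum[OF assms(1)]\<close>)
  finally show ?thesis .
qed

lemma sum_fwd_snoc:
  assumes "\<theta> \<in> models S A Ob H" "Suc n < H" "a < A"
  shows "(\<Sum>s<S. fwd S \<theta> \<pi> (Suc n) (\<tau> @ [(i, a)]) s) = pmf (\<pi> (Suc n) \<tau> i) a * obs S \<theta> \<pi> n \<tau> i"
proof -
  have "(\<Sum>s<S. fwd S \<theta> \<pi> (Suc n) (\<tau> @ [(i, a)]) s) = pmf (\<pi> (Suc n) \<tau> i) a *
     (\<Sum>s<S. \<Sum>s'<S. fwd S \<theta> \<pi> n \<tau> s' * pmf (emit_prob \<theta> (Suc n) s') i * pmf (trans_prob \<theta> (Suc n) a s') s)"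
    unfolding fwd_snoc by (simp add: sum_distrib_left)
  also have "(\<Sum>s<S. \<Sum>s'<S. fwd S \<theta> \<pi> n \<tau> s' * pmf (emit_prob \<theta> (Suc n) s') i * pmf (trans_prob \<theta> (Suc n) a s') s)
      = (\<Sum>s'<S. \<Sum>s<S. fwd S \<theta> \<pi> n \<tau> s' * pmf (emit_prob \<theta> (Suc n) s') i * pmf (trans_prob \<theta> (Suc n) a s') s)"
    by (rule sum.swap)
  also have "\<dots> = obs S \<theta> \<pi> n \<tau> i"
    unfolding sum_distrib_left[symmetric] obs_def
    by (intro sum.cong) (use assms in \<open>auto simp: trans_prob_sum[OF assms(1)]\<close>)
  finally show ?thesis .
qed

lemma sum_fwd:
  assumes \<theta>: "\<theta> \<in> models S A Ob H" and \<pi>: "\<pi> \<in> policies A Ob H"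
  shows "n < H \<Longrightarrow> (\<Sum>\<tau>\<in>histories A Ob n. \<Sum>s<S. fwd S \<theta> \<pi> n \<tau> s) = 1"
proof (induction n)
  case 0
  then show ?case using init_prob_sum[OF \<theta>] by (simp add: histories_0)
next
  case (Suc n)
  have "(\<Sum>\<tau>\<in>histories A Ob (Suc n). \<Sum>s<S. fwd S \<theta> \<pi> (Suc n) \<tau> s) =
      (\<Sum>\<tau>\<in>histories A Ob n. \<Sum>i<Ob. \<Sum>a<A. pmf (\<pi> (Suc n) \<tau> i) a * obs S \<theta> \<pi> n \<tau> i)"
    unfolding sum_histories_Suc using Suc.prems by (intro sum.cong) (auto simp: sum_fwd_snoc[OF \<theta>] simp del: fwd.simps)
  also have "\<dots> = (\<Sum>\<tau>\<in>histories A Ob n. \<Sum>i<Ob. obs S \<theta> \<pi> n \<tau> i)"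
    unfolding sum_distrib_right[symmetric] using Suc.prems by (intro sum.cong) (auto simp: policy_sum[OF \<pi>])
  also have "\<dots> = 1" using Suc by (simp add: sum_obs[OF \<theta>])
  finally show ?case .
qed

text \<open>The law stops at the observation of step \<open>n + 1\<close>, before its action: this
  is the object on which a left inverse of the emission matrix acts.\<close>

definition obs_dist :: "nat \<Rightarrow> nat \<Rightarrow> nat \<Rightarrow> model \<Rightarrow> model \<Rightarrow> policy \<Rightarrow> nat \<Rightarrow> real" where
  "obs_dist S A Ob \<theta> \<theta>' \<pi> n = (\<Sum>\<tau>\<in>histories A Ob n. \<Sum>i<Ob. \<bar>obs S \<theta> \<pi> n \<tau> i - obs S \<theta>' \<pi> n \<tau> i\<bar>)"

definition traj_dist :: "nat \<Rightarrow> nat \<Rightarrow> nat \<Rightarrow> model \<Rightarrow> model \<Rightarrow> policy \<Rightarrow> real" where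
  "traj_dist A Ob H \<theta> \<theta>' \<pi> =
     (\<Sum>\<tau>\<in>histories A Ob H. \<bar>pmf (traj_pmf H \<theta> \<pi>) \<tau> - pmf (traj_pmf H \<theta>' \<pi>) \<tau>\<bar>)"

text \<open>Both models face the same policy, so the probability of the last action factors out and
  sums to 1.\<close>

lemma traj_dist_eq_obs_dist:
  assumes \<theta>: "\<theta> \<in> models S A Ob H" and \<theta>': "\<theta>' \<in> models S A Ob H" and \<pi>: "\<pi> \<in> policies A Ob H" and H: "H = Suc n"
  shows "traj_dist A Ob H \<theta> \<theta>' \<pi> = obs_dist S A Ob \<theta> \<theta>' \<pi> n"
proof -
  have "traj_dist A Ob H \<theta> \<theta>' \<pi> = (\<Sum>\<tau>\<in>histories A Ob n. \<Sum>i<Ob. \<Sum>a<A.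
      pmf (\<pi> (Suc n) \<tau> i) a * \<bar>obs S \<theta> \<pi> n \<tau> i - obs S \<theta>' \<pi> n \<tau> i\<bar>)"
    unfolding traj_dist_def H sum_histories_Suc
    using pmf_traj_pmf_snoc[OF \<theta>[unfolded H]] pmf_traj_pmf_snoc[OF \<theta>'[unfolded H]]
    by (intro sum.cong) (auto simp: abs_mult right_diff_distrib[symmetric])
  also have "\<dots> = obs_dist S A Ob \<theta> \<theta>' \<pi> n"
    unfolding obs_dist_def sum_distrib_right[symmetric]
    using H by (intro sum.cong) (auto simp: policy_sum[OF \<pi>])
  finally show ?thesis .
qed

text \<open>The earlier law is a marginal of the later one, and marginalising cannot increase an l1
  distance.\<close>

lemma obs_dist_mono:
  assumes \<theta>: "\<theta> \<in> models S A Ob H" and \<theta>': "\<theta>' \<in> models S A Ob H" and \<pi>: "\<pi> \<in> policies A Ob H" and n: "Suc n < H"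
  shows "obs_dist S A Ob \<theta> \<theta>' \<pi> n \<le> obs_dist S A Ob \<theta> \<theta>' \<pi> (Suc n)"
proof -
  have "obs_dist S A Ob \<theta> \<theta>' \<pi> n =
      (\<Sum>\<tau>\<in>histories A Ob n. \<Sum>i<Ob. \<Sum>a<A. pmf (\<pi> (Suc n) \<tau> i) a * \<bar>obs S \<theta> \<pi> n \<tau> i - obs S \<theta>' \<pi> n \<tau> i\<bar>)"
    unfolding obs_dist_def sum_distrib_right[symmetric]
    using n by (intro sum.cong) (auto simp: policy_sum[OF \<pi>])
  also have "\<dots> \<le> obs_dist S A Ob \<theta> \<theta>' \<pi> (Suc n)"
    unfolding obs_dist_def sum_histories_Suc
  proof (intro sum_mono)
    fix \<tau> i a assume "i \<in> {..<Ob}" "a \<in> {..<A}"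
    then have a: "a < A" by simp
    let ?\<tau> = "\<tau> @ [(i, a)]"
    have "pmf (\<pi> (Suc n) \<tau> i) a * \<bar>obs S \<theta> \<pi> n \<tau> i - obs S \<theta>' \<pi> n \<tau> i\<bar> =
        \<bar>pmf (\<pi> (Suc n) \<tau> i) a * obs S \<theta> \<pi> n \<tau> i - pmf (\<pi> (Suc n) \<tau> i) a * obs S \<theta>' \<pi> n \<tau> i\<bar>"
      by (simp add: abs_mult right_diff_distrib[symmetric])
    also have "\<dots> = \<bar>\<Sum>j<Ob. obs S \<theta> \<pi> (Suc n) ?\<tau> j - obs S \<theta>' \<pi> (Suc n) ?\<tau> j\<bar>"
      unfolding sum_subtractf sum_obs[OF \<theta> n] sum_obs[OF \<theta>' n] sum_fwd_snoc[OF \<theta> n a] sum_fwd_snoc[OF \<theta>' n a] ..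
    also have "\<dots> \<le> (\<Sum>j<Ob. \<bar>obs S \<theta> \<pi> (Suc n) ?\<tau> j - obs S \<theta>' \<pi> (Suc n) ?\<tau> j\<bar>)"
      by (rule sum_abs)
    finally show "pmf (\<pi> (Suc n) \<tau> i) a * \<bar>obs S \<theta> \<pi> n \<tau> i - obs S \<theta>' \<pi> n \<tau> i\<bar> \<le> \<dots>" .
  qed
  finally show ?thesis .
qed

lemma obs_dist_le_traj_dist:
  assumes \<theta>: "\<theta> \<in> models S A Ob H" and \<theta>': "\<theta>' \<in> models S A Ob H" and \<pi>: "\<pi> \<in> policies A Ob H" and n: "n < H"
  shows "obs_dist S A Ob \<theta> \<theta>' \<pi> n \<le> traj_dist A Ob H \<theta> \<theta>' \<pi>"
proof -
  obtain m where m: "H = Suc m" using n by (cases H) auto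
  have "n \<le> m" using n m by simp
  then have "obs_dist S A Ob \<theta> \<theta>' \<pi> n \<le> obs_dist S A Ob \<theta> \<theta>' \<pi> m"
    using m
  proof (induction rule: inc_induct)
    case (step k)
    then show ?case using obs_dist_mono[OF \<theta> \<theta>' \<pi>, of k] by simp
  qed simp
  then show ?thesis using traj_dist_eq_obs_dist[OF \<theta> \<theta>' \<pi> m] by simp
qed

section \<open>Comparison of two models\<close>

text \<open>One index for each scalar comparison: coordinate \<open>l\<close> of the initial
  pseudo-state, coordinate \<open>l\<close> of the update after observation \<open>i\<close> and
  action \<open>a\<close>, and observation \<open>i\<close> of the last step. Their number is
  polynomial, unlike that of histories.\<close>

datatype error_index = Init nat | Mid nat nat nat nat | Fin nat

definition error_indices :: "nat \<Rightarrow> nat \<Rightarrow> nat \<Rightarrow> nat \<Rightarrow> error_index set" where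
  "error_indices S A Ob H = Init ` {..<S} \<union>
     (\<lambda>(n, i, a, l). Mid n i a l) ` ({..<H - 1} \<times> {..<Ob} \<times> {..<A} \<times> {..<S}) \<union> Fin ` {..<Ob}"

fun error_step :: "nat \<Rightarrow> error_index \<Rightarrow> nat" where
  "error_step H (Init l) = 0"
| "error_step H (Mid n i a l) = n"
| "error_step H (Fin i) = H - 1"

text \<open>The policy enters the errors only here. The emission probability of \<open>i\<close> is
  left to the weight, whose two terms carry those of different models.\<close>

fun error_feature :: "nat \<Rightarrow> nat \<Rightarrow> model \<Rightarrow> policy \<Rightarrow> error_index \<Rightarrow> trajectory \<Rightarrow> nat \<Rightarrow> real" where
  "error_feature S H \<theta> \<pi> (Init l) \<tau> s = fwd S \<theta> \<pi> 0 \<tau> s"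
| "error_feature S H \<theta> \<pi> (Mid n i a l) \<tau> s = pmf (\<pi> (Suc n) \<tau> i) a * fwd S \<theta> \<pi> n \<tau> s"
| "error_feature S H \<theta> \<pi> (Fin i) \<tau> s = fwd S \<theta> \<pi> (H - 1) \<tau> s"

definition error_value ::
  "nat \<Rightarrow> nat \<Rightarrow> nat \<Rightarrow> nat \<Rightarrow> model \<Rightarrow> policy \<Rightarrow> error_index \<Rightarrow> (nat \<Rightarrow> real) \<Rightarrow> real" where
  "error_value S A Ob H \<theta> \<pi> e w =
     (\<Sum>\<tau>\<in>histories A Ob (error_step H e). \<bar>\<Sum>s<S. w s * error_feature S H \<theta> \<pi> e \<tau> s\<bar>)"

lemma sum_error_indices:
  "(\<Sum>e\<in>error_indices S A Ob H. f e) = (\<Sum>l<S. f (Init l)) +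
     (\<Sum>n<H - 1. \<Sum>i<Ob. \<Sum>a<A. \<Sum>l<S. f (Mid n i a l)) + (\<Sum>i<Ob. f (Fin i))"
proof -
  have "(\<Sum>e\<in>(\<lambda>(n, i, a, l). Mid n i a l) ` ({..<H - 1} \<times> {..<Ob} \<times> {..<A} \<times> {..<S}). f e) =
      (\<Sum>(n, i, a, l)\<in>{..<H - 1} \<times> {..<Ob} \<times> {..<A} \<times> {..<S}. f (Mid n i a l))"
    by (subst sum.reindex) (auto simp: inj_on_def intro!: sum.cong)
  moreover have "(\<Sum>e\<in>Init ` {..<S}. f e) = (\<Sum>l<S. f (Init l))"
    "(\<Sum>e\<in>Fin ` {..<Ob}. f e) = (\<Sum>i<Ob. f (Fin i))"
    by (subst sum.reindex; simp add: inj_on_def)+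
  ultimately show ?thesis
    unfolding error_indices_def
    by (subst sum.union_disjoint; (subst sum.union_disjoint)?) (auto simp: sum.cartesian_product)
qed

lemma card_error_indices:
  "card (error_indices S A Ob H) = S + (H - 1) * Ob * A * S + Ob"
  using sum_error_indices[of "\<lambda>_. 1 :: nat" S A Ob H] by simp

lemma error_feature_sum_le_1:
  assumes \<theta>: "\<theta> \<in> models S A Ob H" and \<pi>: "\<pi> \<in> policies A Ob H" and H: "0 < H"
    and e: "e \<in> error_indices S A Ob H"
  shows "(\<Sum>\<tau>\<in>histories A Ob (error_step H e). \<Sum>s<S. \<bar>error_feature S H \<theta> \<pi> e \<tau> s\<bar>) \<le> 1"
proof -
  have "\<bar>error_feature S H \<theta> \<pi> e \<tau> s\<bar> \<le> fwd S \<theta> \<pi> (error_step H e) \<tau> s" for \<tau> s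
    by (cases e) (auto simp: abs_mult fwd_nonneg pmf_le_1 intro!: mult_left_le_one_le)
  then have "(\<Sum>\<tau>\<in>histories A Ob (error_step H e). \<Sum>s<S. \<bar>error_feature S H \<theta> \<pi> e \<tau> s\<bar>)
      \<le> (\<Sum>\<tau>\<in>histories A Ob (error_step H e). \<Sum>s<S. fwd S \<theta> \<pi> (error_step H e) \<tau> s)"
    by (intro sum_mono)
  also have "\<dots> = 1"
    using e H by (intro sum_fwd[OF \<theta> \<pi>]) (auto simp: error_indices_def)
  finally show ?thesis .
qed

text \<open>
  \<open>L\<close> holds left inverses of the emission matrices of the candidate model \<open>\<theta>'\<close>. They turn the
  observation probabilities of the true model \<open>\<theta>\<close> into pseudo-state vectors, and all errors are
  linear in the forward vectors of \<open>\<theta>\<close>, with weights that do not depend on the policy.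
\<close>

locale model_comparison =
  fixes S A Ob H :: nat and \<theta> \<theta>' :: model and L :: "nat \<Rightarrow> nat \<Rightarrow> nat \<Rightarrow> real" and C :: real
  assumes H: "0 < H" and \<theta>: "\<theta> \<in> models S A Ob H" and \<theta>': "\<theta>' \<in> models S A Ob H"
    and left_inverse: "\<And>h l s. 1 \<le> h \<Longrightarrow> h \<le> H \<Longrightarrow> l < S \<Longrightarrow> s < S \<Longrightarrow>
      (\<Sum>i<Ob. L h l i * pmf (emit_prob \<theta>' h s) i) = (if l = s then 1 else 0)"
    and L_bound: "\<And>h i. 1 \<le> h \<Longrightarrow> h \<le> H \<Longrightarrow> i < Ob \<Longrightarrow> (\<Sum>l<S. \<bar>L h l i\<bar>) \<le> C"
    and C: "0 \<le> C"
begin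

text \<open>The matrix that sends true states to pseudo-states; it is the identity where both models
  have the same emissions.\<close>

definition LE :: "nat \<Rightarrow> nat \<Rightarrow> nat \<Rightarrow> real" where
  "LE h l s = (\<Sum>i<Ob. L h l i * pmf (emit_prob \<theta> h s) i)"

definition \<Delta> :: "policy \<Rightarrow> nat \<Rightarrow> trajectory \<Rightarrow> nat \<Rightarrow> real" where
  "\<Delta> \<pi> n \<tau> l = fwd S \<theta>' \<pi> n \<tau> l - (\<Sum>s<S. LE (Suc n) l s * fwd S \<theta> \<pi> n \<tau> s)"

definition D :: "policy \<Rightarrow> nat \<Rightarrow> real" where
  "D \<pi> n = (\<Sum>\<tau>\<in>histories A Ob n. \<Sum>l<S. \<bar>\<Delta> \<pi> n \<tau> l\<bar>)"

abbreviation kernel :: "nat \<Rightarrow> nat \<Rightarrow> nat \<Rightarrow> nat \<Rightarrow> nat \<Rightarrow> real" where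
  "kernel n i a l s \<equiv> pmf (trans_prob \<theta>' (Suc n) a s) l * pmf (emit_prob \<theta>' (Suc n) s) i"

text \<open>\<open>Mid\<close> is the candidate's update of a pseudo-state minus the pseudo-state of
  the true update; the other two are the analogues at the two ends. In \<open>Init\<close> a
  constant appears as a linear form because initial probabilities sum to 1, so for equal models the
  residual vanishes although the weight need not.\<close>

fun error_weight :: "error_index \<Rightarrow> nat \<Rightarrow> real" where
  "error_weight (Init l) s = pmf (init_prob \<theta>') l - LE 1 l s"
| "error_weight (Mid n i a l) s =
     (\<Sum>s'<S. kernel n i a l s' * LE (Suc n) s' s) -
     pmf (emit_prob \<theta> (Suc n) s) i * (\<Sum>s'<S. pmf (trans_prob \<theta> (Suc n) a s) s' * LE (Suc (Suc n)) l s')"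
| "error_weight (Fin i) s =
     (\<Sum>s'<S. pmf (emit_prob \<theta>' H s') i * LE H s' s) - pmf (emit_prob \<theta> H s) i"

abbreviation residual :: "policy \<Rightarrow> error_index \<Rightarrow> trajectory \<Rightarrow> real" where
  "residual \<pi> e \<tau> \<equiv> (\<Sum>s<S. error_weight e s * error_feature S H \<theta> \<pi> e \<tau> s)"

abbreviation err :: "policy \<Rightarrow> error_index \<Rightarrow> real" where
  "err \<pi> e \<equiv> error_value S A Ob H \<theta> \<pi> e (error_weight e)"

lemma err_nonneg: "0 \<le> err \<pi> e"
  by (simp add: error_value_def sum_nonneg)

section \<open>Bounds on weights and state errors\<close>

lemma LE_bound:
  assumes h: "1 \<le> h" "h \<le> H" and s: "s < S"
  shows "(\<Sum>l<S. \<bar>LE h l s\<bar>) \<le> C"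
proof -
  have "(\<Sum>l<S. \<bar>LE h l s\<bar>) \<le> (\<Sum>l<S. \<Sum>i<Ob. \<bar>L h l i\<bar> * pmf (emit_prob \<theta> h s) i)"
    unfolding LE_def by (intro sum_mono order_trans[OF sum_abs]) (simp add: abs_mult)
  also have "\<dots> = (\<Sum>i<Ob. \<Sum>l<S. \<bar>L h l i\<bar> * pmf (emit_prob \<theta> h s) i)"
    by (rule sum.swap)
  also have "\<dots> \<le> (\<Sum>i<Ob. C * pmf (emit_prob \<theta> h s) i)"
    unfolding sum_distrib_right[symmetric] by (intro sum_mono mult_right_mono L_bound h) auto
  also have "\<dots> = C"
    unfolding sum_distrib_left[symmetric] using emit_prob_sum[OF \<theta> h s] by simp
  finally show ?thesis .
qed

lemma LE_entry_bound:
  assumes "1 \<le> h" "h \<le> H" "s < S" "l < S"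
  shows "\<bar>LE h l s\<bar> \<le> C"
proof -
  have "\<bar>LE h l s\<bar> \<le> (\<Sum>l<S. \<bar>LE h l s\<bar>)"
    using assms by (intro member_le_sum) auto
  then show ?thesis using LE_bound[OF assms(1-3)] by linarith
qed

text \<open>\<open>Mid\<close> is a difference of two terms of size at most \<open>C\<close>; the
  other kinds compare one such term with a probability. The constant covers all three.\<close>

lemma error_weight_bound:
  assumes e: "e \<in> error_indices S A Ob H" and s: "s < S"
  shows "\<bar>error_weight e s\<bar> \<le> 2 * C + 1"
proof (cases e)
  case (Init l)
  then have "l < S" using e by (auto simp: error_indices_def)
  then have "\<bar>LE 1 l s\<bar> \<le> C" using LE_entry_bound[of 1 s l] H s by simp
  moreover have "0 \<le> pmf (init_prob \<theta>') l" "pmf (init_prob \<theta>') l \<le> 1" by (auto simp: pmf_le_1)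
  ultimately show ?thesis using C unfolding Init error_weight.simps by linarith
next
  case (Mid n i a l)
  then have n: "Suc n < H" "l < S" "a < A" using e by (auto simp: error_indices_def)
  have "\<bar>\<Sum>s'<S. kernel n i a l s' * LE (Suc n) s' s\<bar>
      \<le> (\<Sum>s'<S. \<bar>LE (Suc n) s' s\<bar>)"
    by (intro order_trans[OF sum_abs] sum_mono)
      (auto simp: abs_mult pmf_le_1 intro!: mult_left_le_one_le mult_le_one)
  also have "\<dots> \<le> C" using n s by (intro LE_bound) auto
  finally have 1: "\<bar>\<Sum>s'<S. kernel n i a l s' * LE (Suc n) s' s\<bar> \<le> C" .
  have "\<bar>\<Sum>s'<S. pmf (trans_prob \<theta> (Suc n) a s) s' * LE (Suc (Suc n)) l s'\<bar>
      \<le> (\<Sum>s'<S. pmf (trans_prob \<theta> (Suc n) a s) s' * C)"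
    using n by (intro order_trans[OF sum_abs] sum_mono) (auto simp: abs_mult intro!: mult_left_mono LE_entry_bound)
  also have "\<dots> = C"
    unfolding sum_distrib_right[symmetric] using trans_prob_sum[OF \<theta>, of "Suc n" a s] n s by simp
  finally have "\<bar>\<Sum>s'<S. pmf (trans_prob \<theta> (Suc n) a s) s' * LE (Suc (Suc n)) l s'\<bar> \<le> C" (is "\<bar>?X\<bar> \<le> C") .
  moreover have "pmf (emit_prob \<theta> (Suc n) s) i * \<bar>?X\<bar> \<le> \<bar>?X\<bar>"
    by (intro mult_left_le_one_le) (auto simp: pmf_le_1)
  ultimately have "\<bar>pmf (emit_prob \<theta> (Suc n) s) i * (\<Sum>s'<S. pmf (trans_prob \<theta> (Suc n) a s) s' * LE (Suc (Suc n)) l s')\<bar> \<le> C"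
    by (simp add: abs_mult)
  then show ?thesis using 1 unfolding Mid error_weight.simps by linarith
next
  case (Fin i)
  have "\<bar>\<Sum>s'<S. pmf (emit_prob \<theta>' H s') i * LE H s' s\<bar> \<le> (\<Sum>s'<S. \<bar>LE H s' s\<bar>)"
    by (intro order_trans[OF sum_abs] sum_mono) (auto simp: abs_mult pmf_le_1 intro!: mult_left_le_one_le)
  also have "\<dots> \<le> C" using H s by (intro LE_bound) auto
  finally have "\<bar>\<Sum>s'<S. pmf (emit_prob \<theta>' H s') i * LE H s' s\<bar> \<le> C" .
  moreover have "0 \<le> pmf (emit_prob \<theta> H s) i" "pmf (emit_prob \<theta> H s) i \<le> 1" by (auto simp: pmf_le_1)
  ultimately show ?thesis using C unfolding Fin error_weight.simps by linarith
qed

text \<open>The left inverse recovers the candidate's forward vector exactly from its observation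
  probabilities and gives the pseudo-state from the true ones. Errors of states are thus controlled
  by errors of observations.\<close>

lemma \<Delta>_eq:
  assumes n: "n < H" and l: "l < S"
  shows "\<Delta> \<pi> n \<tau> l = (\<Sum>i<Ob. L (Suc n) l i * (obs S \<theta>' \<pi> n \<tau> i - obs S \<theta> \<pi> n \<tau> i))"
proof -
  have swap: "(\<Sum>i<Ob. L (Suc n) l i * obs S \<eta> \<pi> n \<tau> i) =
      (\<Sum>s<S. (\<Sum>i<Ob. L (Suc n) l i * pmf (emit_prob \<eta> (Suc n) s) i) * fwd S \<eta> \<pi> n \<tau> s)" for \<eta>
  proof -
    have "(\<Sum>i<Ob. L (Suc n) l i * obs S \<eta> \<pi> n \<tau> i) =
        (\<Sum>i<Ob. \<Sum>s<S. L (Suc n) l i * pmf (emit_prob \<eta> (Suc n) s) i * fwd S \<eta> \<pi> n \<tau> s)"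
      by (simp add: obs_def sum_distrib_left ac_simps)
    also have "\<dots> = (\<Sum>s<S. \<Sum>i<Ob. L (Suc n) l i * pmf (emit_prob \<eta> (Suc n) s) i * fwd S \<eta> \<pi> n \<tau> s)"
      by (rule sum.swap)
    finally show ?thesis by (simp add: sum_distrib_right)
  qed
  have "(\<Sum>s<S. (\<Sum>i<Ob. L (Suc n) l i * pmf (emit_prob \<theta>' (Suc n) s) i) * fwd S \<theta>' \<pi> n \<tau> s)
      = (\<Sum>s<S. if s = l then fwd S \<theta>' \<pi> n \<tau> l else 0)"
    using n l by (intro sum.cong) (auto simp: left_inverse)
  also have "\<dots> = fwd S \<theta>' \<pi> n \<tau> l" using l by simp
  finally show ?thesis
    unfolding right_diff_distrib sum_subtractf swap by (simp add: \<Delta>_def LE_def)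
qed

lemma D_le_obs_dist:
  assumes n: "n < H"
  shows "D \<pi> n \<le> C * obs_dist S A Ob \<theta>' \<theta> \<pi> n"
  unfolding D_def obs_dist_def sum_distrib_left
proof (intro sum_mono)
  fix \<tau>
  let ?d = "\<lambda>i. \<bar>obs S \<theta>' \<pi> n \<tau> i - obs S \<theta> \<pi> n \<tau> i\<bar>"
  have "(\<Sum>l<S. \<bar>\<Delta> \<pi> n \<tau> l\<bar>) \<le> (\<Sum>l<S. \<Sum>i<Ob. \<bar>L (Suc n) l i\<bar> * ?d i)"
    by (intro sum_mono) (auto simp: \<Delta>_eq[OF n] abs_mult[symmetric] intro!: sum_abs)
  also have "\<dots> = (\<Sum>i<Ob. \<Sum>l<S. \<bar>L (Suc n) l i\<bar> * ?d i)" by (rule sum.swap)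
  also have "\<dots> \<le> (\<Sum>i<Ob. C * ?d i)"
    unfolding sum_distrib_right[symmetric] using n by (intro sum_mono mult_right_mono L_bound) auto
  finally show "(\<Sum>l<S. \<bar>\<Delta> \<pi> n \<tau> l\<bar>) \<le> (\<Sum>i<Ob. C * ?d i)" .
qed

lemma D_le_traj_dist:
  assumes "\<pi> \<in> policies A Ob H" "n < H"
  shows "D \<pi> n \<le> C * traj_dist A Ob H \<theta>' \<theta> \<pi>"
  using D_le_obs_dist[OF assms(2), of \<pi>] obs_dist_le_traj_dist[OF \<theta>' \<theta> assms] C
  by (meson mult_left_mono order_trans)

lemma D_0: "D \<pi> 0 = (\<Sum>l<S. err \<pi> (Init l))"
proof -
  have "\<Delta> \<pi> 0 [] l = residual \<pi> (Init l) []" for l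
  proof -
    have "\<Delta> \<pi> 0 [] l = pmf (init_prob \<theta>') l * (\<Sum>s<S. pmf (init_prob \<theta>) s) - (\<Sum>s<S. LE 1 l s * pmf (init_prob \<theta>) s)"
      by (simp add: \<Delta>_def init_prob_sum[OF \<theta>])
    also have "\<dots> = (\<Sum>s<S. (pmf (init_prob \<theta>') l - LE 1 l s) * pmf (init_prob \<theta>) s)"
      by (simp add: left_diff_distrib sum_subtractf sum_distrib_left)
    finally show ?thesis by simp
  qed
  then show ?thesis
    by (simp add: D_def error_value_def histories_0 del: error_weight.simps error_feature.simps)
qed

text \<open>Adding and subtracting the candidate's update of the true pseudo-state leaves the
  candidate's operator on the old error plus a residual that is linear in the true forward
  vector.\<close>

lemma \<Delta>_Suc:
  "\<Delta> \<pi> (Suc n) (\<tau> @ [(i, a)]) l =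
     pmf (\<pi> (Suc n) \<tau> i) a * (\<Sum>s<S. kernel n i a l s * \<Delta> \<pi> n \<tau> s) +
     residual \<pi> (Mid n i a l) \<tau>"
proof -
  let ?p = "pmf (\<pi> (Suc n) \<tau> i) a"
  let ?TE = "\<lambda>s. kernel n i a l s"
  let ?f = "fwd S \<theta> \<pi> n \<tau>" and ?f' = "fwd S \<theta>' \<pi> n \<tau>"
  have a: "(\<Sum>s<S. ?TE s * (\<Sum>s'<S. LE (Suc n) s s' * ?f s')) = (\<Sum>s'<S. (\<Sum>s<S. ?TE s * LE (Suc n) s s') * ?f s')"
  proof -
    have "(\<Sum>s<S. ?TE s * (\<Sum>s'<S. LE (Suc n) s s' * ?f s')) = (\<Sum>s<S. \<Sum>s'<S. ?TE s * LE (Suc n) s s' * ?f s')"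
      by (simp add: sum_distrib_left mult.assoc)
    also have "\<dots> = (\<Sum>s'<S. \<Sum>s<S. ?TE s * LE (Suc n) s s' * ?f s')" by (rule sum.swap)
    finally show ?thesis by (simp add: sum_distrib_right)
  qed
  have b: "(\<Sum>s<S. LE (Suc (Suc n)) l s * fwd S \<theta> \<pi> (Suc n) (\<tau> @ [(i, a)]) s) =
      ?p * (\<Sum>s<S. pmf (emit_prob \<theta> (Suc n) s) i * (\<Sum>s'<S. pmf (trans_prob \<theta> (Suc n) a s) s' * LE (Suc (Suc n)) l s') * ?f s)"
  proof -
    have "(\<Sum>s<S. LE (Suc (Suc n)) l s * fwd S \<theta> \<pi> (Suc n) (\<tau> @ [(i, a)]) s) =
        (\<Sum>s<S. \<Sum>s'<S. ?p * (pmf (emit_prob \<theta> (Suc n) s') i * (pmf (trans_prob \<theta> (Suc n) a s') s * LE (Suc (Suc n)) l s) * ?f s'))"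
      unfolding fwd_snoc by (simp add: sum_distrib_left ac_simps)
    also have "\<dots> = (\<Sum>s'<S. \<Sum>s<S. ?p * (pmf (emit_prob \<theta> (Suc n) s') i * (pmf (trans_prob \<theta> (Suc n) a s') s * LE (Suc (Suc n)) l s) * ?f s'))"
      by (rule sum.swap)
    finally show ?thesis by (simp only: sum_distrib_left sum_distrib_right)
  qed
  have c: "fwd S \<theta>' \<pi> (Suc n) (\<tau> @ [(i, a)]) l = ?p * (\<Sum>s<S. ?TE s * ?f' s)"
    unfolding fwd_snoc by (simp add: ac_simps)
  have "residual \<pi> (Mid n i a l) \<tau> =
     ?p * (\<Sum>s'<S. (\<Sum>s<S. ?TE s * LE (Suc n) s s') * ?f s') -
     ?p * (\<Sum>s<S. pmf (emit_prob \<theta> (Suc n) s) i * (\<Sum>s'<S. pmf (trans_prob \<theta> (Suc n) a s) s' * LE (Suc (Suc n)) l s') * ?f s)"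
    unfolding sum_distrib_left[of ?p] sum_subtractf[symmetric]
    by (intro sum.cong refl) (simp add: algebra_simps)
  then show ?thesis
    unfolding \<Delta>_def[of \<pi> "Suc n"] b c
    by (simp add: \<Delta>_def right_diff_distrib sum_subtractf a del: error_weight.simps error_feature.simps)
qed

text \<open>The first summand of \<open>\<Delta>_Suc\<close> with the absolute value moved inside,
  in a form that can be summed exactly.\<close>

definition propagated :: "policy \<Rightarrow> nat \<Rightarrow> trajectory \<Rightarrow> nat \<Rightarrow> nat \<Rightarrow> nat \<Rightarrow> real" where
  "propagated \<pi> n \<tau> i a l = pmf (\<pi> (Suc n) \<tau> i) a *
     (\<Sum>s<S. kernel n i a l s * \<bar>\<Delta> \<pi> n \<tau> s\<bar>)"

text \<open>Policy, emission and transition of the candidate form a probability kernel, so mass is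
  preserved. This is why errors add up over the steps instead of multiplying.\<close>

lemma sum_propagated:
  assumes \<pi>: "\<pi> \<in> policies A Ob H" and n: "Suc n < H"
  shows "(\<Sum>\<tau>\<in>histories A Ob n. \<Sum>i<Ob. \<Sum>a<A. \<Sum>l<S. propagated \<pi> n \<tau> i a l) = D \<pi> n"
  unfolding D_def
proof (rule sum.cong[OF refl])
  fix \<tau> assume \<tau>: "\<tau> \<in> histories A Ob n"
  let ?e = "\<lambda>s i. pmf (emit_prob \<theta>' (Suc n) s) i * \<bar>\<Delta> \<pi> n \<tau> s\<bar>"
  have "(\<Sum>i<Ob. \<Sum>a<A. \<Sum>l<S. propagated \<pi> n \<tau> i a l) = (\<Sum>i<Ob. \<Sum>a<A. pmf (\<pi> (Suc n) \<tau> i) a * (\<Sum>s<S. ?e s i))"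
  proof (intro sum.cong refl)
    fix i a assume "a \<in> {..<A}"
    then have a: "a < A" by simp
    have "(\<Sum>l<S. \<Sum>s<S. kernel n i a l s * \<bar>\<Delta> \<pi> n \<tau> s\<bar>)
        = (\<Sum>s<S. \<Sum>l<S. kernel n i a l s * \<bar>\<Delta> \<pi> n \<tau> s\<bar>)"
      by (rule sum.swap)
    also have "\<dots> = (\<Sum>s<S. ?e s i)"
      unfolding sum_distrib_right[symmetric]
      using a n by (intro sum.cong) (auto simp: trans_prob_sum[OF \<theta>'])
    finally show "(\<Sum>l<S. propagated \<pi> n \<tau> i a l) = pmf (\<pi> (Suc n) \<tau> i) a * (\<Sum>s<S. ?e s i)"
      unfolding propagated_def sum_distrib_left[symmetric] by simp
  qed
  also have "\<dots> = (\<Sum>i<Ob. \<Sum>s<S. ?e s i)"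
    unfolding sum_distrib_right[symmetric]
    using n \<tau> by (intro sum.cong) (auto simp: policy_sum[OF \<pi>])
  also have "\<dots> = (\<Sum>s<S. \<Sum>i<Ob. ?e s i)" by (rule sum.swap)
  also have "\<dots> = (\<Sum>s<S. \<bar>\<Delta> \<pi> n \<tau> s\<bar>)"
    unfolding sum_distrib_right[symmetric]
    using n by (intro sum.cong) (auto simp: emit_prob_sum[OF \<theta>'])
  finally show "(\<Sum>i<Ob. \<Sum>a<A. \<Sum>l<S. propagated \<pi> n \<tau> i a l) = (\<Sum>s<S. \<bar>\<Delta> \<pi> n \<tau> s\<bar>)" .
qed

lemma abs_propagated:
  "\<bar>pmf (\<pi> (Suc n) \<tau> i) a * (\<Sum>s<S. kernel n i a l s * \<Delta> \<pi> n \<tau> s)\<bar>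
     \<le> propagated \<pi> n \<tau> i a l"
  unfolding propagated_def abs_mult
  by (intro mult_mono order_trans[OF sum_abs] sum_mono) (auto simp: abs_mult intro!: sum_nonneg)

definition mid_error :: "policy \<Rightarrow> nat \<Rightarrow> real" where
  "mid_error \<pi> n = (\<Sum>i<Ob. \<Sum>a<A. \<Sum>l<S. err \<pi> (Mid n i a l))"

lemma mid_error_eq:
  "mid_error \<pi> n = (\<Sum>\<tau>\<in>histories A Ob n. \<Sum>i<Ob. \<Sum>a<A. \<Sum>l<S.
     \<bar>residual \<pi> (Mid n i a l) \<tau>\<bar>)"
proof -
  let ?g = "\<lambda>\<tau> i a l. \<bar>residual \<pi> (Mid n i a l) \<tau>\<bar>"
  have "mid_error \<pi> n = (\<Sum>i<Ob. \<Sum>a<A. \<Sum>l<S. \<Sum>\<tau>\<in>histories A Ob n. ?g \<tau> i a l)"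
    by (simp add: mid_error_def error_value_def del: error_weight.simps error_feature.simps)
  also have "\<dots> = (\<Sum>i<Ob. \<Sum>a<A. \<Sum>\<tau>\<in>histories A Ob n. \<Sum>l<S. ?g \<tau> i a l)"
    by (intro sum.cong refl sum.swap)
  also have "\<dots> = (\<Sum>i<Ob. \<Sum>\<tau>\<in>histories A Ob n. \<Sum>a<A. \<Sum>l<S. ?g \<tau> i a l)"
    by (intro sum.cong refl sum.swap)
  also have "\<dots> = (\<Sum>\<tau>\<in>histories A Ob n. \<Sum>i<Ob. \<Sum>a<A. \<Sum>l<S. ?g \<tau> i a l)"
    by (rule sum.swap)
  finally show ?thesis .
qed

lemma D_Suc_le:
  assumes \<pi>: "\<pi> \<in> policies A Ob H" and n: "Suc n < H"
  shows "D \<pi> (Suc n) \<le> D \<pi> n + mid_error \<pi> n"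
  unfolding sum_propagated[OF \<pi> n, symmetric] mid_error_eq sum.distrib[symmetric]
  unfolding D_def sum_histories_Suc \<Delta>_Suc
  by (intro sum_mono order_trans[OF abs_triangle_ineq] add_mono abs_propagated order_refl)

text \<open>\<open>\<Delta>_Suc\<close> read backwards: a residual is the new error minus the
  propagated old one.\<close>

lemma mid_error_le:
  assumes \<pi>: "\<pi> \<in> policies A Ob H" and n: "Suc n < H"
  shows "mid_error \<pi> n \<le> D \<pi> (Suc n) + D \<pi> n"
proof -
  have "\<bar>residual \<pi> (Mid n i a l) \<tau>\<bar>
      \<le> \<bar>\<Delta> \<pi> (Suc n) (\<tau> @ [(i, a)]) l\<bar> + propagated \<pi> n \<tau> i a l" for i a l \<tau>
    using \<Delta>_Suc[of \<pi> n \<tau> i a l] abs_propagated[of \<pi> n \<tau> i a l] by linarith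
  then show ?thesis
    unfolding sum_propagated[OF \<pi> n, symmetric] mid_error_eq
    unfolding D_def sum_histories_Suc sum.distrib[symmetric]
    by (intro sum_mono)
qed

lemma err_Mid_le:
  assumes "i < Ob" "a < A" "l < S"
  shows "err \<pi> (Mid n i a l) \<le> mid_error \<pi> n"
proof -
  have "err \<pi> (Mid n i a l) \<le> (\<Sum>l<S. err \<pi> (Mid n i a l))"
    using assms by (intro member_le_sum err_nonneg) auto
  also have "\<dots> \<le> (\<Sum>a<A. \<Sum>l<S. err \<pi> (Mid n i a l))"
    using assms by (intro member_le_sum[where f = "\<lambda>a. \<Sum>l<S. err \<pi> (Mid n i a l)"] sum_nonneg err_nonneg) auto
  also have "\<dots> \<le> mid_error \<pi> n" unfolding mid_error_def
    using assms by (intro member_le_sum[where f = "\<lambda>i. \<Sum>a<A. \<Sum>l<S. err \<pi> (Mid n i a l)"] sum_nonneg err_nonneg) auto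
  finally show ?thesis .
qed

text \<open>No update follows the last observation, so the final error is split in observation space
  instead of pseudo-state space.\<close>

lemma obs_diff_last:
  "obs S \<theta>' \<pi> (H - 1) \<tau> i - obs S \<theta> \<pi> (H - 1) \<tau> i =
     (\<Sum>s<S. pmf (emit_prob \<theta>' H s) i * \<Delta> \<pi> (H - 1) \<tau> s) +
     residual \<pi> (Fin i) \<tau>"
proof -
  let ?f = "fwd S \<theta> \<pi> (H - 1) \<tau>" and ?f' = "fwd S \<theta>' \<pi> (H - 1) \<tau>"
  have "(\<Sum>s<S. pmf (emit_prob \<theta>' H s) i * (\<Sum>s'<S. LE H s s' * ?f s')) = (\<Sum>s<S. \<Sum>s'<S. pmf (emit_prob \<theta>' H s) i * LE H s s' * ?f s')"
    by (simp add: sum_distrib_left mult.assoc)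
  also have "\<dots> = (\<Sum>s'<S. \<Sum>s<S. pmf (emit_prob \<theta>' H s) i * LE H s s' * ?f s')" by (rule sum.swap)
  also have "\<dots> = (\<Sum>s'<S. (\<Sum>s<S. pmf (emit_prob \<theta>' H s) i * LE H s s') * ?f s')"
    by (simp add: sum_distrib_right)
  finally have a: "(\<Sum>s<S. pmf (emit_prob \<theta>' H s) i * (\<Sum>s'<S. LE H s s' * ?f s')) =
      (\<Sum>s'<S. (\<Sum>s<S. pmf (emit_prob \<theta>' H s) i * LE H s s') * ?f s')" .
  have SucH: "Suc (H - 1) = H" using H by simp
  have o: "obs S \<eta> \<pi> (H - 1) \<tau> i = (\<Sum>s<S. pmf (emit_prob \<eta> H s) i * fwd S \<eta> \<pi> (H - 1) \<tau> s)" for \<eta>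
    unfolding obs_def SucH by (simp only: mult.commute)
  show ?thesis
    unfolding o \<Delta>_def error_weight.simps error_feature.simps SucH right_diff_distrib left_diff_distrib sum_subtractf a
    by simp
qed

lemma sum_propagated_last:
  "(\<Sum>\<tau>\<in>histories A Ob (H - 1). \<Sum>i<Ob. \<Sum>s<S. pmf (emit_prob \<theta>' H s) i * \<bar>\<Delta> \<pi> (H - 1) \<tau> s\<bar>) = D \<pi> (H - 1)"
  unfolding D_def
proof (rule sum.cong[OF refl])
  fix \<tau>
  have "(\<Sum>i<Ob. \<Sum>s<S. pmf (emit_prob \<theta>' H s) i * \<bar>\<Delta> \<pi> (H - 1) \<tau> s\<bar>) = (\<Sum>s<S. \<Sum>i<Ob. pmf (emit_prob \<theta>' H s) i * \<bar>\<Delta> \<pi> (H - 1) \<tau> s\<bar>)"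
    by (rule sum.swap)
  also have "\<dots> = (\<Sum>s<S. \<bar>\<Delta> \<pi> (H - 1) \<tau> s\<bar>)"
    unfolding sum_distrib_right[symmetric] using H by (intro sum.cong) (auto simp: emit_prob_sum[OF \<theta>'])
  finally show "(\<Sum>i<Ob. \<Sum>s<S. pmf (emit_prob \<theta>' H s) i * \<bar>\<Delta> \<pi> (H - 1) \<tau> s\<bar>) = (\<Sum>s<S. \<bar>\<Delta> \<pi> (H - 1) \<tau> s\<bar>)" .
qed

lemma abs_propagated_last:
  "\<bar>\<Sum>s<S. pmf (emit_prob \<theta>' H s) i * \<Delta> \<pi> (H - 1) \<tau> s\<bar> \<le> (\<Sum>s<S. pmf (emit_prob \<theta>' H s) i * \<bar>\<Delta> \<pi> (H - 1) \<tau> s\<bar>)"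
  by (intro order_trans[OF sum_abs] sum_mono) (simp add: abs_mult)

lemma sum_err_Fin:
  "(\<Sum>i<Ob. err \<pi> (Fin i)) = (\<Sum>\<tau>\<in>histories A Ob (H - 1). \<Sum>i<Ob.
     \<bar>residual \<pi> (Fin i) \<tau>\<bar>)"
  unfolding error_value_def error_step.simps by (rule sum.swap)

text \<open>Meant for the new policy: unrolling \<open>D_Suc_le\<close> from \<open>D_0\<close>
  leaves the residuals of all steps, and \<open>obs_diff_last\<close> adds the final ones.\<close>

lemma traj_dist_le_errors:
  assumes \<pi>: "\<pi> \<in> policies A Ob H"
  shows "traj_dist A Ob H \<theta>' \<theta> \<pi> \<le> (\<Sum>e\<in>error_indices S A Ob H. err \<pi> e)"
proof -
  have "n < H \<Longrightarrow> D \<pi> n \<le> (\<Sum>l<S. err \<pi> (Init l)) + (\<Sum>m<n. mid_error \<pi> m)" for n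
  proof (induction n)
    case (Suc n)
    then show ?case using D_Suc_le[OF \<pi>, of n] by simp
  qed (simp add: D_0)
  then have "D \<pi> (H - 1) \<le> (\<Sum>l<S. err \<pi> (Init l)) + (\<Sum>m<H - 1. mid_error \<pi> m)" using H by simp
  moreover have "traj_dist A Ob H \<theta>' \<theta> \<pi> \<le> D \<pi> (H - 1) + (\<Sum>i<Ob. err \<pi> (Fin i))"
  proof -
    have "traj_dist A Ob H \<theta>' \<theta> \<pi> = obs_dist S A Ob \<theta>' \<theta> \<pi> (H - 1)"
      using H by (intro traj_dist_eq_obs_dist[OF \<theta>' \<theta> \<pi>]) simp
    also have "\<dots> \<le> D \<pi> (H - 1) + (\<Sum>i<Ob. err \<pi> (Fin i))"
      unfolding obs_dist_def obs_diff_last sum_propagated_last[symmetric] sum_err_Fin sum.distrib[symmetric, where A = "histories _ _ _"]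
        sum.distrib[symmetric, where A = "{..<Ob}"]
      by (intro sum_mono order_trans[OF abs_triangle_ineq] add_mono abs_propagated_last order_refl)
    finally show ?thesis .
  qed
  ultimately show ?thesis
    unfolding sum_error_indices mid_error_def by simp
qed

text \<open>Meant for the past policies: each residual is a combination of neighbouring errors, so
  its factor is \<open>C\<close>, \<open>2 * C\<close> or \<open>C + 1\<close> according to the kind
  of index.\<close>

lemma error_le_traj_dist:
  assumes \<pi>: "\<pi> \<in> policies A Ob H" and e: "e \<in> error_indices S A Ob H"
  shows "err \<pi> e \<le> (2 * C + 1) * traj_dist A Ob H \<theta>' \<theta> \<pi>"
proof -
  let ?d = "traj_dist A Ob H \<theta>' \<theta> \<pi>"
  have d: "0 \<le> ?d" by (simp add: traj_dist_def sum_nonneg)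
  have Cd: "0 \<le> C * ?d" using C d by simp
  show ?thesis
  proof (cases e)
    case (Init l)
    then have "l < S" using e by (auto simp: error_indices_def)
    then have "err \<pi> e \<le> D \<pi> 0"
      unfolding D_0 Init by (intro member_le_sum[where f = "\<lambda>l. err \<pi> (Init l)"] err_nonneg) auto
    also have "\<dots> \<le> C * ?d" by (rule D_le_traj_dist[OF \<pi> H])
    finally show ?thesis using d Cd by (simp add: algebra_simps)
  next
    case (Mid n i a l)
    then have n: "Suc n < H" "i < Ob" "a < A" "l < S" using e by (auto simp: error_indices_def)
    have "err \<pi> e \<le> mid_error \<pi> n" unfolding Mid by (rule err_Mid_le[OF n(2-4)])
    also have "\<dots> \<le> D \<pi> (Suc n) + D \<pi> n" by (rule mid_error_le[OF \<pi> n(1)])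
    also have "\<dots> \<le> C * ?d + C * ?d" using n by (intro add_mono D_le_traj_dist[OF \<pi>]) auto
    finally show ?thesis using d by (simp add: algebra_simps)
  next
    case (Fin i)
    then have i: "i < Ob" using e by (auto simp: error_indices_def)
    have le: "\<bar>residual \<pi> (Fin i) \<tau>\<bar> \<le>
        \<bar>obs S \<theta>' \<pi> (H - 1) \<tau> i - obs S \<theta> \<pi> (H - 1) \<tau> i\<bar> + (\<Sum>s<S. pmf (emit_prob \<theta>' H s) i * \<bar>\<Delta> \<pi> (H - 1) \<tau> s\<bar>)" for i \<tau>
      using obs_diff_last[of \<pi> \<tau> i] abs_propagated_last[of i \<pi> \<tau>] by linarith
    have "err \<pi> e \<le> (\<Sum>i<Ob. err \<pi> (Fin i))"
      unfolding Fin using i by (intro member_le_sum[where f = "\<lambda>i. err \<pi> (Fin i)"] err_nonneg) auto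
    also have "\<dots> \<le> obs_dist S A Ob \<theta>' \<theta> \<pi> (H - 1) + D \<pi> (H - 1)"
      unfolding obs_dist_def sum_propagated_last[symmetric] sum_err_Fin sum.distrib[symmetric]
      by (intro sum_mono le)
    also have "\<dots> \<le> ?d + C * ?d"
      using H by (intro add_mono D_le_traj_dist[OF \<pi>] obs_dist_le_traj_dist[OF \<theta>' \<theta> \<pi>]) auto
    finally show ?thesis using Cd by (simp add: algebra_simps)
  qed
qed

end

section \<open>Finite covers of the models\<close>

text \<open>The numbers \<open>m * pmf p i\<close> are rounded up to integers and renormalised.
  Rounding up never loses mass at a point and gives a total between \<open>m\<close> and
  \<open>m + n\<close>, so renormalising costs at most the factor (m + n) / m.\<close>

lemma pmf_finite_cover:
  fixes n m :: nat
  assumes m: "0 < m"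
  shows "\<exists>C. finite C \<and> card C \<le> (m + 1) ^ n \<and> (\<forall>q\<in>C. set_pmf q \<subseteq> {..<n}) \<and>
    (\<forall>p :: nat pmf. set_pmf p \<subseteq> {..<n} \<longrightarrow> (\<exists>q\<in>C. \<forall>i. pmf p i \<le> (1 + real n / real m) * pmf q i))"
proof -
  define F where "F = {..<n} \<rightarrow>\<^sub>E {0..m}"
  define M where "M v = (\<Sum>i<n. replicate_mset (v i) i)" for v :: "nat \<Rightarrow> nat"
  define C where "C = (\<lambda>v. pmf_of_multiset (M v)) ` {v \<in> F. M v \<noteq> {#}}"
  have fF: "finite F" unfolding F_def by (intro finite_PiE) auto
  have cM: "count (M v) j = (if j < n then v j else 0)" for v j
    unfolding M_def count_sum by (simp add: if_distrib cong: if_cong)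
  have sM: "size (M v) = (\<Sum>i<n. v i)" for v
    unfolding M_def by (induction n) auto
  have "card C \<le> card {v \<in> F. M v \<noteq> {#}}" unfolding C_def using fF by (intro card_image_le) auto
  also have "\<dots> \<le> card F" using fF by (intro card_mono) auto
  also have "\<dots> = (m + 1) ^ n" by (simp add: F_def card_PiE)
  finally have "card C \<le> (m + 1) ^ n" .
  moreover have "finite C" using fF by (simp add: C_def)
  moreover have "set_pmf q \<subseteq> {..<n}" if q: "q \<in> C" for q
  proof -
    obtain v where v: "q = pmf_of_multiset (M v)" "M v \<noteq> {#}" using q unfolding C_def by blast
    have "set_mset (M v) \<subseteq> {..<n}"
      using cM[of v] by (auto simp: set_mset_def split: if_splits)
    then show ?thesis using v by simp
  qed
  moreover have "\<exists>q\<in>C. \<forall>i. pmf p i \<le> (1 + real n / real m) * pmf q i" if p: "set_pmf p \<subseteq> {..<n}" for p :: "nat pmf"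
  proof -
    define v where "v = (\<lambda>i\<in>{..<n}. nat \<lceil>real m * pmf p i\<rceil>)"
    have vlow: "real m * pmf p i \<le> real (v i)" if "i < n" for i
      using that by (simp add: v_def, linarith?)
    have vup: "real (v i) \<le> real m * pmf p i + 1" if "i < n" for i
      using that by (simp add: v_def, linarith?)
    have sp: "(\<Sum>i<n. pmf p i) = 1" by (rule sum_pmf_lessThan[OF p])
    have "v i \<le> m" if "i < n" for i
    proof -
      have "real m * pmf p i \<le> real m" using pmf_le_1[of p i] by (simp add: mult_left_le)
      then show ?thesis using that by (simp add: v_def)
    qed
    then have vF: "v \<in> F" by (auto simp: F_def v_def)
    have "real m = (\<Sum>i<n. real m * pmf p i)" by (simp add: sum_distrib_left[symmetric] sp)
    also have "\<dots> \<le> (\<Sum>i<n. real (v i))" by (intro sum_mono vlow) auto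
    finally have slow: "real m \<le> real (size (M v))" by (simp add: sM)
    have "(\<Sum>i<n. real (v i)) \<le> (\<Sum>i<n. real m * pmf p i + 1)" by (intro sum_mono vup) auto
    also have "\<dots> = real m + real n" by (simp add: sum.distrib sum_distrib_left[symmetric] sp)
    finally have sup: "real (size (M v)) \<le> real m + real n" by (simp add: sM)
    have ne: "M v \<noteq> {#}" using slow m by auto
    have "pmf p i \<le> (1 + real n / real m) * pmf (pmf_of_multiset (M v)) i" for i
    proof (cases "i < n")
      case True
      have "pmf p i \<le> real (v i) / real m" using vlow[OF True] m by (simp add: field_simps)
      also have "\<dots> = real (size (M v)) / real m * (real (v i) / real (size (M v)))"
        using slow m ne by simp
      also have "\<dots> \<le> (1 + real n / real m) * (real (v i) / real (size (M v)))"
        using sup m by (intro mult_right_mono) (auto simp: field_simps)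
      finally show ?thesis using True ne by (simp add: pmf_of_multiset cM)
    next
      case False
      then have "pmf p i = 0" using p by (auto simp: pmf_eq_0_set_pmf)
      then show ?thesis by simp
    qed
    then show ?thesis using vF ne by (auto simp: C_def)
  qed
  ultimately show ?thesis by blast
qed

text \<open>A one-sided ratio bound multiplies along steps and episodes and so transfers whole
  likelihoods, which closeness in l1 would not.\<close>

abbreviation dominated :: "nat \<Rightarrow> nat \<Rightarrow> nat \<Rightarrow> real \<Rightarrow> model \<Rightarrow> model \<Rightarrow> bool" where
  "dominated A Ob H c \<theta> \<theta>' \<equiv> (\<forall>\<pi>\<in>policies A Ob H. \<forall>\<tau>.
     pmf (traj_pmf H \<theta> \<pi>) \<tau> \<le> c * pmf (traj_pmf H \<theta>' \<pi>) \<tau>)"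

text \<open>Policy factors are common to both sides; a past of length \<open>n\<close> uses the
  initial law, \<open>n\<close> transitions and \<open>n\<close> emissions, whence the
  exponents.\<close>

lemma fwd_dominated:
  assumes cS: "1 \<le> cS" and cO: "1 \<le> cO"
    and init: "\<And>s. s < S \<Longrightarrow> pmf (init_prob \<theta>) s \<le> cS * pmf (init_prob \<theta>') s"
    and trans: "\<And>h a s s'. 1 \<le> h \<Longrightarrow> h < H \<Longrightarrow> a < A \<Longrightarrow> s < S \<Longrightarrow> s' < S \<Longrightarrow>
      pmf (trans_prob \<theta> h a s) s' \<le> cS * pmf (trans_prob \<theta>' h a s) s'"
    and emit: "\<And>h s i. 1 \<le> h \<Longrightarrow> h \<le> H \<Longrightarrow> s < S \<Longrightarrow> i < Ob \<Longrightarrow>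
      pmf (emit_prob \<theta> h s) i \<le> cO * pmf (emit_prob \<theta>' h s) i"
  shows "n < H \<Longrightarrow> \<tau> \<in> histories A Ob n \<Longrightarrow> s < S \<Longrightarrow>
    fwd S \<theta> \<pi> n \<tau> s \<le> cS ^ Suc n * cO ^ n * fwd S \<theta>' \<pi> n \<tau> s"
proof (induction n arbitrary: \<tau> s)
  case 0
  then show ?case using init by simp
next
  case (Suc n)
  then have "\<tau> \<noteq> []" by (auto simp: histories_def)
  then obtain \<sigma> i a where \<tau>: "\<tau> = \<sigma> @ [(i, a)]" by (metis prod.exhaust rev_exhaust)
  then have \<sigma>: "\<sigma> \<in> histories A Ob n" "i < Ob" "a < A" using Suc.prems by (auto simp: histories_def)
  have "fwd S \<theta> \<pi> n \<sigma> s' * pmf (emit_prob \<theta> (Suc n) s') i * pmf (trans_prob \<theta> (Suc n) a s') s \<le>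
      (cS ^ Suc n * cO ^ n * fwd S \<theta>' \<pi> n \<sigma> s') * (cO * pmf (emit_prob \<theta>' (Suc n) s') i) *
      (cS * pmf (trans_prob \<theta>' (Suc n) a s') s)" if "s' < S" for s'
    using that Suc.prems \<sigma> cS cO
    by (intro mult_mono Suc.IH emit trans mult_nonneg_nonneg fwd_nonneg) auto
  then have "(\<Sum>s'<S. fwd S \<theta> \<pi> n \<sigma> s' * pmf (emit_prob \<theta> (Suc n) s') i * pmf (trans_prob \<theta> (Suc n) a s') s) \<le>
     (\<Sum>s'<S. (cS ^ Suc n * cO ^ n * fwd S \<theta>' \<pi> n \<sigma> s') * (cO * pmf (emit_prob \<theta>' (Suc n) s') i) *
      (cS * pmf (trans_prob \<theta>' (Suc n) a s') s))"
    by (intro sum_mono) auto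
  also have "\<dots> = cS ^ Suc (Suc n) * cO ^ Suc n *
     (\<Sum>s'<S. fwd S \<theta>' \<pi> n \<sigma> s' * pmf (emit_prob \<theta>' (Suc n) s') i * pmf (trans_prob \<theta>' (Suc n) a s') s)"
    unfolding sum_distrib_left by (intro sum.cong refl) (simp add: ac_simps)
  finally have "fwd S \<theta> \<pi> (Suc n) \<tau> s \<le> pmf (\<pi> (Suc n) \<sigma> i) a * (cS ^ Suc (Suc n) * cO ^ Suc n *
     (\<Sum>s'<S. fwd S \<theta>' \<pi> n \<sigma> s' * pmf (emit_prob \<theta>' (Suc n) s') i * pmf (trans_prob \<theta>' (Suc n) a s') s))"
    unfolding \<tau> fwd_snoc by (rule mult_left_mono) simp
  then show ?case unfolding \<tau> fwd_snoc by (simp only: mult.left_commute)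
qed

lemma pmf_traj_pmf_dominated:
  assumes \<theta>: "\<theta> \<in> models S A Ob H" and \<theta>': "\<theta>' \<in> models S A Ob H" and \<pi>: "\<pi> \<in> policies A Ob H" and H: "0 < H"
    and cS: "1 \<le> cS" and cO: "1 \<le> cO"
    and init: "\<And>s. s < S \<Longrightarrow> pmf (init_prob \<theta>) s \<le> cS * pmf (init_prob \<theta>') s"
    and trans: "\<And>h a s s'. 1 \<le> h \<Longrightarrow> h < H \<Longrightarrow> a < A \<Longrightarrow> s < S \<Longrightarrow> s' < S \<Longrightarrow>
      pmf (trans_prob \<theta> h a s) s' \<le> cS * pmf (trans_prob \<theta>' h a s) s'"
    and emit: "\<And>h s i. 1 \<le> h \<Longrightarrow> h \<le> H \<Longrightarrow> s < S \<Longrightarrow> i < Ob \<Longrightarrow>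
      pmf (emit_prob \<theta> h s) i \<le> cO * pmf (emit_prob \<theta>' h s) i"
  shows "pmf (traj_pmf H \<theta> \<pi>) \<tau> \<le> cS ^ H * cO ^ H * pmf (traj_pmf H \<theta>' \<pi>) \<tau>"
proof (cases "\<tau> \<in> histories A Ob H")
  case False
  then have "pmf (traj_pmf H \<theta> \<pi>) \<tau> = 0"
    using traj_pmf_support[OF \<theta> \<pi> H] by (auto simp: pmf_eq_0_set_pmf)
  then show ?thesis using cS cO by simp
next
  case True
  obtain n where n: "H = Suc n" using H by (cases H) auto
  have "\<tau> \<noteq> []" using True n by (auto simp: histories_def)
  then obtain \<sigma> i a where \<tau>: "\<tau> = \<sigma> @ [(i, a)]" by (metis prod.exhaust rev_exhaust)
  then have \<sigma>: "\<sigma> \<in> histories A Ob n" "i < Ob" "a < A" using True n by (auto simp: histories_def)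
  have "obs S \<theta> \<pi> n \<sigma> i \<le> (\<Sum>s<S. (cS ^ Suc n * cO ^ n * fwd S \<theta>' \<pi> n \<sigma> s) * (cO * pmf (emit_prob \<theta>' (Suc n) s) i))"
    unfolding obs_def
    using \<sigma> n cS cO
    by (intro sum_mono mult_mono emit mult_nonneg_nonneg fwd_nonneg
        fwd_dominated[where H = H and A = A and Ob = Ob, OF cS cO init trans emit]) auto
  also have "\<dots> = cS ^ H * cO ^ H * obs S \<theta>' \<pi> n \<sigma> i"
    unfolding obs_def sum_distrib_left n by (intro sum.cong refl) (simp add: ac_simps)
  finally have "pmf (\<pi> (Suc n) \<sigma> i) a * obs S \<theta> \<pi> n \<sigma> i \<le> pmf (\<pi> (Suc n) \<sigma> i) a * (cS ^ H * cO ^ H * obs S \<theta>' \<pi> n \<sigma> i)"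
    by (rule mult_left_mono) simp
  then show ?thesis
    using pmf_traj_pmf_snoc[OF \<theta>[unfolded n] \<sigma>] pmf_traj_pmf_snoc[OF \<theta>'[unfolded n] \<sigma>]
    unfolding \<tau> n by (simp only: mult.left_commute)
qed

text \<open>There are only \<open>H - 1\<close> transition steps; the parameters of the initial law
  fit into the missing one.\<close>

lemma card_model_parameters:
  fixes S A Ob H :: nat
  assumes "0 < S" "0 < A" "0 < H"
  shows "S + S * ((H - 1) * (A * S)) + Ob * (H * S) \<le> H * (S\<^sup>2 * A + S * Ob)"
proof -
  obtain h where h: "H = Suc h" using assms by (cases H) auto
  have "S \<le> S * S * A" using assms by (metis One_nat_def Suc_leI mult_le_mono mult.right_neutral mult.assoc nat_0_less_mult_iff le_refl)
  then show ?thesis unfolding h by (simp add: power2_eq_square algebra_simps)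
qed

lemma model_finite_cover:
  assumes pos: "0 < S" "0 < A" "0 < H" and m: "0 < m"
  shows "\<exists>N. finite N \<and> card N \<le> (m + 1) ^ (H * (S\<^sup>2 * A + S * Ob)) \<and> N \<subseteq> models S A Ob H \<and>
    (\<forall>\<theta>\<in>models S A Ob H. \<exists>\<theta>'\<in>N. dominated A Ob H (exp (real H * (real S + real Ob) / real m)) \<theta> \<theta>')"
proof -
  obtain CS where CS: "finite CS" "card CS \<le> (m + 1) ^ S" "\<And>q. q \<in> CS \<Longrightarrow> set_pmf q \<subseteq> {..<S}"
    "\<And>p. set_pmf p \<subseteq> {..<S} \<Longrightarrow> \<exists>q\<in>CS. \<forall>i. pmf p i \<le> (1 + real S / real m) * pmf q i"
    using pmf_finite_cover[OF m, of S] by blast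
  obtain CO where CO: "finite CO" "card CO \<le> (m + 1) ^ Ob" "\<And>q. q \<in> CO \<Longrightarrow> set_pmf q \<subseteq> {..<Ob}"
    "\<And>p. set_pmf p \<subseteq> {..<Ob} \<Longrightarrow> \<exists>q\<in>CO. \<forall>i. pmf p i \<le> (1 + real Ob / real m) * pmf q i"
    using pmf_finite_cover[OF m, of Ob] by blast
  define IT where "IT = {1..<H} \<times> {..<A} \<times> {..<S}"
  define IE where "IE = {1..H} \<times> {..<S}"
  define mk :: "nat pmf \<times> (nat \<times> nat \<times> nat \<Rightarrow> nat pmf) \<times> (nat \<times> nat \<Rightarrow> nat pmf) \<Rightarrow> model"
    where "mk = (\<lambda>(\<mu>, T, E). \<lparr>init_prob = \<mu>, trans_prob = (\<lambda>h a s. T (h, a, s)), emit_prob = (\<lambda>h s. E (h, s))\<rparr>)"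
  \<comment> \<open>\<open>models\<close> leaves the kernels free outside the relevant steps,
    actions and states; extensional functions fix them there, which keeps the family finite.\<close>
  define P where "P = CS \<times> (IT \<rightarrow>\<^sub>E CS) \<times> (IE \<rightarrow>\<^sub>E CO)"
  define N where "N = mk ` P"
  have finP: "finite P" unfolding P_def IT_def IE_def using CS CO by (intro finite_cartesian_product finite_PiE) auto
  have "card N \<le> card P" unfolding N_def using finP by (rule card_image_le)
  also have "\<dots> = card CS * (card CS ^ ((H - 1) * (A * S)) * card CO ^ (H * S))"
    by (simp add: P_def IT_def IE_def card_cartesian_product card_PiE)
  also have "\<dots> \<le> (m + 1) ^ S * (((m + 1) ^ S) ^ ((H - 1) * (A * S)) * ((m + 1) ^ Ob) ^ (H * S))"
    using CS CO by (intro mult_le_mono power_mono) auto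
  also have "\<dots> = (m + 1) ^ (S + S * ((H - 1) * (A * S)) + Ob * (H * S))"
    by (simp only: power_add power_mult[symmetric] mult.assoc)
  also have "\<dots> \<le> (m + 1) ^ (H * (S\<^sup>2 * A + S * Ob))"
    using card_model_parameters[OF pos] by (intro power_increasing) auto
  finally have "card N \<le> (m + 1) ^ (H * (S\<^sup>2 * A + S * Ob))" .
  moreover have "finite N" using finP by (simp add: N_def)
  moreover have sub: "N \<subseteq> models S A Ob H"
  proof
    fix \<theta> assume "\<theta> \<in> N"
    then obtain \<mu> T E where \<theta>: "\<theta> = mk (\<mu>, T, E)" "\<mu> \<in> CS" "T \<in> IT \<rightarrow>\<^sub>E CS" "E \<in> IE \<rightarrow>\<^sub>E CO"
      by (auto simp: N_def P_def)
    have "set_pmf \<mu> \<subseteq> {..<S}" using \<theta> CS by blast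
    moreover have "set_pmf (T (h, a, s)) \<subseteq> {..<S}" if "h \<in> {1..<H}" "a < A" "s < S" for h a s
      using that \<theta>(3) by (intro CS(3)) (auto simp: IT_def PiE_iff)
    moreover have "set_pmf (E (h, s)) \<subseteq> {..<Ob}" if "h \<in> {1..H}" "s < S" for h s
      using that \<theta>(4) by (intro CO(3)) (auto simp: IE_def PiE_iff)
    ultimately show "\<theta> \<in> models S A Ob H"
      unfolding \<theta>(1) models_def mk_def by simp
  qed
  moreover have "\<exists>\<theta>'\<in>N. dominated A Ob H (exp (real H * (real S + real Ob) / real m)) \<theta> \<theta>'"
    if \<theta>: "\<theta> \<in> models S A Ob H" for \<theta>
  proof -
    have "set_pmf (init_prob \<theta>) \<subseteq> {..<S}" using \<theta> by (simp add: models_def)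
    then obtain \<mu> where \<mu>: "\<mu> \<in> CS" "\<And>i. pmf (init_prob \<theta>) i \<le> (1 + real S / real m) * pmf \<mu> i"
      using CS(4) by blast
    have "\<forall>x\<in>IT. \<exists>q. q \<in> CS \<and> (\<forall>i. pmf (case x of (h, a, s) \<Rightarrow> trans_prob \<theta> h a s) i \<le> (1 + real S / real m) * pmf q i)"
    proof
      fix x assume "x \<in> IT"
      then have "set_pmf (case x of (h, a, s) \<Rightarrow> trans_prob \<theta> h a s) \<subseteq> {..<S}"
        using \<theta> by (cases x) (simp add: models_def IT_def)
      from CS(4)[OF this] show "\<exists>q. q \<in> CS \<and> (\<forall>i. pmf (case x of (h, a, s) \<Rightarrow> trans_prob \<theta> h a s) i \<le> (1 + real S / real m) * pmf q i)"
        by blast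
    qed
    from bchoice[OF this] obtain T where T: "\<And>x. x \<in> IT \<Longrightarrow> T x \<in> CS"
      "\<And>x i. x \<in> IT \<Longrightarrow> pmf (case x of (h, a, s) \<Rightarrow> trans_prob \<theta> h a s) i \<le> (1 + real S / real m) * pmf (T x) i"
      by blast
    have "\<forall>x\<in>IE. \<exists>q. q \<in> CO \<and> (\<forall>i. pmf (case x of (h, s) \<Rightarrow> emit_prob \<theta> h s) i \<le> (1 + real Ob / real m) * pmf q i)"
    proof
      fix x assume "x \<in> IE"
      then have "set_pmf (case x of (h, s) \<Rightarrow> emit_prob \<theta> h s) \<subseteq> {..<Ob}"
        using \<theta> by (cases x) (simp add: models_def IE_def)
      from CO(4)[OF this] show "\<exists>q. q \<in> CO \<and> (\<forall>i. pmf (case x of (h, s) \<Rightarrow> emit_prob \<theta> h s) i \<le> (1 + real Ob / real m) * pmf q i)"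
        by blast
    qed
    from bchoice[OF this] obtain E where E: "\<And>x. x \<in> IE \<Longrightarrow> E x \<in> CO"
      "\<And>x i. x \<in> IE \<Longrightarrow> pmf (case x of (h, s) \<Rightarrow> emit_prob \<theta> h s) i \<le> (1 + real Ob / real m) * pmf (E x) i"
      by blast
    define \<theta>' where "\<theta>' = mk (\<mu>, restrict T IT, restrict E IE)"
    have N': "\<theta>' \<in> N" unfolding \<theta>'_def N_def P_def using \<mu> T E by (intro imageI) auto
    have sel: "init_prob \<theta>' = \<mu>" "trans_prob \<theta>' h a s = restrict T IT (h, a, s)" "emit_prob \<theta>' h s = restrict E IE (h, s)" for h a s
      by (simp_all add: \<theta>'_def mk_def)
    have tr: "pmf (trans_prob \<theta> h a s) s' \<le> (1 + real S / real m) * pmf (trans_prob \<theta>' h a s) s'"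
      if "1 \<le> h" "h < H" "a < A" "s < S" for h a s s'
      using T(2)[of "(h, a, s)" s'] that by (simp add: sel IT_def)
    have em: "pmf (emit_prob \<theta> h s) i \<le> (1 + real Ob / real m) * pmf (emit_prob \<theta>' h s) i"
      if "1 \<le> h" "h \<le> H" "s < S" for h s i
      using E(2)[of "(h, s)" i] that by (simp add: sel IE_def)
    have "pmf (traj_pmf H \<theta> \<pi>) \<tau> \<le> exp (real H * (real S + real Ob) / real m) * pmf (traj_pmf H \<theta>' \<pi>) \<tau>"
      if \<pi>: "\<pi> \<in> policies A Ob H" for \<pi> \<tau>
    proof -
      have "pmf (traj_pmf H \<theta> \<pi>) \<tau> \<le> (1 + real S / real m) ^ H * (1 + real Ob / real m) ^ H * pmf (traj_pmf H \<theta>' \<pi>) \<tau>"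
        using \<mu>(2) tr em N' sub by (intro pmf_traj_pmf_dominated[OF \<theta> _ \<pi> pos(3)]) (auto simp: sel(1))
      also have "\<dots> \<le> (exp (real S / real m) ^ H * exp (real Ob / real m) ^ H) * pmf (traj_pmf H \<theta>' \<pi>) \<tau>"
        by (intro mult_right_mono mult_mono power_mono) auto
      also have "exp (real S / real m) ^ H * exp (real Ob / real m) ^ H = exp (real H * (real S + real Ob) / real m)"
        by (simp add: exp_of_nat_mult[symmetric] exp_add[symmetric] add_divide_distrib distrib_left)
      finally show ?thesis .
    qed
    then show ?thesis using N' by blast
  qed
  ultimately show ?thesis by blast
qed

text \<open>Cauchy-Schwarz for p - q = (sqrt p - sqrt q) (sqrt p + sqrt q). If b is the sum on the
  right, the squared norms of the factors are 2 - 2 b and 2 + 2 b, and the second is at most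
  4.\<close>

lemma l1_sq_le_hellinger:
  fixes p q :: "'a \<Rightarrow> real"
  assumes p: "\<And>x. x \<in> X \<Longrightarrow> 0 \<le> p x" "(\<Sum>x\<in>X. p x) = 1" and q: "\<And>x. x \<in> X \<Longrightarrow> 0 \<le> q x" "(\<Sum>x\<in>X. q x) = 1"
  shows "(\<Sum>x\<in>X. \<bar>p x - q x\<bar>)\<^sup>2 \<le> 8 * (1 - (\<Sum>x\<in>X. sqrt (p x * q x)))"
proof -
  define b where "b = (\<Sum>x\<in>X. sqrt (p x * q x))"
  have minus: "(\<Sum>x\<in>X. (sqrt (p x) - sqrt (q x))\<^sup>2) = 2 - 2 * b"
  proof -
    have "(\<Sum>x\<in>X. (sqrt (p x) - sqrt (q x))\<^sup>2) = (\<Sum>x\<in>X. p x + q x - 2 * sqrt (p x * q x))"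
      using p q by (intro sum.cong refl) (simp add: power2_diff real_sqrt_mult)
    then show ?thesis by (simp add: sum_subtractf sum.distrib p q b_def sum_distrib_left)
  qed
  have plus: "(\<Sum>x\<in>X. (sqrt (p x) + sqrt (q x))\<^sup>2) = 2 + 2 * b"
  proof -
    have "(\<Sum>x\<in>X. (sqrt (p x) + sqrt (q x))\<^sup>2) = (\<Sum>x\<in>X. p x + q x + 2 * sqrt (p x * q x))"
      using p q by (intro sum.cong refl) (simp add: power2_sum real_sqrt_mult)
    then show ?thesis by (simp add: sum.distrib p q b_def sum_distrib_left)
  qed
  have "b \<le> 1" using minus sum_nonneg[of X "\<lambda>x. (sqrt (p x) - sqrt (q x))\<^sup>2"] by simp
  have "(\<Sum>x\<in>X. \<bar>p x - q x\<bar>) = (\<Sum>x\<in>X. \<bar>sqrt (p x) - sqrt (q x)\<bar> * \<bar>sqrt (p x) + sqrt (q x)\<bar>)"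
  proof (intro sum.cong refl)
    fix x assume "x \<in> X"
    then have "p x - q x = (sqrt (p x) - sqrt (q x)) * (sqrt (p x) + sqrt (q x))"
      using p(1)[of x] q(1)[of x] by (simp add: algebra_simps)
    then show "\<bar>p x - q x\<bar> = \<bar>sqrt (p x) - sqrt (q x)\<bar> * \<bar>sqrt (p x) + sqrt (q x)\<bar>"
      by (simp only: abs_mult)
  qed
  then have "(\<Sum>x\<in>X. \<bar>p x - q x\<bar>)\<^sup>2 \<le> (\<Sum>x\<in>X. \<bar>sqrt (p x) - sqrt (q x)\<bar>\<^sup>2) * (\<Sum>x\<in>X. \<bar>sqrt (p x) + sqrt (q x)\<bar>\<^sup>2)"
    using Cauchy_Schwarz_ineq_sum[of "\<lambda>x. \<bar>sqrt (p x) - sqrt (q x)\<bar>" "\<lambda>x. \<bar>sqrt (p x) + sqrt (q x)\<bar>" X] by simp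
  also have "\<dots> = (2 - 2 * b) * (2 + 2 * b)" by (simp add: minus plus)
  also have "\<dots> \<le> (2 - 2 * b) * 4" using \<open>b \<le> 1\<close> by (intro mult_left_mono) auto
  finally show ?thesis by (simp add: b_def)
qed

section \<open>Likelihoods and the supermartingale\<close>

text \<open>A real product in place of the sum of extended logarithms; the two meet in
  \<open>log_likelihood_eq\<close> and in the rules for \<open>confidence_set\<close>.\<close>

definition likelihood :: "nat \<Rightarrow> model \<Rightarrow> dataset \<Rightarrow> real" where
  "likelihood H \<theta> D = (\<Prod>(\<pi>, \<tau>)\<leftarrow>D. pmf (traj_pmf H \<theta> \<pi>) \<tau>)"

lemma likelihood_Nil: "likelihood H \<theta> [] = 1"
  by (simp add: likelihood_def)

lemma likelihood_snoc: "likelihood H \<theta> (D @ [(\<pi>, \<tau>)]) = likelihood H \<theta> D * pmf (traj_pmf H \<theta> \<pi>) \<tau>"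
  by (simp add: likelihood_def)

lemma likelihood_nonneg: "0 \<le> likelihood H \<theta> D"
  by (induction D) (auto simp: likelihood_def)

lemma eln_mult: "0 \<le> x \<Longrightarrow> 0 \<le> y \<Longrightarrow> eln (x * y) = eln x + eln y"
  by (cases "x = 0"; cases "y = 0") (auto simp: eln_def ln_mult)

lemma eln_mono: "0 \<le> x \<Longrightarrow> x \<le> y \<Longrightarrow> eln x \<le> eln y"
  by (auto simp: eln_def)

lemma log_likelihood_eq: "log_likelihood H \<theta> D = eln (likelihood H \<theta> D)"
proof (induction D)
  case Nil
  then show ?case by (simp add: log_likelihood_def likelihood_def eln_def zero_ereal_def)
next
  case (Cons x D)
  then show ?case
    using eln_mult[OF pmf_nonneg likelihood_nonneg, of "traj_pmf H \<theta> (fst x)" "snd x" H \<theta> D]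
    by (simp add: log_likelihood_def likelihood_def case_prod_unfold)
qed

lemma confidence_setI:
  assumes "\<theta> \<in> initial_set S A Ob H \<alpha>" "0 < likelihood H \<theta> D"
    and le: "\<And>\<theta>'. \<theta>' \<in> models S A Ob H \<Longrightarrow> likelihood H \<theta>' D \<le> exp \<beta> * likelihood H \<theta> D"
  shows "\<theta> \<in> confidence_set S A Ob H \<alpha> \<beta> D"
proof -
  have "(SUP \<theta>'\<in>models S A Ob H. log_likelihood H \<theta>' D) \<le> eln (exp \<beta> * likelihood H \<theta> D)"
    unfolding log_likelihood_eq by (intro SUP_least eln_mono likelihood_nonneg le)
  also have "\<dots> = log_likelihood H \<theta> D + ereal \<beta>"
    using assms(2) by (simp add: log_likelihood_eq eln_def ln_mult)
  finally have "(SUP \<theta>'\<in>models S A Ob H. log_likelihood H \<theta>' D) - ereal \<beta> \<le> log_likelihood H \<theta> D"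
    by (simp add: ereal_minus_le)
  then show ?thesis
    using assms(1) by (simp add: confidence_set_def initial_set_def)
qed

text \<open>Positivity of the true likelihood, which holds on the support of the run, makes the
  logarithms finite, so the inequality can be exponentiated.\<close>

lemma confidence_setD:
  assumes \<theta>': "\<theta>' \<in> confidence_set S A Ob H \<alpha> \<beta> D" and \<theta>: "\<theta> \<in> models S A Ob H"
    and pos: "0 < likelihood H \<theta> D" and \<beta>: "0 \<le> \<beta>"
  shows "likelihood H \<theta> D \<le> exp \<beta> * likelihood H \<theta>' D"
proof (cases "D = []")
  case True
  \<comment> \<open>Without data no likelihood constraint is imposed, but both likelihoods are
    1.\<close>
  then show ?thesis using \<beta> by (simp add: likelihood_Nil)
next
  case False
  have "eln (likelihood H \<theta> D) \<le> (SUP \<theta>'\<in>models S A Ob H. log_likelihood H \<theta>' D)"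
    unfolding log_likelihood_eq using \<theta> by (intro SUP_upper)
  then have "eln (likelihood H \<theta> D) - ereal \<beta> \<le> (SUP \<theta>'\<in>models S A Ob H. log_likelihood H \<theta>' D) - ereal \<beta>"
    by (intro ereal_minus_mono) auto
  also have "\<dots> \<le> eln (likelihood H \<theta>' D)"
    using \<theta>' False by (simp add: confidence_set_def log_likelihood_eq)
  finally have le: "ereal (ln (likelihood H \<theta> D) - \<beta>) \<le> eln (likelihood H \<theta>' D)"
    using pos by (simp add: eln_def)
  then have pos': "0 < likelihood H \<theta>' D" by (auto simp: eln_def split: if_splits)
  then have "ln (likelihood H \<theta> D) \<le> ln (exp \<beta> * likelihood H \<theta>' D)"
    using le by (simp add: eln_def ln_mult)
  then show ?thesis using pos pos' by (subst (asm) ln_le_cancel_iff) auto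
qed

lemma confidence_set_models: "confidence_set S A Ob H \<alpha> \<beta> D \<subseteq> initial_set S A Ob H \<alpha>"
  by (auto simp: confidence_set_def)

text \<open>The Bhattacharyya coefficient; its defect from 1 is a squared Hellinger
  distance.\<close>

definition affinity :: "nat \<Rightarrow> nat \<Rightarrow> nat \<Rightarrow> model \<Rightarrow> model \<Rightarrow> policy \<Rightarrow> real" where
  "affinity A Ob H \<theta> \<theta>' \<pi> =
     (\<Sum>\<tau>\<in>histories A Ob H. sqrt (pmf (traj_pmf H \<theta> \<pi>) \<tau> * pmf (traj_pmf H \<theta>' \<pi>) \<tau>))"

lemma sum_pmf_traj_pmf:
  "\<theta> \<in> models S A Ob H \<Longrightarrow> \<pi> \<in> policies A Ob H \<Longrightarrow> 0 < H \<Longrightarrow>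
    (\<Sum>\<tau>\<in>histories A Ob H. pmf (traj_pmf H \<theta> \<pi>) \<tau>) = 1"
  by (intro sum_pmf_eq_1 finite_histories traj_pmf_support)

lemma traj_dist_sq_le_affinity:
  assumes "\<theta> \<in> models S A Ob H" "\<theta>' \<in> models S A Ob H" "\<pi> \<in> policies A Ob H" "0 < H"
  shows "(traj_dist A Ob H \<theta> \<theta>' \<pi>)\<^sup>2 \<le> 8 * (1 - affinity A Ob H \<theta> \<theta>' \<pi>)"
  unfolding traj_dist_def affinity_def
  using assms by (intro l1_sq_le_hellinger sum_pmf_traj_pmf) auto

lemma traj_dist_triangle:
  "traj_dist A Ob H \<theta> \<theta>'' \<pi> \<le> traj_dist A Ob H \<theta> \<theta>' \<pi> + traj_dist A Ob H \<theta>' \<theta>'' \<pi>"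
  unfolding traj_dist_def sum.distrib[symmetric] by (intro sum_mono) linarith

lemma traj_dist_commute: "traj_dist A Ob H \<theta> \<theta>' \<pi> = traj_dist A Ob H \<theta>' \<theta> \<pi>"
  unfolding traj_dist_def by (simp add: abs_minus_commute)

lemma traj_dist_nonneg: "0 \<le> traj_dist A Ob H \<theta> \<theta>' \<pi>"
  unfolding traj_dist_def by (intro sum_nonneg) auto

lemma traj_dist_dominated:
  assumes \<theta>: "\<theta> \<in> models S A Ob H" and \<theta>': "\<theta>' \<in> models S A Ob H" and \<pi>: "\<pi> \<in> policies A Ob H" and H: "0 < H"
    and c: "1 \<le> c" and dom: "\<And>\<tau>. pmf (traj_pmf H \<theta> \<pi>) \<tau> \<le> c * pmf (traj_pmf H \<theta>' \<pi>) \<tau>"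
  shows "traj_dist A Ob H \<theta> \<theta>' \<pi> \<le> 2 * (c - 1)"
proof -
  let ?p = "pmf (traj_pmf H \<theta> \<pi>)" and ?q = "pmf (traj_pmf H \<theta>' \<pi>)"
  \<comment> \<open>Both c q - p and c q - q are nonnegative, and their sum dominates the absolute
    value of their difference.\<close>
  have "\<bar>?p \<tau> - ?q \<tau>\<bar> \<le> 2 * c * ?q \<tau> - ?p \<tau> - ?q \<tau>" for \<tau>
    using dom[of \<tau>] mult_right_mono[OF c pmf_nonneg[of "traj_pmf H \<theta>' \<pi>" \<tau>]] by (simp add: abs_if)
  then have "traj_dist A Ob H \<theta> \<theta>' \<pi> \<le> (\<Sum>\<tau>\<in>histories A Ob H. 2 * c * ?q \<tau> - ?p \<tau> - ?q \<tau>)"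
    unfolding traj_dist_def by (intro sum_mono)
  also have "\<dots> = 2 * (c - 1)"
    by (simp add: sum_subtractf sum_distrib_left[symmetric] sum_pmf_traj_pmf[OF \<theta> \<pi> H] sum_pmf_traj_pmf[OF \<theta>' \<pi> H])
  finally show ?thesis .
qed

section \<open>The law of the run and its prefixes\<close>

lemma omle_run_support:
  assumes \<theta>: "\<theta> \<in> models S A Ob H" and H: "0 < H"
    and sel: "\<And>D. D \<in> lists (policies A Ob H \<times> histories A Ob H) \<Longrightarrow> snd (sel D) \<in> policies A Ob H"
  shows "D \<in> set_pmf (omle_run H \<theta> sel k) \<Longrightarrow> D \<in> lists (policies A Ob H \<times> histories A Ob H) \<and>
    length D = k \<and> 0 < likelihood H \<theta> D \<and> (\<forall>j<k. fst (D ! j) = snd (sel (take j D)))"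
proof (induction k arbitrary: D)
  case 0
  then show ?case by (simp add: likelihood_Nil)
next
  case (Suc k)
  then obtain D' \<tau> where D': "D' \<in> set_pmf (omle_run H \<theta> sel k)"
    "\<tau> \<in> set_pmf (traj_pmf H \<theta> (snd (sel D')))" "D = D' @ [(snd (sel D'), \<tau>)]"
    by (auto simp: Let_def)
  note IH = Suc.IH[OF D'(1)]
  have "snd (sel D') \<in> policies A Ob H" using IH sel by blast
  moreover from this have "\<tau> \<in> histories A Ob H" using traj_pmf_support[OF \<theta> _ H] D'(2) by blast
  moreover have "0 < pmf (traj_pmf H \<theta> (snd (sel D'))) \<tau>" using D'(2) by (simp add: pmf_positive)
  ultimately show ?case
    using IH D'(3) by (auto simp: likelihood_snoc nth_append less_Suc_eq)
qed

text \<open>Later episodes only append. Bounds at each time \<open>j\<close> thus become statements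
  about prefixes of one run, where a union bound over \<open>j\<close> is possible.\<close>

lemma map_take_omle_run:
  assumes len: "\<And>k D. D \<in> set_pmf (omle_run H \<theta> sel k) \<Longrightarrow> length D = k"
  shows "j \<le> k \<Longrightarrow> map_pmf (take j) (omle_run H \<theta> sel k) = omle_run H \<theta> sel j"
proof (induction k)
  case 0
  then show ?case by (simp add: map_return_pmf)
next
  case (Suc k)
  show ?case
  proof (cases "j = Suc k")
    case True
    have "map_pmf (take j) (omle_run H \<theta> sel (Suc k)) = map_pmf id (omle_run H \<theta> sel (Suc k))"
      using len[of _ "Suc k"] True by (intro map_pmf_cong refl) simp
    then show ?thesis using True by (simp add: pmf.map_id)
  next
    case False
    then have j: "j \<le> k" using Suc.prems by simp
    have "map_pmf (take j) (omle_run H \<theta> sel (Suc k)) =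
        bind_pmf (omle_run H \<theta> sel k) (\<lambda>D. map_pmf (\<lambda>\<tau>. take j (D @ [(snd (sel D), \<tau>)])) (traj_pmf H \<theta> (snd (sel D))))"
      by (simp add: Let_def map_bind_pmf pmf.map_comp o_def)
    also have "\<dots> = bind_pmf (omle_run H \<theta> sel k) (\<lambda>D. return_pmf (take j D))"
      using len j by (intro bind_pmf_cong refl) simp
    also have "\<dots> = map_pmf (take j) (omle_run H \<theta> sel k)" by (simp add: map_pmf_def)
    finally show ?thesis using Suc.IH[OF j] by simp
  qed
qed

text \<open>
  The square root of the likelihood ratio, renormalised by \<open>exp (1 - affinity)\<close> in every episode,
  is a supermartingale because \<open>x * exp (1 - x) \<le> 1\<close>.
\<close>

definition root_ratio :: "nat \<Rightarrow> nat \<Rightarrow> nat \<Rightarrow> model \<Rightarrow> model \<Rightarrow> dataset \<Rightarrow> real" where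
  "root_ratio A Ob H \<theta> \<theta>' D = sqrt (likelihood H \<theta>' D / likelihood H \<theta> D) *
     exp (\<Sum>t<length D. 1 - affinity A Ob H \<theta> \<theta>' (fst (D ! t)))"

lemma root_ratio_nonneg: "0 \<le> root_ratio A Ob H \<theta> \<theta>' D"
  by (simp add: root_ratio_def likelihood_nonneg)

lemma root_ratio_snoc:
  "root_ratio A Ob H \<theta> \<theta>' (D @ [(\<pi>, \<tau>)]) = root_ratio A Ob H \<theta> \<theta>' D *
     (sqrt (pmf (traj_pmf H \<theta>' \<pi>) \<tau> / pmf (traj_pmf H \<theta> \<pi>) \<tau>) * exp (1 - affinity A Ob H \<theta> \<theta>' \<pi>))"
proof -
  have "(\<Sum>t<length D. 1 - affinity A Ob H \<theta> \<theta>' (fst ((D @ [(\<pi>, \<tau>)]) ! t))) =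
      (\<Sum>t<length D. 1 - affinity A Ob H \<theta> \<theta>' (fst (D ! t)))"
    by (intro sum.cong refl) (simp add: nth_append)
  then show ?thesis
    by (simp add: root_ratio_def likelihood_snoc exp_add real_sqrt_mult real_sqrt_divide)
qed

text \<open>Weighting sqrt (q / p) by p gives sqrt (p q), whose sum is the affinity; working on the
  support of the true law avoids division by 0.\<close>

lemma nn_integral_root_ratio_step:
  assumes \<theta>: "\<theta> \<in> models S A Ob H" and \<pi>: "\<pi> \<in> policies A Ob H" and H: "0 < H"
  shows "(\<integral>\<^sup>+\<tau>. ennreal (sqrt (pmf (traj_pmf H \<theta>' \<pi>) \<tau> / pmf (traj_pmf H \<theta> \<pi>) \<tau>) *
     exp (1 - affinity A Ob H \<theta> \<theta>' \<pi>)) \<partial>traj_pmf H \<theta> \<pi>) \<le> 1"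
proof -
  let ?p = "pmf (traj_pmf H \<theta> \<pi>)" and ?q = "pmf (traj_pmf H \<theta>' \<pi>)" and ?b = "affinity A Ob H \<theta> \<theta>' \<pi>"
  let ?X = "set_pmf (traj_pmf H \<theta> \<pi>)"
  have sub: "?X \<subseteq> histories A Ob H" by (rule traj_pmf_support[OF \<theta> \<pi> H])
  then have fin: "finite ?X" using finite_histories finite_subset by blast
  have "(\<integral>\<^sup>+\<tau>. ennreal (sqrt (?q \<tau> / ?p \<tau>) * exp (1 - ?b)) \<partial>traj_pmf H \<theta> \<pi>) =
      (\<Sum>\<tau>\<in>?X. ennreal (sqrt (?q \<tau> / ?p \<tau>) * exp (1 - ?b)) * ennreal (?p \<tau>))"
    by (intro nn_integral_measure_pmf_finite fin) simp
  also have "\<dots> = (\<Sum>\<tau>\<in>?X. ennreal (sqrt (?p \<tau> * ?q \<tau>) * exp (1 - ?b)))"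
  proof (intro sum.cong refl)
    fix \<tau> assume "\<tau> \<in> ?X"
    then have pos: "0 < ?p \<tau>" by (simp add: pmf_positive)
    have "sqrt (?q \<tau> / ?p \<tau>) * ?p \<tau> = sqrt (?p \<tau> * ?q \<tau>)"
      using pos by (simp add: real_sqrt_divide real_sqrt_mult field_simps)
    then have "sqrt (?q \<tau> / ?p \<tau>) * exp (1 - ?b) * ?p \<tau> = sqrt (?p \<tau> * ?q \<tau>) * exp (1 - ?b)"
      by (simp only: ac_simps) (metis mult.assoc mult.commute)
    then show "ennreal (sqrt (?q \<tau> / ?p \<tau>) * exp (1 - ?b)) * ennreal (?p \<tau>) = ennreal (sqrt (?p \<tau> * ?q \<tau>) * exp (1 - ?b))"
      by (subst ennreal_mult[symmetric]) auto
  qed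
  also have "\<dots> = ennreal ((\<Sum>\<tau>\<in>?X. sqrt (?p \<tau> * ?q \<tau>)) * exp (1 - ?b))"
    by (simp add: sum_ennreal sum_distrib_right)
  also have "\<dots> \<le> ennreal (?b * exp (1 - ?b))"
    unfolding affinity_def using sub finite_histories
    by (intro ennreal_leI mult_right_mono sum_mono2) auto
  also have "\<dots> \<le> 1"
  proof -
    have "?b * exp (1 - ?b) \<le> exp (?b - 1) * exp (1 - ?b)"
      using exp_ge_add_one_self[of "?b - 1"] by (intro mult_right_mono) auto
    then show ?thesis by (simp add: exp_add[symmetric])
  qed
  finally show ?thesis .
qed

lemma nn_integral_root_ratio:
  assumes \<theta>: "\<theta> \<in> models S A Ob H" and H: "0 < H"
    and sel: "\<And>D. D \<in> lists (policies A Ob H \<times> histories A Ob H) \<Longrightarrow> snd (sel D) \<in> policies A Ob H"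
  shows "(\<integral>\<^sup>+D. ennreal (root_ratio A Ob H \<theta> \<theta>' D) \<partial>omle_run H \<theta> sel k) \<le> 1"
proof (induction k)
  case 0
  then show ?case by (simp add: root_ratio_def likelihood_Nil)
next
  case (Suc k)
  have "(\<integral>\<^sup>+D. ennreal (root_ratio A Ob H \<theta> \<theta>' D) \<partial>omle_run H \<theta> sel (Suc k)) =
      (\<integral>\<^sup>+D. (\<integral>\<^sup>+\<tau>. ennreal (root_ratio A Ob H \<theta> \<theta>' (D @ [(snd (sel D), \<tau>)])) \<partial>traj_pmf H \<theta> (snd (sel D))) \<partial>omle_run H \<theta> sel k)"
    by (simp add: Let_def)
  also have "\<dots> \<le> (\<integral>\<^sup>+D. ennreal (root_ratio A Ob H \<theta> \<theta>' D) \<partial>omle_run H \<theta> sel k)"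
  proof (rule nn_integral_mono_AE, subst AE_measure_pmf_iff, rule ballI)
    fix D assume "D \<in> set_pmf (omle_run H \<theta> sel k)"
    then have \<pi>: "snd (sel D) \<in> policies A Ob H" using omle_run_support[where sel = sel, OF \<theta> H sel] sel by blast
    let ?g = "\<lambda>\<tau>. sqrt (pmf (traj_pmf H \<theta>' (snd (sel D))) \<tau> / pmf (traj_pmf H \<theta> (snd (sel D))) \<tau>) *
      exp (1 - affinity A Ob H \<theta> \<theta>' (snd (sel D)))"
    have "(\<integral>\<^sup>+\<tau>. ennreal (root_ratio A Ob H \<theta> \<theta>' (D @ [(snd (sel D), \<tau>)])) \<partial>traj_pmf H \<theta> (snd (sel D))) =
        (\<integral>\<^sup>+\<tau>. ennreal (root_ratio A Ob H \<theta> \<theta>' D) * ennreal (?g \<tau>) \<partial>traj_pmf H \<theta> (snd (sel D)))"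
      unfolding root_ratio_snoc
      by (intro nn_integral_cong ennreal_mult root_ratio_nonneg) simp
    also have "\<dots> = ennreal (root_ratio A Ob H \<theta> \<theta>' D) * (\<integral>\<^sup>+\<tau>. ennreal (?g \<tau>) \<partial>traj_pmf H \<theta> (snd (sel D)))"
      by (intro nn_integral_cmult) simp
    also have "\<dots> \<le> ennreal (root_ratio A Ob H \<theta> \<theta>' D) * 1"
      by (intro mult_left_mono nn_integral_root_ratio_step[OF \<theta> \<pi> H]) simp
    finally show "(\<integral>\<^sup>+\<tau>. ennreal (root_ratio A Ob H \<theta> \<theta>' (D @ [(snd (sel D), \<tau>)])) \<partial>traj_pmf H \<theta> (snd (sel D)))
        \<le> ennreal (root_ratio A Ob H \<theta> \<theta>' D)" by simp
  qed
  also have "\<dots> \<le> 1" by (rule Suc.IH)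
  finally show ?case .
qed

lemma prob_root_ratio_gt:
  assumes \<theta>: "\<theta> \<in> models S A Ob H" and H: "0 < H"
    and sel: "\<And>D. D \<in> lists (policies A Ob H \<times> histories A Ob H) \<Longrightarrow> snd (sel D) \<in> policies A Ob H"
    and B: "0 < B" and j: "j \<le> K"
  shows "measure_pmf.prob (omle_run H \<theta> sel K) {D. B < root_ratio A Ob H \<theta> \<theta>' (take j D)} \<le> 1 / B"
proof -
  let ?R = "root_ratio A Ob H \<theta> \<theta>'"
  let ?M = "measure_pmf (omle_run H \<theta> sel j)"
  have "length D = k" if "D \<in> set_pmf (omle_run H \<theta> sel k)" for k D
    using omle_run_support[where sel = sel, OF \<theta> H sel that] by blast
  from map_take_omle_run[OF this j]
  have "measure_pmf.prob (omle_run H \<theta> sel j) {D. B < ?R D} = measure_pmf.prob (map_pmf (take j) (omle_run H \<theta> sel K)) {D. B < ?R D}"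
    by simp
  also have "\<dots> = measure_pmf.prob (omle_run H \<theta> sel K) {D. B < ?R (take j D)}"
    by (simp add: vimage_def)
  finally have "measure_pmf.prob (omle_run H \<theta> sel K) {D. B < ?R (take j D)} = measure_pmf.prob (omle_run H \<theta> sel j) {D. B < ?R D}" ..
  also have "\<dots> \<le> 1 / B"
  proof -
    have "emeasure ?M {D. B < ?R D} \<le> emeasure ?M {D \<in> UNIV. 1 \<le> ennreal (1 / B) * ennreal (?R D)}"
    proof (intro emeasure_mono subsetI)
      fix D assume "D \<in> {D. B < ?R D}"
      then have "1 \<le> 1 / B * ?R D" using B by (simp add: field_simps)
      then have "ennreal 1 \<le> ennreal (1 / B * ?R D)" by (rule ennreal_leI)
      also have "\<dots> = ennreal (1 / B) * ennreal (?R D)"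
        using B by (intro ennreal_mult root_ratio_nonneg) simp
      finally show "D \<in> {D \<in> UNIV. 1 \<le> ennreal (1 / B) * ennreal (?R D)}"
        by simp
    qed auto
    also have "\<dots> \<le> ennreal (1 / B) * (\<integral>\<^sup>+D. ennreal (?R D) * indicator UNIV D \<partial>?M)"
      by (rule nn_integral_Markov_inequality) auto
    also have "\<dots> \<le> ennreal (1 / B) * 1"
      using nn_integral_root_ratio[where sel = sel and \<theta>' = \<theta>' and k = j, OF \<theta> H sel] by (intro mult_left_mono) auto
    finally show ?thesis using B by (simp add: measure_pmf.emeasure_eq_measure)
  qed
  finally show ?thesis .
qed

text \<open>Markov's inequality allots \<delta> / (K card N) to each pair of a prefix and a cover
  element. Lengths below \<open>K\<close> suffice because each of the \<open>K\<close> choices uses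
  only earlier data.\<close>

lemma prob_root_ratio_bound:
  assumes \<theta>: "\<theta> \<in> models S A Ob H" and H: "0 < H"
    and sel: "\<And>D. D \<in> lists (policies A Ob H \<times> histories A Ob H) \<Longrightarrow> snd (sel D) \<in> policies A Ob H"
    and N: "finite N" "N \<noteq> {}" and K: "0 < K" and \<delta>: "0 < \<delta>"
  shows "1 - \<delta> \<le> measure_pmf.prob (omle_run H \<theta> sel K)
    {D. \<forall>j<K. \<forall>\<theta>'\<in>N. root_ratio A Ob H \<theta> \<theta>' (take j D) \<le> real K * real (card N) / \<delta>}"
proof -
  let ?B = "real K * real (card N) / \<delta>"
  let ?P = "measure_pmf.prob (omle_run H \<theta> sel K)"
  let ?bad = "\<lambda>j \<theta>'. {D. \<not> root_ratio A Ob H \<theta> \<theta>' (take j D) \<le> ?B}"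
  let ?U = "\<Union>j\<in>{..<K}. \<Union>\<theta>'\<in>N. ?bad j \<theta>'"
  have cN: "0 < card N" using N by (simp add: card_gt_0_iff)
  have B: "0 < ?B" using K \<delta> cN by simp
  have "?P ?U \<le> (\<Sum>j<K. ?P (\<Union>\<theta>'\<in>N. ?bad j \<theta>'))"
    by (intro measure_pmf.finite_measure_subadditive_finite) auto
  also have "\<dots> \<le> (\<Sum>j<K. \<Sum>\<theta>'\<in>N. ?P (?bad j \<theta>'))"
    using N by (intro sum_mono measure_pmf.finite_measure_subadditive_finite) auto
  also have "\<dots> \<le> (\<Sum>j<K. \<Sum>\<theta>'\<in>N. 1 / ?B)"
    unfolding not_le using prob_root_ratio_gt[where sel = sel and K = K, OF \<theta> H sel B]
    by (intro sum_mono) auto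
  also have "\<dots> = \<delta>" using K cN \<delta> by simp
  finally have "?P ?U \<le> \<delta>" .
  moreover have "{D. \<forall>j<K. \<forall>\<theta>'\<in>N. root_ratio A Ob H \<theta> \<theta>' (take j D) \<le> ?B} = UNIV - ?U"
    by blast
  moreover have "?P (UNIV - ?U) = 1 - ?P ?U"
    using measure_pmf.prob_compl[of ?U "omle_run H \<theta> sel K"] by simp
  ultimately show ?thesis by simp
qed

section \<open>Confidence sets and regret\<close>

lemma likelihood_append: "likelihood H \<theta> (D @ D') = likelihood H \<theta> D * likelihood H \<theta> D'"
  by (simp add: likelihood_def)

lemma likelihood_take_pos:
  assumes "0 < likelihood H \<theta> D"
  shows "0 < likelihood H \<theta> (take j D)"
proof -
  have "likelihood H \<theta> D = likelihood H \<theta> (take j D) * likelihood H \<theta> (drop j D)"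
    using likelihood_append[of H \<theta> "take j D" "drop j D"] by simp
  then have "likelihood H \<theta> (take j D) \<noteq> 0" using assms by auto
  then show ?thesis using likelihood_nonneg[of H \<theta> "take j D"] by linarith
qed

lemma likelihood_dominated:
  assumes dom: "\<And>\<pi> \<tau>. \<pi> \<in> P \<Longrightarrow> pmf (traj_pmf H \<theta> \<pi>) \<tau> \<le> c * pmf (traj_pmf H \<theta>' \<pi>) \<tau>" and c: "0 \<le> c"
  shows "D \<in> lists (P \<times> X) \<Longrightarrow> likelihood H \<theta> D \<le> c ^ length D * likelihood H \<theta>' D"
proof (induction D rule: rev_induct)
  case Nil
  then show ?case by (simp add: likelihood_Nil)
next
  case (snoc x D)
  obtain \<pi> \<tau> where x: "x = (\<pi>, \<tau>)" by fastforce
  then have "\<pi> \<in> P" "D \<in> lists (P \<times> X)" using snoc.prems by auto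
  then have "likelihood H \<theta> D * pmf (traj_pmf H \<theta> \<pi>) \<tau> \<le>
      (c ^ length D * likelihood H \<theta>' D) * (c * pmf (traj_pmf H \<theta>' \<pi>) \<tau>)"
    using c by (intro mult_mono snoc.IH dom mult_nonneg_nonneg likelihood_nonneg) auto
  then show ?case unfolding x likelihood_snoc by (simp add: ac_simps)
qed

lemma affinity_le_1:
  assumes "\<theta> \<in> models S A Ob H" "\<theta>' \<in> models S A Ob H" "\<pi> \<in> policies A Ob H" "0 < H"
  shows "affinity A Ob H \<theta> \<theta>' \<pi> \<le> 1"
  using order_trans[OF zero_le_power2 traj_dist_sq_le_affinity[OF assms]] by simp

lemma exp_inverse_le:
  assumes "0 < K"
  shows "exp (1 / real K) \<le> 1 + 2 / real K"
proof -
  have x: "0 \<le> 1 / real K" "1 / real K \<le> 1" using assms by auto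
  then have "exp (1 / real K) \<le> 1 + 1 / real K + (1 / real K)\<^sup>2" by (intro exp_bound)
  also have "(1 / real K)\<^sup>2 \<le> 1 / real K"
    using mult_left_le_one_le[of "1 / real K" "1 / real K"] x by (simp add: power2_eq_square)
  finally show ?thesis by simp
qed

text \<open>The deterministic situation before one episode, with \<open>\<Gamma>\<close> the
  logarithm of the level in the union bound. In \<open>1 + 2 * \<Gamma> \<le> \<beta>\<close> the 2
  undoes the square root in \<open>root_ratio\<close> and the 1 pays for passing to the
  cover.\<close>

locale likelihood_event =
  fixes S A Ob H K :: nat and \<alpha> \<beta> \<Gamma> :: real and \<theta> :: model and N :: "model set" and D :: dataset
  assumes pos: "0 < H" "0 < K" and \<theta>: "\<theta> \<in> initial_set S A Ob H \<alpha>"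
    and N: "N \<subseteq> models S A Ob H"
    and cover: "\<And>\<theta>'. \<theta>' \<in> models S A Ob H \<Longrightarrow> \<exists>\<theta>''\<in>N. dominated A Ob H (exp (1 / real K)) \<theta>' \<theta>''"
    and D: "D \<in> lists (policies A Ob H \<times> histories A Ob H)" "length D \<le> K" "0 < likelihood H \<theta> D"
    and ratio: "\<And>\<theta>'. \<theta>' \<in> N \<Longrightarrow> root_ratio A Ob H \<theta> \<theta>' D \<le> exp \<Gamma>"
    and \<beta>: "1 + 2 * \<Gamma> \<le> \<beta>" and \<Gamma>: "0 \<le> \<Gamma>"
begin

lemma \<theta>_model: "\<theta> \<in> models S A Ob H"
  using \<theta> by (simp add: initial_set_def)

lemma policy_nth: "t < length D \<Longrightarrow> fst (D ! t) \<in> policies A Ob H"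
  using D(1) nth_mem[of t D] by (auto simp: in_lists_conv_set mem_Times_iff)

lemma covered:
  assumes "\<theta>' \<in> models S A Ob H"
  obtains \<theta>'' where "\<theta>'' \<in> N"
    "\<And>\<pi> \<tau>. \<pi> \<in> policies A Ob H \<Longrightarrow> pmf (traj_pmf H \<theta>' \<pi>) \<tau> \<le> exp (1 / real K) * pmf (traj_pmf H \<theta>'' \<pi>) \<tau>"
    "likelihood H \<theta>' D \<le> exp 1 * likelihood H \<theta>'' D"
proof -
  obtain \<theta>'' where \<theta>'': "\<theta>'' \<in> N"
    "\<And>\<pi> \<tau>. \<pi> \<in> policies A Ob H \<Longrightarrow> pmf (traj_pmf H \<theta>' \<pi>) \<tau> \<le> exp (1 / real K) * pmf (traj_pmf H \<theta>'' \<pi>) \<tau>"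
    using cover[OF assms] by auto
  have "likelihood H \<theta>' D \<le> exp (1 / real K) ^ length D * likelihood H \<theta>'' D"
    by (rule likelihood_dominated[OF \<theta>''(2) _ D(1)]) auto
  also have "\<dots> \<le> exp 1 * likelihood H \<theta>'' D"
    using D(2) pos by (intro mult_right_mono likelihood_nonneg) (simp add: exp_of_nat_mult[symmetric] field_simps)
  finally have lik: "likelihood H \<theta>' D \<le> exp 1 * likelihood H \<theta>'' D" .
  show ?thesis by (rule that[OF \<theta>''(1) _ lik]) (rule \<theta>''(2))
qed

text \<open>Affinities are at most 1, so the exponential in \<open>root_ratio\<close> is at least 1
  and may be dropped: on the cover the likelihood ratio is at most exp (2 \<Gamma>).\<close>

lemma true_model_in_confidence_set: "\<theta> \<in> confidence_set S A Ob H \<alpha> \<beta> D"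
proof (rule confidence_setI[OF \<theta> D(3)])
  fix \<theta>' assume "\<theta>' \<in> models S A Ob H"
  then obtain \<theta>'' where \<theta>'': "\<theta>'' \<in> N" "likelihood H \<theta>' D \<le> exp 1 * likelihood H \<theta>'' D"
    by (rule covered) (rule that)
  let ?q = "likelihood H \<theta>'' D / likelihood H \<theta> D"
  have "0 \<le> (\<Sum>t<length D. 1 - affinity A Ob H \<theta> \<theta>'' (fst (D ! t)))"
    using affinity_le_1[OF \<theta>_model _ policy_nth pos(1)] \<theta>''(1) N by (intro sum_nonneg) auto
  then have "sqrt ?q * 1 \<le> root_ratio A Ob H \<theta> \<theta>'' D"
    unfolding root_ratio_def using D(3) likelihood_nonneg by (intro mult_left_mono) auto
  also have "\<dots> \<le> exp \<Gamma>" by (rule ratio[OF \<theta>''(1)])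
  finally have "sqrt ?q \<le> exp \<Gamma>" by simp
  then have "(sqrt ?q)\<^sup>2 \<le> (exp \<Gamma>)\<^sup>2"
    using D(3) likelihood_nonneg by (intro power_mono) auto
  then have "?q \<le> exp (2 * \<Gamma>)"
    using D(3) likelihood_nonneg by (simp add: exp_double)
  then have "likelihood H \<theta>'' D \<le> exp (2 * \<Gamma>) * likelihood H \<theta> D"
    using D(3) by (simp add: field_simps)
  then have "exp 1 * likelihood H \<theta>'' D \<le> exp 1 * (exp (2 * \<Gamma>) * likelihood H \<theta> D)"
    by (intro mult_left_mono) auto
  also have "\<dots> = exp (1 + 2 * \<Gamma>) * likelihood H \<theta> D" by (simp add: exp_add)
  also have "\<dots> \<le> exp \<beta> * likelihood H \<theta> D"
    using \<beta> D(3) by (intro mult_right_mono) auto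
  finally show "likelihood H \<theta>' D \<le> exp \<beta> * likelihood H \<theta> D" using \<theta>''(2) by linarith
qed

text \<open>Here the exponential in \<open>root_ratio\<close> carries the information. Membership
  keeps the likelihood ratio of the cover element above exp (- \<beta> - 1), so the sum of
  \<open>1 - affinity\<close> is at most \<Gamma> + (\<beta> + 1) / 2 \<le> \<beta>. Each episode
  contributes at most 32 / K + 16 (1 - affinity), the first term for the step from candidate to
  cover, and 32 + 16 \<beta> \<le> 48 \<beta>.\<close>

lemma confidence_set_squared_error:
  assumes "\<theta>' \<in> confidence_set S A Ob H \<alpha> \<beta> D"
  shows "(\<Sum>t<length D. (traj_dist A Ob H \<theta>' \<theta> (fst (D ! t)))\<^sup>2) \<le> 48 * \<beta>"
proof -
  have \<beta>1: "1 \<le> \<beta>" using \<beta> \<Gamma> by linarith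
  have \<theta>': "\<theta>' \<in> models S A Ob H"
    using subsetD[OF confidence_set_models assms] by (simp add: initial_set_def)
  obtain \<theta>'' where \<theta>'': "\<theta>'' \<in> N"
    "\<And>\<pi> \<tau>. \<pi> \<in> policies A Ob H \<Longrightarrow> pmf (traj_pmf H \<theta>' \<pi>) \<tau> \<le> exp (1 / real K) * pmf (traj_pmf H \<theta>'' \<pi>) \<tau>"
    "likelihood H \<theta>' D \<le> exp 1 * likelihood H \<theta>'' D"
    by (rule covered[OF \<theta>']) (rule that; assumption)
  have m'': "\<theta>'' \<in> models S A Ob H" using \<theta>'' N by auto
  let ?q = "likelihood H \<theta>'' D / likelihood H \<theta> D"
  let ?s = "\<Sum>t<length D. 1 - affinity A Ob H \<theta> \<theta>'' (fst (D ! t))"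
  have "likelihood H \<theta> D \<le> exp \<beta> * (exp 1 * likelihood H \<theta>'' D)"
    using confidence_setD[OF assms \<theta>_model D(3)] \<beta>1 \<theta>''(3)
    by (meson exp_ge_zero mult_left_mono order_trans zero_le_one)
  then have "exp (- (\<beta> + 1)) * likelihood H \<theta> D \<le> exp (- (\<beta> + 1)) * (exp \<beta> * (exp 1 * likelihood H \<theta>'' D))"
    by (intro mult_left_mono) auto
  also have "\<dots> = likelihood H \<theta>'' D"
    by (simp add: exp_add[symmetric] mult.assoc[symmetric])
  finally have "exp (- (\<beta> + 1)) \<le> ?q"
    using D(3) by (simp add: pos_le_divide_eq)
  define e where "e = - (\<beta> + 1) / 2"
  have "2 * e = - (\<beta> + 1)" by (simp add: e_def field_simps)
  then have "exp (2 * e) \<le> ?q" using \<open>exp (- (\<beta> + 1)) \<le> ?q\<close> by simp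
  then have "exp e \<le> sqrt ?q" unfolding exp_double by (rule real_le_rsqrt)
  then have "exp e * exp ?s \<le> root_ratio A Ob H \<theta> \<theta>'' D"
    unfolding root_ratio_def by (intro mult_right_mono) auto
  also have "\<dots> \<le> exp \<Gamma>" by (rule ratio[OF \<theta>''(1)])
  finally have "e + ?s \<le> \<Gamma>" by (simp only: exp_add[symmetric] exp_le_cancel_iff)
  then have s: "?s \<le> \<beta>" using \<beta> by (simp add: e_def field_simps)
  have each: "(traj_dist A Ob H \<theta>' \<theta> (fst (D ! t)))\<^sup>2 \<le> 32 / real K + 16 * (1 - affinity A Ob H \<theta> \<theta>'' (fst (D ! t)))"
    if t: "t < length D" for t
  proof -
    let ?\<pi> = "fst (D ! t)"
    let ?a = "traj_dist A Ob H \<theta>' \<theta>'' ?\<pi>" and ?b = "traj_dist A Ob H \<theta> \<theta>'' ?\<pi>"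
    note \<pi> = policy_nth[OF t]
    have "?a \<le> 2 * (exp (1 / real K) - 1)"
      using \<theta>''(2)[OF \<pi>] by (intro traj_dist_dominated[OF \<theta>' m'' \<pi> pos(1)]) auto
    also have "\<dots> \<le> 4 / real K" using exp_inverse_le[OF pos(2)] by simp
    finally have "?a\<^sup>2 \<le> (4 / real K)\<^sup>2" by (intro power_mono traj_dist_nonneg)
    also have "\<dots> \<le> 16 / real K"
      using pos(2) by (simp add: power2_eq_square field_simps)
    finally have a: "?a\<^sup>2 \<le> 16 / real K" .
    have b: "?b\<^sup>2 \<le> 8 * (1 - affinity A Ob H \<theta> \<theta>'' ?\<pi>)"
      by (rule traj_dist_sq_le_affinity[OF \<theta>_model m'' \<pi> pos(1)])
    have "traj_dist A Ob H \<theta>' \<theta> ?\<pi> \<le> ?a + ?b"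
      using traj_dist_triangle[of A Ob H \<theta>' \<theta> ?\<pi> \<theta>''] by (simp add: traj_dist_commute[of A Ob H \<theta>'' \<theta>])
    then have "(traj_dist A Ob H \<theta>' \<theta> ?\<pi>)\<^sup>2 \<le> (?a + ?b)\<^sup>2"
      by (intro power_mono traj_dist_nonneg)
    also have "\<dots> \<le> 2 * ?a\<^sup>2 + 2 * ?b\<^sup>2"
      using sum_squares_bound[of ?a ?b] by (simp add: power2_sum)
    also have "\<dots> \<le> 32 / real K + 16 * (1 - affinity A Ob H \<theta> \<theta>'' ?\<pi>)" using a b by simp
    finally show ?thesis .
  qed
  have "(\<Sum>t<length D. (traj_dist A Ob H \<theta>' \<theta> (fst (D ! t)))\<^sup>2) \<le>
      (\<Sum>t<length D. 32 / real K + 16 * (1 - affinity A Ob H \<theta> \<theta>'' (fst (D ! t))))"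
    using each by (intro sum_mono) auto
  also have "\<dots> = real (length D) * (32 / real K) + 16 * ?s"
    by (simp add: sum.distrib sum_distrib_left)
  also have "real (length D) * (32 / real K) \<le> 32"
    using D(2) pos(2) by (simp add: field_simps)
  finally show ?thesis using s \<beta>1 by linarith
qed

end

text \<open>The entries of the left inverses are at most 1/\<alpha>, and a column has
  \<open>S\<close> of them.\<close>

lemma initial_set_comparison:
  assumes \<theta>: "\<theta> \<in> models S A Ob H" and \<theta>': "\<theta>' \<in> initial_set S A Ob H \<alpha>" and \<alpha>: "0 < \<alpha>" and S: "0 < S" and H: "0 < H"
  shows "\<exists>L. model_comparison S A Ob H \<theta> \<theta>' L (real S / \<alpha>)"
proof -
  have "\<exists>L. (\<forall>l<S. \<forall>s<S. (\<Sum>i<Ob. L l i * pmf (emit_prob \<theta>' h s) i) = (if l = s then 1 else 0)) \<and>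
      (\<forall>l<S. \<forall>i<Ob. \<bar>L l i\<bar> \<le> 1 / \<alpha>)" if h: "1 \<le> h" "h \<le> H" for h
  proof -
    let ?M = "emission_matrix S Ob \<theta>' h"
    have "\<alpha> \<le> min_singular_value S Ob H \<theta>'" using \<theta>' by (simp add: initial_set_def)
    also have "\<dots> \<le> singular_value S ?M"
      unfolding min_singular_value_def using h by (intro Min_le) auto
    finally have sv: "\<alpha> \<le> singular_value S ?M" .
    have M: "?M \<in> carrier_mat Ob S" by (simp add: emission_matrix_def)
    have low: "\<alpha>\<^sup>2 * (\<Sum>s<S. (x s)\<^sup>2) \<le> (\<Sum>k<Ob. (\<Sum>s<S. pmf (emit_prob \<theta>' h s) k * x s)\<^sup>2)" for x
    proof -
      have "(\<Sum>k<Ob. (\<Sum>s<S. ?M $$ (k, s) * x s)\<^sup>2) = (\<Sum>k<Ob. (\<Sum>s<S. pmf (emit_prob \<theta>' h s) k * x s)\<^sup>2)"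
        by (simp add: emission_matrix_def)
      then show ?thesis using least_singular_value_lower_bound[OF M S sv \<alpha>, of x] by simp
    qed
    obtain L where "\<And>l s. l < S \<Longrightarrow> s < S \<Longrightarrow> (\<Sum>k<Ob. L l k * pmf (emit_prob \<theta>' h s) k) = (if l = s then 1 else 0)"
      "\<And>l k. l < S \<Longrightarrow> k < Ob \<Longrightarrow> \<bar>L l k\<bar> \<le> 1 / \<alpha>"
      by (rule bounded_left_inverse[where F = "\<lambda>k s. pmf (emit_prob \<theta>' h s) k", OF \<alpha> low]) (rule that; assumption)
    then show ?thesis by (intro exI[of _ L]) simp
  qed
  then have "\<forall>h\<in>{1..H}. \<exists>L. (\<forall>l<S. \<forall>s<S. (\<Sum>i<Ob. L l i * pmf (emit_prob \<theta>' h s) i) = (if l = s then 1 else 0)) \<and>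
      (\<forall>l<S. \<forall>i<Ob. \<bar>L l i\<bar> \<le> 1 / \<alpha>)" by simp
  from bchoice[OF this] obtain L where L: "\<And>h l s. h \<in> {1..H} \<Longrightarrow> l < S \<Longrightarrow> s < S \<Longrightarrow>
        (\<Sum>i<Ob. L h l i * pmf (emit_prob \<theta>' h s) i) = (if l = s then 1 else 0)"
      "\<And>h l i. h \<in> {1..H} \<Longrightarrow> l < S \<Longrightarrow> i < Ob \<Longrightarrow> \<bar>L h l i\<bar> \<le> 1 / \<alpha>"
    by blast
  have "(\<Sum>l<S. \<bar>L h l i\<bar>) \<le> real S / \<alpha>" if "h \<in> {1..H}" "i < Ob" for h i
  proof -
    have "(\<Sum>l<S. \<bar>L h l i\<bar>) \<le> (\<Sum>l<S. 1 / \<alpha>)" using that by (intro sum_mono L) auto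
    then show ?thesis by simp
  qed
  then have "model_comparison S A Ob H \<theta> \<theta>' L (real S / \<alpha>)"
    using assms L by unfold_locales (auto simp: initial_set_def)
  then show ?thesis by blast
qed

text \<open>One elliptical potential per error index. \<open>error_le_traj_dist\<close> turns
  \<open>R\<close> into a bound on the seminorms of round \<open>k\<close> under earlier policies,
  and \<open>traj_dist_le_errors\<close> returns from their values under the new policy to the
  distance.\<close>

lemma sum_traj_dist_bound:
  assumes \<theta>: "\<theta> \<in> models S A Ob H" and \<alpha>: "0 < \<alpha>" and S: "0 < S" and H: "0 < H"
    and \<theta>': "\<And>k. k < K \<Longrightarrow> \<theta>' k \<in> initial_set S A Ob H \<alpha>"
    and \<pi>: "\<And>k. k < K \<Longrightarrow> \<pi> k \<in> policies A Ob H"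
    and R: "\<And>k. k < K \<Longrightarrow> (\<Sum>t<k. (traj_dist A Ob H (\<theta>' k) \<theta> (\<pi> t))\<^sup>2) \<le> R"
  shows "(\<Sum>k<K. traj_dist A Ob H (\<theta>' k) \<theta> (\<pi> k)) \<le> real (card (error_indices S A Ob H)) *
    sqrt (2 * real K * real S * ((2 * (real S / \<alpha>) + 1)\<^sup>2 * (real S + R)) * ln (real S * (1 + real K)))"
proof -
  let ?I = "error_indices S A Ob H" and ?c = "2 * (real S / \<alpha>) + 1"
  have c: "0 \<le> ?c" using \<alpha> by simp
  have "\<forall>k\<in>{..<K}. \<exists>L. model_comparison S A Ob H \<theta> (\<theta>' k) L (real S / \<alpha>)"
    using initial_set_comparison[OF \<theta> \<theta>' \<alpha> S H] by blast
  from bchoice[OF this] obtain L where L: "\<And>k. k < K \<Longrightarrow> model_comparison S A Ob H \<theta> (\<theta>' k) (L k) (real S / \<alpha>)"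
    by auto
  define w where "w k = model_comparison.error_weight S Ob H \<theta> (\<theta>' k) (L k)" for k
  have w: "\<bar>w k e s\<bar> \<le> ?c" if "k < K" "e \<in> ?I" "s < S" for k e s
    unfolding w_def by (rule model_comparison.error_weight_bound[OF L[OF that(1)] that(2,3)])
  have up: "traj_dist A Ob H (\<theta>' k) \<theta> (\<pi> k) \<le> (\<Sum>e\<in>?I. error_value S A Ob H \<theta> (\<pi> k) e (w k e))" if "k < K" for k
    unfolding w_def by (rule model_comparison.traj_dist_le_errors[OF L[OF that] \<pi>[OF that]])
  have low: "error_value S A Ob H \<theta> (\<pi> t) e (w k e) \<le> ?c * traj_dist A Ob H (\<theta>' k) \<theta> (\<pi> t)"
    if "k < K" "t < K" "e \<in> ?I" for k t e
    unfolding w_def by (rule model_comparison.error_le_traj_dist[OF L[OF that(1)] \<pi>[OF that(2)] that(3)])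
  have each: "(\<Sum>k<K. error_value S A Ob H \<theta> (\<pi> k) e (w k e)) \<le>
      sqrt (2 * real K * real S * (real S * ?c\<^sup>2 + ?c\<^sup>2 * R) * ln (real S * (1 + real K)))" if e: "e \<in> ?I" for e
    unfolding error_value_def
  proof (rule l1_elliptical_potential[where x = "\<lambda>k. error_feature S H \<theta> (\<pi> k) e" and w = "\<lambda>k. w k e", OF S])
    fix k assume k: "k < K"
    show "(\<Sum>\<tau>\<in>histories A Ob (error_step H e). \<Sum>i<S. \<bar>error_feature S H \<theta> (\<pi> k) e \<tau> i\<bar>) \<le> 1"
      by (rule error_feature_sum_le_1[OF \<theta> \<pi>[OF k] H e])
    have "(\<Sum>i<S. (w k e i)\<^sup>2) \<le> (\<Sum>i<S. ?c\<^sup>2)"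
    proof (intro sum_mono)
      fix i assume "i \<in> {..<S}"
      then have "\<bar>w k e i\<bar> \<le> \<bar>?c\<bar>" using w[OF k e, of i] by simp
      then show "(w k e i)\<^sup>2 \<le> ?c\<^sup>2" by (simp only: abs_le_square_iff)
    qed
    then show "(\<Sum>i<S. (w k e i)\<^sup>2) \<le> real S * ?c\<^sup>2" by simp
    have "(\<Sum>t<k. (error_value S A Ob H \<theta> (\<pi> t) e (w k e))\<^sup>2) \<le> (\<Sum>t<k. (?c * traj_dist A Ob H (\<theta>' k) \<theta> (\<pi> t))\<^sup>2)"
      using k e by (intro sum_mono power_mono low) (auto simp: error_value_def intro!: sum_nonneg)
    also have "\<dots> = ?c\<^sup>2 * (\<Sum>t<k. (traj_dist A Ob H (\<theta>' k) \<theta> (\<pi> t))\<^sup>2)"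
      by (simp only: power_mult_distrib sum_distrib_left)
    also have "\<dots> \<le> ?c\<^sup>2 * R" by (intro mult_left_mono R[OF k]) simp
    finally show "(\<Sum>t<k. (\<Sum>\<tau>\<in>histories A Ob (error_step H e). \<bar>\<Sum>i<S. w k e i * error_feature S H \<theta> (\<pi> t) e \<tau> i\<bar>)\<^sup>2) \<le> ?c\<^sup>2 * R"
      unfolding error_value_def .
  qed
  have "(\<Sum>k<K. traj_dist A Ob H (\<theta>' k) \<theta> (\<pi> k)) \<le> (\<Sum>k<K. \<Sum>e\<in>?I. error_value S A Ob H \<theta> (\<pi> k) e (w k e))"
    using up by (intro sum_mono) auto
  also have "\<dots> = (\<Sum>e\<in>?I. \<Sum>k<K. error_value S A Ob H \<theta> (\<pi> k) e (w k e))" by (rule sum.swap)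
  also have "\<dots> \<le> (\<Sum>e\<in>?I. sqrt (2 * real K * real S * (real S * ?c\<^sup>2 + ?c\<^sup>2 * R) * ln (real S * (1 + real K))))"
    by (intro sum_mono each)
  also have "real S * ?c\<^sup>2 + ?c\<^sup>2 * R = ?c\<^sup>2 * (real S + R)" by (simp add: algebra_simps)
  finally show ?thesis by simp
qed

section \<open>Rewards and values\<close>

lemma reward_sum_bounds:
  assumes r: "r \<in> reward_functions Ob H" and \<tau>: "\<tau> \<in> histories A Ob H"
  shows "(\<Sum>h = 1..H. r h (fst (\<tau> ! (h - 1)))) \<in> {0..real H}"
proof -
  have "r h (fst (\<tau> ! (h - 1))) \<in> {0..1}" if "h \<in> {1..H}" for h
  proof -
    have "\<tau> ! (h - 1) \<in> {..<Ob} \<times> {..<A}"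
      using \<tau> that nth_mem[of "h - 1" \<tau>] by (auto simp: histories_def)
    then have "fst (\<tau> ! (h - 1)) < Ob" by auto
    then show ?thesis using r that by (simp add: reward_functions_def)
  qed
  then show ?thesis
    using sum_bounded_above[of "{1..H}" "\<lambda>h. r h (fst (\<tau> ! (h - 1)))" 1] by (auto intro!: sum_nonneg)
qed

lemma policy_value_eq:
  assumes "\<theta> \<in> models S A Ob H" "\<pi> \<in> policies A Ob H" "0 < H"
  shows "policy_value H r \<theta> \<pi> = (\<Sum>\<tau>\<in>histories A Ob H. (\<Sum>h = 1..H. r h (fst (\<tau> ! (h - 1)))) * pmf (traj_pmf H \<theta> \<pi>) \<tau>)"
  unfolding policy_value_def using traj_pmf_support[OF assms]
  by (intro integral_measure_pmf_real finite_histories) auto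

lemma policy_value_bounds:
  assumes "\<theta> \<in> models S A Ob H" "\<pi> \<in> policies A Ob H" "0 < H" "r \<in> reward_functions Ob H"
  shows "0 \<le> policy_value H r \<theta> \<pi>" "policy_value H r \<theta> \<pi> \<le> real H"
proof -
  have f: "0 \<le> (\<Sum>h = 1..H. r h (fst (\<tau> ! (h - 1))))" "(\<Sum>h = 1..H. r h (fst (\<tau> ! (h - 1)))) \<le> real H"
    if "\<tau> \<in> histories A Ob H" for \<tau>
    using reward_sum_bounds[OF assms(4) that] by (simp_all only: atLeastAtMost_iff)
  show "0 \<le> policy_value H r \<theta> \<pi>"
    unfolding policy_value_eq[OF assms(1-3)]
    by (rule sum_nonneg, rule mult_nonneg_nonneg, erule f) simp
  have "policy_value H r \<theta> \<pi> \<le> (\<Sum>\<tau>\<in>histories A Ob H. real H * pmf (traj_pmf H \<theta> \<pi>) \<tau>)"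
    unfolding policy_value_eq[OF assms(1-3)] by (rule sum_mono, rule mult_right_mono, erule f) simp
  then show "policy_value H r \<theta> \<pi> \<le> real H"
    by (simp add: sum_distrib_left[symmetric] sum_pmf_traj_pmf[OF assms(1-3)])
qed

lemma policy_value_diff:
  assumes \<theta>: "\<theta> \<in> models S A Ob H" and \<theta>': "\<theta>' \<in> models S A Ob H" and \<pi>: "\<pi> \<in> policies A Ob H" and H: "0 < H"
    and r: "r \<in> reward_functions Ob H"
  shows "policy_value H r \<theta>' \<pi> - policy_value H r \<theta> \<pi> \<le> real H * traj_dist A Ob H \<theta>' \<theta> \<pi>"
proof -
  let ?f = "\<lambda>\<tau>. \<Sum>h = 1..H. r h (fst (\<tau> ! (h - 1)))"
  let ?d = "\<lambda>\<tau>. pmf (traj_pmf H \<theta>' \<pi>) \<tau> - pmf (traj_pmf H \<theta> \<pi>) \<tau>"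
  have "policy_value H r \<theta>' \<pi> - policy_value H r \<theta> \<pi> = (\<Sum>\<tau>\<in>histories A Ob H. ?f \<tau> * ?d \<tau>)"
    unfolding policy_value_eq[OF \<theta> \<pi> H] policy_value_eq[OF \<theta>' \<pi> H]
    by (simp only: sum_subtractf right_diff_distrib)
  also have "\<dots> \<le> (\<Sum>\<tau>\<in>histories A Ob H. real H * \<bar>?d \<tau>\<bar>)"
  proof (intro sum_mono)
    fix \<tau> assume "\<tau> \<in> histories A Ob H"
    then have f: "0 \<le> ?f \<tau>" "?f \<tau> \<le> real H"
      using reward_sum_bounds[OF r] by (simp_all only: atLeastAtMost_iff)
    have "?f \<tau> * ?d \<tau> \<le> ?f \<tau> * \<bar>?d \<tau>\<bar>" using f by (intro mult_left_mono) auto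
    also have "\<dots> \<le> real H * \<bar>?d \<tau>\<bar>" using f by (intro mult_right_mono) auto
    finally show "?f \<tau> * ?d \<tau> \<le> real H * \<bar>?d \<tau>\<bar>" .
  qed
  finally show ?thesis by (simp add: traj_dist_def sum_distrib_left)
qed

lemma policies_nonempty: "0 < A \<Longrightarrow> policies A Ob H \<noteq> {}"
proof -
  assume "0 < A"
  then have "(\<lambda>_ _ _. return_pmf 0) \<in> policies A Ob H" by (simp add: policies_def)
  then show ?thesis by blast
qed

lemma sum_list_policies_nth:
  "(\<Sum>(\<pi>, \<tau>)\<leftarrow>D. f \<pi>) = (\<Sum>k<length D. f (fst (D ! k)))" for f :: "policy \<Rightarrow> real"
  by (simp add: sum_list_sum_nth atLeast0LessThan case_prod_unfold)

section \<open>Sample size\<close>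

text \<open>The arguments of both polynomials stand for \<open>S, A, O, H, 1/\<alpha>, ln (1/(\<epsilon>\<delta>))\<close>.\<close>

definition sample_scale :: "real \<times> real \<times> real \<times> real \<times> real \<times> real \<Rightarrow> real" where
  "sample_scale = (\<lambda>(s, a, ob, h, b, l).
     6152 * h\<^sup>2 * (h * ob * a * s)\<^sup>2 * s * (2 * s * b + 1)\<^sup>2 * (h * (s\<^sup>2 * a + s * ob)))"

definition sample_log :: "real \<times> real \<times> real \<times> real \<times> real \<times> real \<Rightarrow> real" where
  "sample_log = (\<lambda>(s, a, ob, h, b, l). s + a + ob + 2 * h + 3 * (1 + l\<^sup>2))"

text \<open>The threshold demanded by \<open>log_absorbed\<close> at x = K \<epsilon>^2; 4096 is
  64^2.\<close>

definition sample_poly :: "real \<times> real \<times> real \<times> real \<times> real \<times> real \<Rightarrow> real" where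
  "sample_poly v = 4 * sample_scale v * (sample_log v)\<^sup>2 + 4096 * (sample_scale v)\<^sup>2"

lemma real_polynomial_function_sample_poly: "real_polynomial_function sample_poly"
proof -
  have lin: "real_polynomial_function (\<lambda>v :: real \<times> real \<times> real \<times> real \<times> real \<times> real. fst v)"
    "real_polynomial_function (\<lambda>v :: real \<times> real \<times> real \<times> real \<times> real \<times> real. fst (snd v))"
    "real_polynomial_function (\<lambda>v :: real \<times> real \<times> real \<times> real \<times> real \<times> real. fst (snd (snd v)))"
    "real_polynomial_function (\<lambda>v :: real \<times> real \<times> real \<times> real \<times> real \<times> real. fst (snd (snd (snd v))))"
    "real_polynomial_function (\<lambda>v :: real \<times> real \<times> real \<times> real \<times> real \<times> real. fst (snd (snd (snd (snd v)))))"
    "real_polynomial_function (\<lambda>v :: real \<times> real \<times> real \<times> real \<times> real \<times> real. snd (snd (snd (snd (snd v)))))"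
    by (intro real_polynomial_function.intros(1) bounded_linear_intros)+
  show ?thesis
    unfolding sample_poly_def[abs_def] sample_scale_def sample_log_def case_prod_unfold power2_eq_square
    by (intro real_polynomial_function.intros(2-4) lin)
qed

text \<open>\<open>u\<close> may contain ln x, so the claim is implicit in x. With y the fourth root
  of x, ln y \<le> y gives (ln x)^2 \<le> 16 sqrt x. Half of x pays for 2 Q P^2, and sqrt x \<ge> 64
  Q lets the other half pay for 32 Q sqrt x.\<close>

lemma log_absorbed:
  fixes Q P x u :: real
  assumes Q: "1 \<le> Q" and P: "0 \<le> P" and x: "4 * Q * P\<^sup>2 + 4096 * Q\<^sup>2 \<le> x" and u: "0 \<le> u" "u \<le> P + ln x"
  shows "Q * u\<^sup>2 \<le> x"
proof -
  have "1 \<le> Q\<^sup>2" using Q by (rule one_le_power)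
  moreover have "0 \<le> 4 * Q * P\<^sup>2" using Q by simp
  ultimately have x1: "1 \<le> x" and x4096: "(64 * Q)\<^sup>2 \<le> x" and xP: "4 * Q * P\<^sup>2 \<le> x"
    using x by (auto simp: power_mult_distrib)
  define y where "y = sqrt (sqrt x)"
  have y: "0 < y" "y\<^sup>2 = sqrt x" using x1 by (auto simp: y_def)
  have "y ^ (2 * 2) = (y\<^sup>2)\<^sup>2" by (rule power_mult)
  then have y4: "x = y ^ 4" using x1 y(2) by simp
  have "ln x = 4 * ln y" using y(1) unfolding y4 by (simp add: ln_realpow)
  moreover have "ln y \<le> y" using ln_le_minus_one[OF y(1)] by linarith
  ultimately have "ln x \<le> 4 * y" by simp
  moreover have "0 \<le> ln x" using x1 by simp
  ultimately have "(ln x)\<^sup>2 \<le> (4 * y)\<^sup>2" by (intro power_mono) auto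
  then have lnx: "(ln x)\<^sup>2 \<le> 16 * sqrt x" using y(2) by (simp add: power_mult_distrib)
  have "u\<^sup>2 \<le> (P + ln x)\<^sup>2" using u by (intro power_mono) auto
  also have "\<dots> \<le> 2 * P\<^sup>2 + 2 * (ln x)\<^sup>2" using sum_squares_bound[of P "ln x"] by (simp add: power2_sum)
  finally have "u\<^sup>2 \<le> 2 * P\<^sup>2 + 32 * sqrt x" using lnx by linarith
  then have "Q * u\<^sup>2 \<le> Q * (2 * P\<^sup>2 + 32 * sqrt x)" using Q by (intro mult_left_mono) auto
  also have "\<dots> = 4 * Q * P\<^sup>2 / 2 + (64 * Q) * sqrt x / 2" by (simp add: algebra_simps)
  also have "(64 * Q) * sqrt x \<le> sqrt x * sqrt x"
    using x4096 x1 by (intro mult_right_mono real_le_rsqrt) auto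
  also have "sqrt x * sqrt x = x" using x1 by simp
  finally show ?thesis using xP by simp
qed

lemma card_error_indices_le:
  assumes "0 < S" "0 < A" "0 < Ob" "0 < H"
  shows "card (error_indices S A Ob H) \<le> 2 * (H * Ob * A * S)"
proof -
  obtain h where h: "H = Suc h" using assms by (cases H) auto
  define q where "q = Ob * A * S"
  have "S \<le> q" "Ob \<le> q" unfolding q_def using assms by auto
  then have "S + h * q + Ob \<le> 2 * (Suc h * q)" by (simp add: algebra_simps)
  moreover have "(H - 1) * Ob * A * S = h * q" "H * Ob * A * S = Suc h * q"
    by (simp_all add: h q_def algebra_simps)
  ultimately show ?thesis unfolding card_error_indices by (simp only:)
qed

lemma ln_nat_le: "0 < n \<Longrightarrow> ln (real n) \<le> real n"
  using ln_le_minus_one[of "real n"] by simp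

abbreviation regret_bound :: "nat \<Rightarrow> nat \<Rightarrow> nat \<Rightarrow> nat \<Rightarrow> nat \<Rightarrow> real \<Rightarrow> real \<Rightarrow> real" where
  "regret_bound S A Ob H K \<alpha> \<beta> \<equiv> real H * (real (card (error_indices S A Ob H)) *
      sqrt (2 * real K * real S * ((2 * (real S / \<alpha>) + 1)\<^sup>2 * (real S + 48 * \<beta>)) * ln (real S * (1 + real K))))"

text \<open>\<open>u\<close> dominates every logarithm that occurs, so the squared regret bound is
  at most K Q u^2, and \<open>log_absorbed\<close> at x = K \<epsilon>^2 removes the dependence of
  \<open>u\<close> on K. For the first claim, 6152 H^2 \<le> Q \<le> K \<epsilon>^2 \<le> K
  H^2.\<close>

lemma sample_size_sufficient:
  fixes S A Ob H K :: nat and \<epsilon> \<delta> \<alpha> :: real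
  assumes pos: "0 < S" "0 < A" "0 < Ob" "0 < H" "0 < K" and \<delta>: "0 < \<delta>" "\<delta> \<le> 1" and \<alpha>: "0 < \<alpha>"
    and \<epsilon>: "0 < \<epsilon>" "\<epsilon> \<le> real H"
    and K: "sample_poly (real S, real A, real Ob, real H, 1 / \<alpha>, ln ((1 / \<epsilon>) * (1 / \<delta>))) * (1 / \<epsilon>\<^sup>2) \<le> real K"
    and \<beta>: "\<beta> = omle_beta 8 S A Ob H K \<delta>"
  shows "2 \<le> K"
    and "regret_bound S A Ob H K \<alpha> \<beta>
      \<le> real K * \<epsilon>"
proof -
  define l where "l = ln ((1 / \<epsilon>) * (1 / \<delta>))"
  define v where "v = (real S, real A, real Ob, real H, 1 / \<alpha>, l)"
  define Q where "Q = sample_scale v"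
  define P where "P = sample_log v"
  define x where "x = real K * \<epsilon>\<^sup>2"
  define X where "X = real H * (real S ^ 2 * real A + real S * real Ob)"
  define C where "C = (2 * (real S / \<alpha>) + 1)\<^sup>2"
  define M where "M = real H * real Ob * real A * real S"
  define G where "G = real S + real A + real Ob + real H"
  define d where "d = ln (1 / \<delta>)"
  define u where "u = G + ln (real K) + d"
  have ge1: "1 \<le> real S" "1 \<le> real A" "1 \<le> real Ob" "1 \<le> real H" "1 \<le> real K" using pos by auto
  have "1 * 1 \<le> real S ^ 2 * real A" using ge1 by (intro mult_mono one_le_power) auto
  moreover have "0 \<le> real S * real Ob" by simp
  ultimately have "1 \<le> real S ^ 2 * real A + real S * real Ob" by linarith
  then have "1 * 1 \<le> X" unfolding X_def using ge1 by (intro mult_mono) auto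
  then have X1: "1 \<le> X" by simp
  have "1 * 1 * 1 * 1 \<le> M" unfolding M_def using ge1 by (intro mult_mono) auto
  then have M1: "1 \<le> M" by simp
  have C1: "1 \<le> C" unfolding C_def using \<alpha> by (intro one_le_power) simp
  have Q: "Q = real H ^ 2 * (6152 * (M\<^sup>2 * real S * C * X))"
    by (simp add: Q_def v_def sample_scale_def M_def C_def X_def)
  have "1 * 1 * 1 * 1 \<le> M\<^sup>2 * real S * C * X"
    using M1 C1 X1 ge1 by (intro mult_mono one_le_power) auto
  then have big: "6152 \<le> 6152 * (M\<^sup>2 * real S * C * X)" by simp
  then have QH: "real H ^ 2 * 6152 \<le> Q" unfolding Q by (intro mult_left_mono) auto
  moreover have "1 \<le> real H ^ 2" using ge1 by (intro one_le_power)
  ultimately have Q1: "1 \<le> Q" by linarith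
  have P: "P = G + real H + 3 * (1 + l\<^sup>2)" by (simp add: P_def v_def sample_log_def G_def)
  have P1: "1 \<le> P" unfolding P G_def using ge1 by (simp add: add_increasing2)
  have "(4 * Q * P\<^sup>2 + 4096 * Q\<^sup>2) * (1 / \<epsilon>\<^sup>2) \<le> real K"
    using K by (simp add: sample_poly_def Q_def P_def v_def l_def)
  then have x: "4 * Q * P\<^sup>2 + 4096 * Q\<^sup>2 \<le> x" using \<epsilon>(1) by (simp add: x_def field_simps)
  have xpos: "0 < x" using pos \<epsilon> by (simp add: x_def)
  have "1 * Q \<le> Q * Q" using Q1 by (intro mult_right_mono) auto
  then have "Q \<le> Q\<^sup>2" by (simp add: power2_eq_square)
  moreover have "0 \<le> 4 * Q * P\<^sup>2" using Q1 by simp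
  ultimately have "Q \<le> x" using x Q1 by linarith
  then have "real H ^ 2 * 6152 \<le> real K * \<epsilon>\<^sup>2" using QH by (simp add: x_def)
  also have "\<dots> \<le> real K * real H ^ 2" using \<epsilon> by (intro mult_left_mono power_mono) auto
  finally have "6152 \<le> real K" using pos(4) by (simp add: mult.commute)
  then show K2: "2 \<le> K" by simp
  have d0: "0 \<le> d" using \<delta> by (simp add: d_def)
  have lnK0: "0 \<le> ln (real K)" using ge1 by simp
  have G4: "4 \<le> G" using ge1 by (simp add: G_def)
  have u4: "4 \<le> u" using G4 lnK0 d0 by (simp add: u_def)
  have \<beta>': "\<beta> \<le> 16 * X * u"
  proof -
    have "ln (real (S * A * Ob * H * K)) = ln (real S) + ln (real A) + ln (real Ob) + ln (real H) + ln (real K)"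
      using pos by (simp add: ln_mult)
    also have "\<dots> \<le> G + ln (real K)"
      unfolding G_def using pos by (intro add_mono ln_nat_le order_refl)
    finally have "X * ln (real (S * A * Ob * H * K)) \<le> X * (G + ln (real K))"
      using X1 by (intro mult_left_mono) auto
    moreover have "ln (real K / \<delta>) = ln (real K) + d"
      using pos \<delta> by (simp add: d_def ln_div)
    moreover have "1 * (ln (real K) + d) \<le> X * (ln (real K) + d)"
      using X1 d0 lnK0 by (intro mult_right_mono) auto
    ultimately have "\<beta> \<le> 8 * (X * (G + ln (real K)) + X * (ln (real K) + d))"
      unfolding \<beta> omle_beta_def X_def[symmetric] by simp
    also have "\<dots> \<le> 8 * (X * u + X * u)"
    proof -
      have "G + ln (real K) \<le> u" "ln (real K) + d \<le> u"
        using d0 G4 by (simp_all add: u_def)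
      then have "X * (G + ln (real K)) \<le> X * u" "X * (ln (real K) + d) \<le> X * u"
        using X1 by (intro mult_left_mono; simp)+
      then show ?thesis by simp
    qed
    finally show ?thesis by simp
  qed
  have Xu: "1 * u \<le> X * u" using X1 u4 by (intro mult_right_mono) auto
  have Su: "real S \<le> u" unfolding u_def G_def using lnK0 d0 ge1 by linarith
  \<comment> \<open>769 = 1 + 48 * 16, with the 16 of \<open>\<beta>'\<close>. The 6152 in
    \<open>sample_scale\<close> is 8 * 769: a 4 from squaring the bound \<open>2 * M\<close> on the
    number of indices, and the 2 under the root.\<close>
  have S\<beta>: "real S + 48 * \<beta> \<le> 769 * (X * u)"
    using \<beta>' Xu Su by (simp add: mult.assoc)
  have lnSK: "ln (real S * (1 + real K)) \<le> u"
  proof -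
    have "ln (1 + real K) \<le> ln (2 * real K)" using ge1 by (subst ln_le_cancel_iff) auto
    also have "\<dots> = ln 2 + ln (real K)" using ge1 by (simp add: ln_mult)
    also have "\<dots> \<le> 1 + ln (real K)" using ln_le_minus_one[of "2 :: real"] by simp
    finally have "ln (1 + real K) \<le> 1 + ln (real K)" .
    moreover have "ln (real S * (1 + real K)) = ln (real S) + ln (1 + real K)"
      using ge1 by (simp add: ln_mult)
    ultimately show ?thesis
      using ln_nat_le[OF pos(1)] ge1 d0 unfolding u_def G_def by linarith
  qed
  have lnSK0: "0 \<le> ln (real S * (1 + real K))"
  proof -
    have "1 * 1 \<le> real S * (1 + real K)" using ge1 by (intro mult_mono) auto
    then show ?thesis by simp
  qed
  have "real (card (error_indices S A Ob H)) \<le> real (2 * (H * Ob * A * S))"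
    using card_error_indices_le[OF pos(1-4)] by (rule of_nat_mono)
  then have cI: "real (card (error_indices S A Ob H)) \<le> 2 * M" by (simp add: M_def)
  \<comment> \<open>3 l + 2 ln \<epsilon> = 3 d - ln \<epsilon> and ln \<epsilon> \<le> H explain
    the factor 3 and the second \<open>h\<close> in \<open>sample_log\<close>. There 1 + l^2 stands
    in for \<open>l\<close>, which is negative if \<epsilon> \<delta> > 1.\<close>
  have "u \<le> P + ln x"
  proof -
    have lnx: "ln x = ln (real K) + 2 * ln \<epsilon>"
      using pos \<epsilon> by (simp add: x_def ln_mult ln_realpow)
    have l: "l = d - ln \<epsilon>" using \<epsilon> \<delta> by (simp add: l_def d_def ln_mult ln_div)
    have "ln \<epsilon> \<le> ln (real H)" using \<epsilon> by (subst ln_le_cancel_iff) auto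
    then have "ln \<epsilon> \<le> real H" using ln_nat_le[OF pos(4)] by linarith
    moreover have "3 * l \<le> 3 * (1 + l\<^sup>2)"
    proof -
      have "0 \<le> (l - 1 / 2)\<^sup>2" by simp
      then show ?thesis by (simp add: power2_eq_square algebra_simps)
    qed
    ultimately show ?thesis unfolding u_def P lnx using l d0 by linarith
  qed
  then have main: "Q * u\<^sup>2 \<le> x" using u4 P1 by (intro log_absorbed[OF Q1 _ x]) auto
  let ?r = "2 * real K * real S * (C * (real S + 48 * \<beta>)) * ln (real S * (1 + real K))"
  have r: "?r \<le> 2 * real K * real S * (C * (769 * (X * u))) * u"
    using ge1 C1 S\<beta> lnSK lnSK0 X1 u4 by (intro mult_mono mult_left_mono) auto
  have "real H * (real (card (error_indices S A Ob H)) * sqrt ?r) \<le>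
      real H * (2 * M * sqrt (2 * real K * real S * (C * (769 * (X * u))) * u))"
  proof (rule mult_left_mono)
    let ?r' = "2 * real K * real S * (C * (769 * (X * u))) * u"
    have "real (card (error_indices S A Ob H)) * sqrt ?r \<le> real (card (error_indices S A Ob H)) * sqrt ?r'"
      by (rule mult_left_mono[OF real_sqrt_le_mono[OF r]]) simp
    also have "\<dots> \<le> 2 * M * sqrt ?r'"
      using C1 X1 u4 by (intro mult_right_mono[OF cI]) simp
    finally show "real (card (error_indices S A Ob H)) * sqrt ?r \<le> 2 * M * sqrt ?r'" .
  qed simp
  also have "\<dots> = sqrt ((real H * (2 * M))\<^sup>2 * (2 * real K * real S * (C * (769 * (X * u))) * u))"
    using M1 ge1 by (simp add: real_sqrt_mult)
  also have "(real H * (2 * M))\<^sup>2 * (2 * real K * real S * (C * (769 * (X * u))) * u) = real K * (Q * u\<^sup>2)"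
    unfolding Q by (simp add: power2_eq_square algebra_simps)
  also have "sqrt (real K * (Q * u\<^sup>2)) \<le> sqrt (real K * x)"
    using main by (intro real_sqrt_le_mono mult_left_mono) auto
  also have "real K * x = (real K * \<epsilon>)\<^sup>2" by (simp add: x_def power2_eq_square)
  also have "sqrt ((real K * \<epsilon>)\<^sup>2) = real K * \<epsilon>" using \<epsilon> by simp
  finally show "regret_bound S A Ob H K \<alpha> \<beta>
      \<le> real K * \<epsilon>"
    unfolding C_def .
qed

text \<open>Origin of the constant 8: put Y = X ln n and Z = ln (K / \<delta>). Since 2 n + 1 \<le>
  n^3, the cover has logarithmic size at most 3 Y, and 1 \<le> 2 Y, so 1 + 2 (Z + 3 Y) \<le> 8 Y + 2
  Z. The assumption \<open>2 \<le> K\<close> excludes n = 1, where ln n vanishes.\<close>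

lemma cover_size_le_beta:
  fixes S A Ob H K :: nat and \<delta> :: real
  assumes pos: "0 < S" "0 < A" "0 < Ob" "0 < H" and K: "2 \<le> K" and \<delta>: "0 < \<delta>" "\<delta> \<le> 1"
    and c: "0 < c" "c \<le> (2 * (S * A * Ob * H * K) + 1) ^ (H * (S\<^sup>2 * A + S * Ob))"
  shows "0 \<le> ln (real K * real c / \<delta>)" "1 + 2 * ln (real K * real c / \<delta>) \<le> omle_beta 8 S A Ob H K \<delta>"
proof -
  define n where "n = S * A * Ob * H * K"
  define X where "X = H * (S\<^sup>2 * A + S * Ob)"
  have "1 * 1 * 1 * 1 * 2 \<le> n" unfolding n_def using pos K by (intro mult_le_mono) auto
  then have n2: "2 \<le> n" by simp
  have X1: "1 \<le> X" unfolding X_def using pos by (simp add: Suc_le_eq)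
  have Z0: "0 \<le> ln (real K / \<delta>)" using K \<delta> by (intro ln_ge_zero) (simp add: field_simps)
  have split: "ln (real K * real c / \<delta>) = ln (real K / \<delta>) + ln (real c)"
    using K \<delta> c by (simp add: ln_mult ln_div)
  have "0 \<le> ln (real c)" using c by simp
  then show "0 \<le> ln (real K * real c / \<delta>)" using Z0 split by simp
  have "2 * n + 1 \<le> n ^ 3"
  proof -
    have "2 * 2 * n \<le> n * n * n" using n2 by (intro mult_le_mono) auto
    then show ?thesis using n2 unfolding power3_eq_cube by linarith
  qed
  then have "(2 * n + 1) ^ X \<le> (n ^ 3) ^ X" by (intro power_mono) auto
  then have "real c \<le> real ((n ^ 3) ^ X)"
    using c(2) by (intro of_nat_mono) (auto simp: n_def X_def)
  then have "ln (real c) \<le> ln (real n ^ (3 * X))"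
    using c(1) n2 by (subst ln_le_cancel_iff) (auto simp: power_mult)
  also have "\<dots> = 3 * (real X * ln (real n))" using n2 by (simp add: ln_realpow)
  finally have lc: "ln (real c) \<le> 3 * (real X * ln (real n))" .
  have "1 / 2 \<le> ln (2 :: real)"
  proof -
    have "exp (1 / 2 :: real) \<le> 1 + 1 / 2 + (1 / 2)\<^sup>2" by (intro exp_bound) auto
    then show ?thesis by (subst ln_ge_iff) (auto simp: power2_eq_square)
  qed
  moreover have "ln 2 \<le> ln (real n)" using n2 by (subst ln_le_cancel_iff) auto
  moreover have "1 * ln (real n) \<le> real X * ln (real n)" using X1 n2 by (intro mult_right_mono) auto
  ultimately have Y: "1 / 2 \<le> real X * ln (real n)" by linarith
  have "omle_beta 8 S A Ob H K \<delta> = 8 * (real X * ln (real n) + ln (real K / \<delta>))"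
    by (simp add: omle_beta_def X_def n_def)
  moreover have "1 + 2 * (z + t) \<le> 8 * (y + z)" if "t \<le> 3 * y" "1 / 2 \<le> y" "0 \<le> z" for y z t :: real
  proof -
    have "1 + (2 * z + 2 * t) \<le> 8 * y + 8 * z" using that by linarith
    then show ?thesis by (simp only: distrib_left)
  qed
  from this[OF lc Y Z0] have "1 + 2 * ln (real K * real c / \<delta>) \<le> 8 * (real X * ln (real n) + ln (real K / \<delta>))"
    unfolding split .
  ultimately show "1 + 2 * ln (real K * real c / \<delta>) \<le> omle_beta 8 S A Ob H K \<delta>" by simp
qed

section \<open>The guarantee\<close>

lemma prob_mono_on_support:
  assumes "p \<le> measure_pmf.prob M E" "\<And>x. x \<in> set_pmf M \<Longrightarrow> x \<in> E \<Longrightarrow> x \<in> F"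
  shows "p \<le> measure_pmf.prob M F"
proof -
  have "measure_pmf.prob M E = measure_pmf.prob M (E \<inter> set_pmf M)" by (simp add: measure_Int_set_pmf)
  also have "\<dots> \<le> measure_pmf.prob M F"
    using assms(2) by (intro measure_pmf.finite_measure_mono) auto
  finally show ?thesis using assms(1) by linarith
qed

lemma omle_rule_sel:
  assumes "omle_rule S A Ob H r \<alpha> \<beta> sel" "D \<in> lists (policies A Ob H \<times> histories A Ob H)"
  shows "snd (sel D) \<in> policies A Ob H"
    and "\<theta> \<in> confidence_set S A Ob H \<alpha> \<beta> D \<Longrightarrow> fst (sel D) \<in> confidence_set S A Ob H \<alpha> \<beta> D"
    and "\<theta> \<in> confidence_set S A Ob H \<alpha> \<beta> D \<Longrightarrow> \<pi> \<in> policies A Ob H \<Longrightarrow>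
      policy_value H r \<theta> \<pi> \<le> policy_value H r (fst (sel D)) (snd (sel D))"
proof -
  have sel: "sel D \<in> models S A Ob H \<times> policies A Ob H"
    and arg: "confidence_set S A Ob H \<alpha> \<beta> D \<noteq> {} \<Longrightarrow> is_arg_max (\<lambda>(\<theta>, \<pi>). policy_value H r \<theta> \<pi>)
             (\<lambda>x. x \<in> confidence_set S A Ob H \<alpha> \<beta> D \<times> policies A Ob H) (sel D)"
    using assms by (auto simp: omle_rule_def)
  show "snd (sel D) \<in> policies A Ob H" using sel by (auto simp: mem_Times_iff)
  {
    assume \<theta>: "\<theta> \<in> confidence_set S A Ob H \<alpha> \<beta> D"
    then have am: "is_arg_max (\<lambda>(\<theta>, \<pi>). policy_value H r \<theta> \<pi>)
             (\<lambda>x. x \<in> confidence_set S A Ob H \<alpha> \<beta> D \<times> policies A Ob H) (sel D)"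
      using arg by blast
    then show "fst (sel D) \<in> confidence_set S A Ob H \<alpha> \<beta> D"
      by (simp add: is_arg_max_def mem_Times_iff)
    assume "\<pi> \<in> policies A Ob H"
    then have "(\<theta>, \<pi>) \<in> confidence_set S A Ob H \<alpha> \<beta> D \<times> policies A Ob H" using \<theta> by simp
    then show "policy_value H r \<theta> \<pi> \<le> policy_value H r (fst (sel D)) (snd (sel D))"
      using am unfolding is_arg_max_def by (metis case_prod_conv case_prod_unfold not_less)
  }
qed

lemma optimal_value_le:
  assumes "0 < A" "\<And>\<pi>. \<pi> \<in> policies A Ob H \<Longrightarrow> policy_value H r \<theta> \<pi> \<le> v"
  shows "optimal_value A Ob H r \<theta> \<le> v"
  unfolding optimal_value_def using policies_nonempty[OF assms(1)] assms(2) by (rule cSUP_least)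

lemma omle_cover:
  fixes S A Ob H K :: nat
  assumes pos: "0 < S" "0 < A" "0 < Ob" "0 < H" "0 < K"
  shows "\<exists>N. finite N \<and> card N \<le> (2 * (S * A * Ob * H * K) + 1) ^ (H * (S\<^sup>2 * A + S * Ob)) \<and>
    N \<subseteq> models S A Ob H \<and> (\<forall>\<theta>\<in>models S A Ob H. \<exists>\<theta>'\<in>N. dominated A Ob H (exp (1 / real K)) \<theta> \<theta>')"
proof -
  \<comment> \<open>As S + O \<le> 2 S A O, this resolution brings the ratio for one trajectory down
    to exp (1 / K).\<close>
  let ?m = "2 * (S * A * Ob * H * K)"
  have m: "0 < ?m" using pos by simp
  have "S \<le> S * (A * Ob)" "Ob \<le> S * (A * Ob)" using pos by auto
  then have "S + Ob \<le> 2 * (S * (A * Ob))" by linarith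
  then have "(S + Ob) * (H * K) \<le> 2 * (S * (A * Ob)) * (H * K)" by (rule mult_le_mono1)
  then have "real ((S + Ob) * (H * K)) \<le> real ?m" by (intro of_nat_mono) (simp add: ac_simps)
  then have "real H * (real S + real Ob) / real ?m \<le> 1 / real K"
    using m pos by (simp add: field_simps)
  then have "exp (real H * (real S + real Ob) / real ?m) * pmf M \<tau> \<le> exp (1 / real K) * pmf M \<tau>" for M :: "trajectory pmf" and \<tau>
    by (intro mult_right_mono) auto
  then show ?thesis
    using model_finite_cover[OF pos(1,2,4) m, of Ob] by (meson order_trans)
qed

lemma omle_regret_on_event:
  fixes S A Ob H K :: nat
  assumes pos: "0 < S" "0 < A" "0 < Ob" "0 < H" "0 < K" and \<alpha>: "0 < \<alpha>"
    and \<theta>: "\<theta> \<in> initial_set S A Ob H \<alpha>" and r: "r \<in> reward_functions Ob H"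
    and rule: "omle_rule S A Ob H r \<alpha> \<beta> sel" and D: "D \<in> set_pmf (omle_run H \<theta> sel K)"
    and N: "N \<subseteq> models S A Ob H"
    and cover: "\<And>\<theta>'. \<theta>' \<in> models S A Ob H \<Longrightarrow> \<exists>\<theta>''\<in>N. dominated A Ob H (exp (1 / real K)) \<theta>' \<theta>''"
    and ratio: "\<And>j \<theta>'. j < K \<Longrightarrow> \<theta>' \<in> N \<Longrightarrow> root_ratio A Ob H \<theta> \<theta>' (take j D) \<le> exp \<Gamma>"
    and \<beta>: "1 + 2 * \<Gamma> \<le> \<beta>" and \<Gamma>: "0 \<le> \<Gamma>"
  shows "real K * optimal_value A Ob H r \<theta> - (\<Sum>(\<pi>, \<tau>)\<leftarrow>D. policy_value H r \<theta> \<pi>) \<le>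
    regret_bound S A Ob H K \<alpha> \<beta>"
proof -
  have model: "\<theta> \<in> models S A Ob H" using \<theta> by (simp add: initial_set_def)
  have sup: "D \<in> lists (policies A Ob H \<times> histories A Ob H)" "length D = K" "0 < likelihood H \<theta> D"
    "\<And>j. j < K \<Longrightarrow> fst (D ! j) = snd (sel (take j D))"
    using omle_run_support[where sel = sel, OF model pos(4) omle_rule_sel(1)[OF rule] D] by blast+
  define \<theta>' where "\<theta>' k = fst (sel (take k D))" for k
  define \<pi> where "\<pi> k = fst (D ! k)" for k
  have take_lists: "take k D \<in> lists (policies A Ob H \<times> histories A Ob H)" for k
    using sup(1) by (auto simp: in_lists_conv_set dest: in_set_takeD)
  \<comment> \<open>Episodes count from 0 here, so \<open>take k D\<close> is exactly what
    \<open>sel\<close> saw before it chose \<open>\<pi> k\<close>.\<close>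
  have event: "likelihood_event S A Ob H K \<alpha> \<beta> \<Gamma> \<theta> N (take k D)" if "k < K" for k
    using pos \<theta> N cover take_lists sup likelihood_take_pos[OF sup(3)] ratio[OF that] \<beta> \<Gamma> that
    by unfold_locales auto
  have true_in: "\<theta> \<in> confidence_set S A Ob H \<alpha> \<beta> (take k D)" if "k < K" for k
    by (rule likelihood_event.true_model_in_confidence_set[OF event[OF that]])
  have conf: "\<theta>' k \<in> confidence_set S A Ob H \<alpha> \<beta> (take k D)" if "k < K" for k
    unfolding \<theta>'_def by (rule omle_rule_sel(2)[OF rule take_lists true_in[OF that]])
  then have init: "\<theta>' k \<in> initial_set S A Ob H \<alpha>" if "k < K" for k
    using confidence_set_models that by blast
  have pol: "\<pi> k \<in> policies A Ob H" if "k < K" for k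
    unfolding \<pi>_def sup(4)[OF that] by (rule omle_rule_sel(1)[OF rule take_lists])
  have gap: "optimal_value A Ob H r \<theta> - policy_value H r \<theta> (\<pi> k) \<le> real H * traj_dist A Ob H (\<theta>' k) \<theta> (\<pi> k)"
    if k: "k < K" for k
  proof -
    have "policy_value H r \<theta> \<rho> \<le> policy_value H r (\<theta>' k) (\<pi> k)" if "\<rho> \<in> policies A Ob H" for \<rho>
      unfolding \<theta>'_def \<pi>_def sup(4)[OF k]
      by (rule omle_rule_sel(3)[OF rule take_lists true_in[OF k] that])
    then have "optimal_value A Ob H r \<theta> \<le> policy_value H r (\<theta>' k) (\<pi> k)"
      by (rule optimal_value_le[OF pos(2)])
    moreover have "\<theta>' k \<in> models S A Ob H" using init[OF k] by (simp add: initial_set_def)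
    then have "policy_value H r (\<theta>' k) (\<pi> k) - policy_value H r \<theta> (\<pi> k) \<le> real H * traj_dist A Ob H (\<theta>' k) \<theta> (\<pi> k)"
      by (rule policy_value_diff[OF model _ pol[OF k] pos(4) r])
    ultimately show ?thesis by linarith
  qed
  have sq: "(\<Sum>t<k. (traj_dist A Ob H (\<theta>' k) \<theta> (\<pi> t))\<^sup>2) \<le> 48 * \<beta>" if "k < K" for k
    using likelihood_event.confidence_set_squared_error[OF event[OF that] conf[OF that]] that sup(2)
    by (simp add: \<pi>_def)
  have "real K * optimal_value A Ob H r \<theta> - (\<Sum>(\<pi>, \<tau>)\<leftarrow>D. policy_value H r \<theta> \<pi>) =
      (\<Sum>k<K. optimal_value A Ob H r \<theta> - policy_value H r \<theta> (\<pi> k))"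
    by (simp add: sum_list_policies_nth sup(2) sum_subtractf \<pi>_def)
  also have "\<dots> \<le> (\<Sum>k<K. real H * traj_dist A Ob H (\<theta>' k) \<theta> (\<pi> k))"
    using gap by (intro sum_mono) auto
  also have "\<dots> = real H * (\<Sum>k<K. traj_dist A Ob H (\<theta>' k) \<theta> (\<pi> k))"
    by (simp add: sum_distrib_left)
  also have "\<dots> \<le> regret_bound S A Ob H K \<alpha> \<beta>"
    by (intro mult_left_mono sum_traj_dist_bound[OF model \<alpha> pos(1,4) init pol sq]) auto
  finally show ?thesis .
qed

lemma omle_guarantee:
  fixes S A Ob H K :: nat and \<epsilon> \<delta> \<alpha> :: real
  assumes pos: "0 < S" "0 < A" "0 < Ob" "0 < H" "0 < K" and \<delta>: "0 < \<delta>" "\<delta> \<le> 1" and \<alpha>: "0 < \<alpha>" and \<epsilon>: "0 < \<epsilon>"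
    and K: "sample_poly (real S, real A, real Ob, real H, 1 / \<alpha>, ln ((1 / \<epsilon>) * (1 / \<delta>))) * (1 / \<epsilon>\<^sup>2) \<le> real K"
    and \<theta>: "\<theta> \<in> initial_set S A Ob H \<alpha>" and r: "r \<in> reward_functions Ob H"
    and rule: "omle_rule S A Ob H r \<alpha> (omle_beta 8 S A Ob H K \<delta>) sel"
  shows "1 - \<delta> \<le> measure_pmf.prob (omle_run H \<theta> sel K)
    {D. optimal_value A Ob H r \<theta> - \<epsilon> \<le> (1 / real K) * (\<Sum>(\<pi>, \<tau>)\<leftarrow>D. policy_value H r \<theta> \<pi>)}"
proof (cases "\<epsilon> \<le> real H")
  \<comment> \<open>All values lie between 0 and H, so the claim is trivial. It is split off because
    K = 1 may be allowed here, and then \<beta> can be too small for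
    \<open>cover_size_le_beta\<close>.\<close>
  case False
  have model: "\<theta> \<in> models S A Ob H" using \<theta> by (simp add: initial_set_def)
  show ?thesis
  proof (rule prob_mono_on_support[where E = UNIV])
    fix D assume "D \<in> set_pmf (omle_run H \<theta> sel K)"
    then have "D \<in> lists (policies A Ob H \<times> histories A Ob H)"
      using omle_run_support[where sel = sel, OF model pos(4) omle_rule_sel(1)[OF rule]] by blast
    then have "0 \<le> (\<Sum>(\<pi>, \<tau>)\<leftarrow>D. policy_value H r \<theta> \<pi>)"
      using policy_value_bounds(1)[OF model _ pos(4) r] by (intro sum_list_nonneg) (auto simp: in_lists_conv_set)
    then have "0 \<le> (1 / real K) * (\<Sum>(\<pi>, \<tau>)\<leftarrow>D. policy_value H r \<theta> \<pi>)" by simp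
    moreover have "optimal_value A Ob H r \<theta> \<le> real H"
      by (rule optimal_value_le[OF pos(2) policy_value_bounds(2)[OF model _ pos(4) r]])
    ultimately show "D \<in> {D. optimal_value A Ob H r \<theta> - \<epsilon> \<le> (1 / real K) * (\<Sum>(\<pi>, \<tau>)\<leftarrow>D. policy_value H r \<theta> \<pi>)}"
      using False by simp
  qed (use \<delta> in simp)
next
  case True
  define \<beta> where "\<beta> = omle_beta 8 S A Ob H K \<delta>"
  have model: "\<theta> \<in> models S A Ob H" using \<theta> by (simp add: initial_set_def)
  obtain N where N: "finite N" "card N \<le> (2 * (S * A * Ob * H * K) + 1) ^ (H * (S\<^sup>2 * A + S * Ob))"
    "N \<subseteq> models S A Ob H" "\<And>\<theta>'. \<theta>' \<in> models S A Ob H \<Longrightarrow> \<exists>\<theta>''\<in>N. dominated A Ob H (exp (1 / real K)) \<theta>' \<theta>''"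
    using omle_cover[OF pos] by blast
  have ne: "N \<noteq> {}" using N(4)[OF model] by blast
  then have cN: "0 < card N" using N(1) by (simp add: card_gt_0_iff)
  define \<Gamma> where "\<Gamma> = ln (real K * real (card N) / \<delta>)"
  note K2 = sample_size_sufficient(1)[OF pos \<delta> \<alpha> \<epsilon> True K \<beta>_def]
  note regret = sample_size_sufficient(2)[OF pos \<delta> \<alpha> \<epsilon> True K \<beta>_def]
  have \<Gamma>: "0 \<le> \<Gamma>" "1 + 2 * \<Gamma> \<le> \<beta>"
    unfolding \<Gamma>_def \<beta>_def using cover_size_le_beta[OF pos(1-4) K2 \<delta> cN N(2)] by auto
  have exp\<Gamma>: "exp \<Gamma> = real K * real (card N) / \<delta>"
    unfolding \<Gamma>_def using pos(5) cN \<delta> by (intro exp_ln) simp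
  show ?thesis
  proof (rule prob_mono_on_support[OF prob_root_ratio_bound[where sel = sel, OF model pos(4) omle_rule_sel(1)[OF rule] N(1) ne pos(5) \<delta>(1)]])
    fix D assume D: "D \<in> set_pmf (omle_run H \<theta> sel K)"
      and "D \<in> {D. \<forall>j<K. \<forall>\<theta>'\<in>N. root_ratio A Ob H \<theta> \<theta>' (take j D) \<le> real K * real (card N) / \<delta>}"
    then have ratio: "root_ratio A Ob H \<theta> \<theta>' (take j D) \<le> exp \<Gamma>" if "j < K" "\<theta>' \<in> N" for j \<theta>'
      using that unfolding exp\<Gamma> by blast
    have "real K * optimal_value A Ob H r \<theta> - (\<Sum>(\<pi>, \<tau>)\<leftarrow>D. policy_value H r \<theta> \<pi>) \<le> real K * \<epsilon>"
      using omle_regret_on_event[OF pos \<alpha> \<theta> r rule[folded \<beta>_def] D N(3,4) ratio \<Gamma>(2,1)] regret by linarith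
    then show "D \<in> {D. optimal_value A Ob H r \<theta> - \<epsilon> \<le> (1 / real K) * (\<Sum>(\<pi>, \<tau>)\<leftarrow>D. policy_value H r \<theta> \<pi>)}"
      using pos(5) by (simp add: field_simps)
  qed
qed

theorem corollary5:
  shows "\<exists>(c::real) (p :: real \<times> real \<times> real \<times> real \<times> real \<times> real \<Rightarrow> real).
    c > 0 \<and> real_polynomial_function p \<and>
    (\<forall>(\<delta>::real) (\<epsilon>::real) (\<alpha>::real) (S::nat) (A::nat) (Ob::nat) (H::nat) (K::nat).
      0 < \<delta> \<and> \<delta> \<le> 1 \<and> 0 < \<epsilon> \<and> 0 < \<alpha> \<and> 0 < S \<and> 0 < A \<and> 0 < Ob \<and> 0 < H \<and> 0 < K \<and>
      real K \<ge> p (real S, real A, real Ob, real H, 1 / \<alpha>, ln ((1 / \<epsilon>) * (1 / \<delta>))) * (1 / \<epsilon>\<^sup>2) \<longrightarrow>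
      (\<forall>\<theta>\<in>models S A Ob H. \<forall>r\<in>reward_functions Ob H. \<forall>sel.
        min_singular_value S Ob H \<theta> \<ge> \<alpha> \<and>
        omle_rule S A Ob H r \<alpha> (omle_beta c S A Ob H K \<delta>) sel \<longrightarrow>
        measure_pmf.prob (omle_run H \<theta> sel K)
          {D. (1 / real K) * (\<Sum>(\<pi>, \<tau>)\<leftarrow>D. policy_value H r \<theta> \<pi>)
                \<ge> optimal_value A Ob H r \<theta> - \<epsilon>}
          \<ge> 1 - \<delta>))"
proof (rule exI[of _ 8], rule exI[of _ sample_poly], intro conjI allI impI ballI)
  show "real_polynomial_function sample_poly" by (rule real_polynomial_function_sample_poly)
next
  fix \<delta> \<epsilon> \<alpha> :: real and S A Ob H K :: nat and \<theta> r sel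
  assume "0 < \<delta> \<and> \<delta> \<le> 1 \<and> 0 < \<epsilon> \<and> 0 < \<alpha> \<and> 0 < S \<and> 0 < A \<and> 0 < Ob \<and> 0 < H \<and> 0 < K \<and>
      real K \<ge> sample_poly (real S, real A, real Ob, real H, 1 / \<alpha>, ln ((1 / \<epsilon>) * (1 / \<delta>))) * (1 / \<epsilon>\<^sup>2)"
    and "\<theta> \<in> models S A Ob H" "r \<in> reward_functions Ob H"
    and "min_singular_value S Ob H \<theta> \<ge> \<alpha> \<and> omle_rule S A Ob H r \<alpha> (omle_beta 8 S A Ob H K \<delta>) sel"
  then show "measure_pmf.prob (omle_run H \<theta> sel K)
          {D. (1 / real K) * (\<Sum>(\<pi>, \<tau>)\<leftarrow>D. policy_value H r \<theta> \<pi>)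
                \<ge> optimal_value A Ob H r \<theta> - \<epsilon>}
          \<ge> 1 - \<delta>"
    by (intro omle_guarantee[where \<alpha> = \<alpha>]) (auto simp: initial_set_def)
qed simp

end
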